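(* Let $n\ge 1$ and let $G$ be a rank $n$ GBS group. Then $G$ is subgroup separable if and only if $G$ is virtually $\mathbb{Z}^n$-by-free.
   Context: A rank $n$ generalized Baumslag–Solitar group (rank $n$ GBS group) is a group that is isomorphic to the fundamental group of a finite connected graph of groups in which every vertex group and every edge group is isomorphic to $\mathbb{Z}^n$. A subgroup $H$ of a group $G$ is separable in $G$ if $H$ is an intersection of finite-index subgroups of $G$ (equivalently, $H$ is closed in the profinite topology on $G$). A group is subgroup separable if every finitely generated subgroup is separable. A group is $\mathbb{Z}^n$-by-free if it has a normal subgroup isomorphic to $\mathbb{Z}^n$ with free quotient; it is virtually $\mathbb{Z}^n$-by-free if it has a finite-index subgroup that is $\mathbb{Z}^n$-by-free. (The trivial group and $\mathbb{Z}$ count as free groups.) *)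

theory Defs
  imports "HOL-Algebra.Generated_Groups" "HOL-Algebra.Product_Groups" "Graph_Theory.Digraph_Component"
begin

section \<open>Groups given by generators and relators\<close>

text \<open>The letter \<open>(s, True)\<close> stands for the generator \<open>s\<close> and \<open>(s, False)\<close> for its inverse.\<close>

type_synonym 's word = "('s \<times> bool) list"

abbreviation words :: "'s set \<Rightarrow> 's word set" where
  "words S \<equiv> lists (S \<times> UNIV)"

inductive_set word_rel :: "'s set \<Rightarrow> 's word set \<Rightarrow> ('s word \<times> 's word) set"
  for S :: "'s set" and R :: "'s word set"
  where
    refl: "w \<in> words S \<Longrightarrow> (w, w) \<in> word_rel S R"
  | sym: "(u, w) \<in> word_rel S R \<Longrightarrow> (w, u) \<in> word_rel S R"
  | trans: "(u, v) \<in> word_rel S R \<Longrightarrow> (v, w) \<in> word_rel S R \<Longrightarrow> (u, w) \<in> word_rel S R"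
  | cancel: "u @ [(s, b), (s, \<not> b)] @ v \<in> words S \<Longrightarrow>
      (u @ [(s, b), (s, \<not> b)] @ v, u @ v) \<in> word_rel S R"
  | relator: "r \<in> R \<Longrightarrow> u @ r @ v \<in> words S \<Longrightarrow> (u @ r @ v, u @ v) \<in> word_rel S R"

definition presented_group :: "'s set \<Rightarrow> 's word set \<Rightarrow> 's word set monoid" where
  "presented_group S R =
    \<lparr>carrier = words S // word_rel S R,
     monoid.mult = (\<lambda>A B. \<Union>a\<in>A. \<Union>b\<in>B. word_rel S R `` {a @ b}),
     one = word_rel S R `` {[]}\<rparr>"

abbreviation free_group :: "'s set \<Rightarrow> 's word set monoid" where
  "free_group S \<equiv> presented_group S {}"

text \<open>A basis of a group consists of elements of that group, so taking \<open>S\<close> in the type of the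
  elements loses no generality. The empty basis gives the trivial group, a singleton gives the
  infinite cyclic group.\<close>

definition is_free_group :: "('a, 'm) monoid_scheme \<Rightarrow> bool" where
  "is_free_group G \<longleftrightarrow> group G \<and> (\<exists>S :: 'a set. G \<cong> free_group S)"

lemma word_rel_words:
  assumes "(u, w) \<in> word_rel S R" shows "u \<in> words S \<and> w \<in> words S"
  using assms by induction auto

lemma word_rel_append:
  assumes "(u, u') \<in> word_rel S R" "(w, w') \<in> word_rel S R"
  shows "(u @ w, u' @ w') \<in> word_rel S R"
proof -
  have 1: "(x @ u, x @ u') \<in> word_rel S R" if "(u, u') \<in> word_rel S R" "x \<in> words S" for x u u'
    using that
  proof (induction)
    case (refl w)
    then show ?case by (intro word_rel.refl) auto
  next
    case (cancel u s b v)
    then show ?case using word_rel.cancel[of "x @ u" s b v S R] by auto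
  next
    case (relator r u v)
    then show ?case using word_rel.relator[of r R "x @ u" v S] by auto
  next
    case (sym u w)
    from sym.IH[OF sym.prems] show ?case by (rule word_rel.sym)
  next
    case (trans u v w)
    from trans.IH(1)[OF trans.prems] trans.IH(2)[OF trans.prems] show ?case
      by (rule word_rel.trans)
  qed
  have 2: "(u @ x, u' @ x) \<in> word_rel S R" if "(u, u') \<in> word_rel S R" "x \<in> words S" for x u u'
    using that
  proof (induction)
    case (refl w)
    then show ?case by (intro word_rel.refl) auto
  next
    case (cancel u s b v)
    then show ?case using word_rel.cancel[of u s b "v @ x" S R] by auto
  next
    case (relator r u v)
    then show ?case using word_rel.relator[of r R u "v @ x" S] by auto
  next
    case (sym u w)
    from sym.IH[OF sym.prems] show ?case by (rule word_rel.sym)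
  next
    case (trans u v w)
    from trans.IH(1)[OF trans.prems] trans.IH(2)[OF trans.prems] show ?case
      by (rule word_rel.trans)
  qed
  show ?thesis
    using word_rel.trans[OF 1[OF assms(2), of u] 2[OF assms(1), of w']]
      word_rel_words[OF assms(1)] word_rel_words[OF assms(2)] by simp
qed

lemma equiv_word_rel: "equiv (words S) (word_rel S R)"
proof (rule equivI)
  show "word_rel S R \<subseteq> words S \<times> words S" using word_rel_words by fast
  show "refl_on (words S) (word_rel S R)" by (rule refl_onI) (rule word_rel.refl)
  show "Relation.sym (word_rel S R)" by (rule symI) (rule word_rel.sym)
  show "Relation.trans (word_rel S R)" by (rule transI) (rule word_rel.trans)
qed

lemma presented_group_mult:
  assumes "u \<in> words S" "w \<in> words S"
  shows "(word_rel S R `` {u}) \<otimes>\<^bsub>presented_group S R\<^esub> (word_rel S R `` {w})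
    = word_rel S R `` {u @ w}"
proof -
  have "word_rel S R `` {a @ b} = word_rel S R `` {u @ w}"
    if "a \<in> word_rel S R `` {u}" "b \<in> word_rel S R `` {w}" for a b
  proof -
    have "(u, a) \<in> word_rel S R" "(w, b) \<in> word_rel S R" using that by simp_all
    from equiv_class_eq[OF equiv_word_rel word_rel_append[OF this]] show ?thesis by (rule HOL.sym)
  qed
  then have "(\<Union>a\<in>word_rel S R `` {u}. \<Union>b\<in>word_rel S R `` {w}. word_rel S R `` {a @ b})
    = (\<Union>a\<in>word_rel S R `` {u}. \<Union>b\<in>word_rel S R `` {w}. word_rel S R `` {u @ w})"
    by (intro SUP_cong) auto
  moreover have "u \<in> word_rel S R `` {u}" "w \<in> word_rel S R `` {w}"
    using word_rel.refl[OF assms(1)] word_rel.refl[OF assms(2)] by simp_all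
  ultimately show ?thesis unfolding presented_group_def by auto
qed

definition inverse_word :: "'s word \<Rightarrow> 's word" where
  "inverse_word w = rev (map (\<lambda>(s, b). (s, \<not> b)) w)"

lemma inverse_word_closed: "w \<in> words S \<Longrightarrow> inverse_word w \<in> words S"
  unfolding inverse_word_def by (auto simp: in_lists_conv_set)

lemma inverse_word_left: "w \<in> words S \<Longrightarrow> (inverse_word w @ w, []) \<in> word_rel S R"
proof (induction w)
  case Nil
  then show ?case by (auto simp: inverse_word_def intro: word_rel.refl)
next
  case (Cons a w)
  obtain s b where a: "a = (s, b)" by force
  have w: "w \<in> words S" "inverse_word w \<in> words S" "s \<in> S"
    using Cons.prems inverse_word_closed a by auto
  have "(inverse_word w @ [(s, \<not> b), (s, \<not> \<not> b)] @ w, inverse_word w @ w) \<in> word_rel S R"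
    by (rule word_rel.cancel) (use w in auto)
  then have "(inverse_word w @ [(s, \<not> b), (s, \<not> \<not> b)] @ w, []) \<in> word_rel S R"
    using Cons.IH[OF w(1)] by (rule word_rel.trans)
  then show ?case by (simp add: a inverse_word_def)
qed

lemma group_presented_group: "group (presented_group S R)"
proof (rule groupI)
  let ?P = "presented_group S R"
  define c where "c w = word_rel S R `` {w}" for w
  have car: "carrier ?P = c ` words S"
    by (auto simp: presented_group_def quotient_def c_def)
  have one: "\<one>\<^bsub>?P\<^esub> = c []" by (simp add: presented_group_def c_def)
  have mult: "c u \<otimes>\<^bsub>?P\<^esub> c w = c (u @ w)" if "u \<in> words S" "w \<in> words S" for u w
    unfolding c_def by (rule presented_group_mult[OF that])
  have app: "u @ w \<in> words S" if "u \<in> words S" "w \<in> words S" for u w :: "'a word"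
    using that by auto
  show "x \<otimes>\<^bsub>?P\<^esub> y \<in> carrier ?P" if xy: "x \<in> carrier ?P" "y \<in> carrier ?P" for x y
  proof -
    obtain u where u: "x = c u" "u \<in> words S" using xy(1) unfolding car by (rule imageE)
    obtain w where w: "y = c w" "w \<in> words S" using xy(2) unfolding car by (rule imageE)
    show ?thesis unfolding car u(1) w(1) mult[OF u(2) w(2)] by (rule imageI[OF app[OF u(2) w(2)]])
  qed
  show "\<one>\<^bsub>?P\<^esub> \<in> carrier ?P" unfolding car one by (rule imageI) simp
  show "x \<otimes>\<^bsub>?P\<^esub> y \<otimes>\<^bsub>?P\<^esub> z = x \<otimes>\<^bsub>?P\<^esub> (y \<otimes>\<^bsub>?P\<^esub> z)"
    if xyz: "x \<in> carrier ?P" "y \<in> carrier ?P" "z \<in> carrier ?P" for x y z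
  proof -
    obtain u where u: "x = c u" "u \<in> words S" using xyz(1) unfolding car by (rule imageE)
    obtain v where v: "y = c v" "v \<in> words S" using xyz(2) unfolding car by (rule imageE)
    obtain w where w: "z = c w" "w \<in> words S" using xyz(3) unfolding car by (rule imageE)
    show ?thesis
      unfolding u(1) v(1) w(1) mult[OF u(2) v(2)] mult[OF v(2) w(2)]
        mult[OF app[OF u(2) v(2)] w(2)] mult[OF u(2) app[OF v(2) w(2)]] by simp
  qed
  show "\<one>\<^bsub>?P\<^esub> \<otimes>\<^bsub>?P\<^esub> x = x" if x: "x \<in> carrier ?P" for x
  proof -
    obtain u where u: "x = c u" "u \<in> words S" using x unfolding car by (rule imageE)
    show ?thesis unfolding one u(1) mult[OF lists.Nil u(2)] by simp
  qed
  show "\<exists>y\<in>carrier ?P. y \<otimes>\<^bsub>?P\<^esub> x = \<one>\<^bsub>?P\<^esub>" if x: "x \<in> carrier ?P" for x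
  proof -
    obtain w where w: "x = c w" "w \<in> words S" using x unfolding car by (rule imageE)
    have "c (inverse_word w) \<otimes>\<^bsub>?P\<^esub> x = c []"
      unfolding w(1) mult[OF inverse_word_closed[OF w(2)] w(2)] unfolding c_def
      by (rule equiv_class_eq[OF equiv_word_rel inverse_word_left[OF w(2)]])
    then show ?thesis unfolding car one
      by (rule bexI[where x = "c (inverse_word w)"])
        (rule imageI[OF inverse_word_closed[OF w(2)]])
  qed
qed


section \<open>Graphs of groups and their fundamental groups\<close>

text \<open>The underlying graph is a directed multigraph (loops and parallel arcs are allowed): every
  geometric edge is represented by one arc, i.e. an orientation has been chosen. The group of an
  arc \<open>e\<close> is embedded into the vertex group at the tail and into the one at the head of \<open>e\<close>.\<close>

record ('v, 'e, 'g, 'h) gog =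
  base_graph :: "('v, 'e) pre_digraph"
  vgroup :: "'v \<Rightarrow> 'g monoid"
  egroup :: "'e \<Rightarrow> 'h monoid"
  tail_emb :: "'e \<Rightarrow> 'h \<Rightarrow> 'g"
  head_emb :: "'e \<Rightarrow> 'h \<Rightarrow> 'g"

locale graph_of_groups =
  fixes Y :: "('v, 'e, 'g, 'h) gog"
  assumes wf_graph: "wf_digraph (base_graph Y)"
    and group_vgroup: "v \<in> verts (base_graph Y) \<Longrightarrow> group (vgroup Y v)"
    and group_egroup: "e \<in> arcs (base_graph Y) \<Longrightarrow> group (egroup Y e)"
    and tail_emb_mon:
      "e \<in> arcs (base_graph Y) \<Longrightarrow>
        tail_emb Y e \<in> mon (egroup Y e) (vgroup Y (tail (base_graph Y) e))"
    and head_emb_mon: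
      "e \<in> arcs (base_graph Y) \<Longrightarrow>
        head_emb Y e \<in> mon (egroup Y e) (vgroup Y (head (base_graph Y) e))"

text \<open>The path group (in the sense of Serre) is the free product of all vertex groups and of the free
  group on the arcs, modulo \<open>e \<cdot> head_emb e a \<cdot> e\<inverse> = tail_emb e a\<close>. The generator \<open>Inl (v, g)\<close>
  is the element \<open>g\<close> of the vertex group at \<open>v\<close>, the generator \<open>Inr e\<close> is the arc \<open>e\<close>.\<close>

definition path_gens :: "('v, 'e, 'g, 'h) gog \<Rightarrow> ('v \<times> 'g + 'e) set" where
  "path_gens Y = Inl ` (SIGMA v : verts (base_graph Y). carrier (vgroup Y v)) \<union>
    Inr ` arcs (base_graph Y)"

definition path_relators :: "('v, 'e, 'g, 'h) gog \<Rightarrow> ('v \<times> 'g + 'e) word set" where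
  "path_relators Y =
    {[(Inl (v, g), True), (Inl (v, h), True), (Inl (v, g \<otimes>\<^bsub>vgroup Y v\<^esub> h), False)] | v g h.
       v \<in> verts (base_graph Y) \<and> g \<in> carrier (vgroup Y v) \<and> h \<in> carrier (vgroup Y v)} \<union>
    {[(Inr e, True), (Inl (head (base_graph Y) e, head_emb Y e a), True), (Inr e, False),
      (Inl (tail (base_graph Y) e, tail_emb Y e a), False)] | e a.
       e \<in> arcs (base_graph Y) \<and> a \<in> carrier (egroup Y e)}"

definition path_group ::
    "('v, 'e, 'g, 'h) gog \<Rightarrow> ('v \<times> 'g + 'e) word set monoid" where
  "path_group Y = presented_group (path_gens Y) (path_relators Y)"

text \<open>\<open>gog_path Y v w c\<close>: the word \<open>c\<close> has the form $g_0\, e_1\, g_1 \cdots e_k\, g_k$, where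
  $e_1, \ldots, e_k$ is an edge path from \<open>v\<close> to \<open>w\<close> (arcs may be traversed in either direction)
  and each $g_i$ lies in the group of the $i$-th vertex on that path.\<close>

inductive gog_path ::
    "('v, 'e, 'g, 'h) gog \<Rightarrow> 'v \<Rightarrow> 'v \<Rightarrow> ('v \<times> 'g + 'e) word \<Rightarrow> bool"
  for Y :: "('v, 'e, 'g, 'h) gog" and v :: 'v
  where
    base: "v \<in> verts (base_graph Y) \<Longrightarrow> g \<in> carrier (vgroup Y v) \<Longrightarrow>
      gog_path Y v v [(Inl (v, g), True)]"
  | forward: "gog_path Y v (tail (base_graph Y) e) c \<Longrightarrow> e \<in> arcs (base_graph Y) \<Longrightarrow>
      g \<in> carrier (vgroup Y (head (base_graph Y) e)) \<Longrightarrow>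
      gog_path Y v (head (base_graph Y) e) (c @ [(Inr e, True), (Inl (head (base_graph Y) e, g), True)])"
  | backward: "gog_path Y v (head (base_graph Y) e) c \<Longrightarrow> e \<in> arcs (base_graph Y) \<Longrightarrow>
      g \<in> carrier (vgroup Y (tail (base_graph Y) e)) \<Longrightarrow>
      gog_path Y v (tail (base_graph Y) e) (c @ [(Inr e, False), (Inl (tail (base_graph Y) e, g), True)])"

text \<open>The fundamental group at a base vertex: the subgroup of the path group consisting of the
  elements represented by closed paths at that vertex.\<close>

definition fundamental_group ::
    "('v, 'e, 'g, 'h) gog \<Rightarrow> 'v \<Rightarrow> ('v \<times> 'g + 'e) word set monoid" where
  "fundamental_group Y v = (path_group Y)
    \<lparr>carrier := {word_rel (path_gens Y) (path_relators Y) `` {c} | c. gog_path Y v v c}\<rparr>"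


section \<open>Generalized Baumslag-Solitar groups of rank n\<close>

definition Zpow :: "nat \<Rightarrow> (nat \<Rightarrow> int) monoid" where
  "Zpow n = product_group {..<n} (\<lambda>_. integer_group)"

text \<open>A finite graph of groups with all vertex and edge groups isomorphic to \<open>Zpow n\<close> is isomorphic
  to one with vertices and edges in \<open>nat\<close> and groups carried by \<open>nat \<Rightarrow> int\<close>, so fixing these types
  loses no generality. Since the graph is connected, the choice of base vertex is immaterial up to
  isomorphism. \<open>Digraph_Component.connected\<close> is connectedness of the underlying undirected graph
  and includes nonemptiness.\<close>

definition GBS_group :: "nat \<Rightarrow> ('a, 'm) monoid_scheme \<Rightarrow> bool" where
  "GBS_group n G \<longleftrightarrow> group G \<and>
    (\<exists>(Y :: (nat, nat, nat \<Rightarrow> int, nat \<Rightarrow> int) gog) v.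
       graph_of_groups Y \<and> fin_digraph (base_graph Y) \<and> Digraph_Component.connected (base_graph Y) \<and>
       (\<forall>u \<in> verts (base_graph Y). vgroup Y u \<cong> Zpow n) \<and>
       (\<forall>e \<in> arcs (base_graph Y). egroup Y e \<cong> Zpow n) \<and>
       v \<in> verts (base_graph Y) \<and> G \<cong> fundamental_group Y v)"


section \<open>Subgroup separability and virtually Zpow-by-free groups\<close>

definition finite_index_subgroup :: "'a set \<Rightarrow> ('a, 'm) monoid_scheme \<Rightarrow> bool" where
  "finite_index_subgroup H G \<longleftrightarrow> subgroup H G \<and> finite (rcosets\<^bsub>G\<^esub> H)"

definition separable_subgroup :: "'a set \<Rightarrow> ('a, 'm) monoid_scheme \<Rightarrow> bool" where
  "separable_subgroup H G \<longleftrightarrow>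
    (\<exists>\<F>. \<F> \<noteq> {} \<and> (\<forall>K \<in> \<F>. finite_index_subgroup K G) \<and> H = \<Inter>\<F>)"

definition subgroup_separable :: "('a, 'm) monoid_scheme \<Rightarrow> bool" where
  "subgroup_separable G \<longleftrightarrow>
    (\<forall>S. finite S \<and> S \<subseteq> carrier G \<longrightarrow> separable_subgroup (generate G S) G)"

definition Zpow_by_free :: "nat \<Rightarrow> ('a, 'm) monoid_scheme \<Rightarrow> bool" where
  "Zpow_by_free n G \<longleftrightarrow>
    (\<exists>N. N \<lhd> G \<and> G\<lparr>carrier := N\<rparr> \<cong> Zpow n \<and> is_free_group (G Mod N))"

definition virtually_Zpow_by_free :: "nat \<Rightarrow> ('a, 'm) monoid_scheme \<Rightarrow> bool" where
  "virtually_Zpow_by_free n G \<longleftrightarrow>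
    (\<exists>H. finite_index_subgroup H G \<and> Zpow_by_free n (G\<lparr>carrier := H\<rparr>))"

end

theory Submission
  imports Defs "HOL-Library.Function_Algebras" "HOL-Library.Countable_Set"
    "HOL-Algebra.SndIsomorphismGrp" "HOL-Algebra.Multiplicative_Group"
begin

text \<open>Let \<open>K\<close> be an extension of \<open>A\<close>, a free abelian group of rank \<open>n\<close>, by a free group, and let
  \<open>g\<close> lie outside a finitely generated subgroup \<open>H\<close> of \<open>K\<close>. Since \<open>A / (H \<inter> A)\<close> is residually
  finite, \<open>g\<close> lies outside \<open>H m A\<close> for some \<open>m > 0\<close>. The quotient \<open>K / m A\<close> is virtually free, and
  free groups are subgroup separable by M. Hall's theorem; subgroup separability passes to
  overgroups of finite index by Schreier's lemma.

  Conversely, the edge groups of a GBS group \<open>G\<close> have finite index in the vertex groups. If they are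
  separable in \<open>G\<close>, then some normal subgroup \<open>L\<close> of finite index in \<open>G\<close> meets every vertex stabilizer
  of the Bass-Serre tree inside all adjacent edge stabilizers. Hence \<open>L\<close> meets all vertex stabilizers
  in one and the same subgroup \<open>A\<close>, which is normal in \<open>G\<close>, and \<open>L / A\<close> acts freely on the
  tree, so it is free. The tree itself can be avoided: choose a spanning tree in the finite quotient
  graph by \<open>L\<close>. A cocycle counting the edges outside the spanning tree maps \<open>L\<close> to the free group on these
  edges, and closing up these edges along the spanning tree gives the inverse modulo \<open>A\<close>.\<close>

section \<open>Presented groups\<close>

text \<open>The subgroup \<open>m A\<close> consists of the m-th powers of elements of
  \<open>A\<close>, so conjugation by all of \<open>K\<close> preserves it, whereas
  \<open>H \<inter> A\<close> is normalized by \<open>H\<close> but not necessarily by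
  \<open>K\<close>. The free quotient lifts to \<open>K\<close>, and the lift together with
  \<open>m A\<close> is a finite-index subgroup that meets \<open>A\<close> only in
  \<open>m A\<close>.

  In the converse, the hypothesis concerns subgroups of \<open>G\<close>, while the index of an edge
  group is measured inside a vertex group; comparing the two needs vertex groups to embed in the
  path group. Instead of a normal form theorem, an explicit action on the natural numbers separates
  the elements of a vertex group. Finiteness of the index rests on counting integer points in boxes,
  and it leaves only finitely many cosets for separability to exclude. A finite quotient of
  \<open>G\<close> is extended to the whole path group by a retraction, so that all vertices can be
  treated at once; the cocycle lives on the path group as well, because tree paths are usually not
  closed.\<close>

abbreviation word_class :: "'s set \<Rightarrow> 's word set \<Rightarrow> 's word \<Rightarrow> 's word set" where
  "word_class S R w \<equiv> word_rel S R `` {w}"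

lemma carrier_presented_group: "carrier (presented_group S R) = word_class S R ` words S"
  by (auto simp: presented_group_def quotient_def)

lemma word_class_in_carrier [intro]: "w \<in> words S \<Longrightarrow> word_class S R w \<in> carrier (presented_group S R)"
  unfolding carrier_presented_group by (rule imageI)

lemma one_presented_group: "\<one>\<^bsub>presented_group S R\<^esub> = word_class S R []"
  by (simp add: presented_group_def)

lemma word_class_eqI: "(u, w) \<in> word_rel S R \<Longrightarrow> word_class S R u = word_class S R w"
  by (rule equiv_class_eq[OF equiv_word_rel])

lemma word_class_eqD:
  assumes "word_class S R u = word_class S R w" "w \<in> words S"
  shows "(u, w) \<in> word_rel S R"
  using assms word_rel.refl[OF assms(2), of R] by auto

lemma inv_word_class:
  assumes "w \<in> words S"
  shows "inv\<^bsub>presented_group S R\<^esub> (word_class S R w) = word_class S R (inverse_word w)"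
proof (rule group.inv_equality[OF group_presented_group])
  show "word_class S R (inverse_word w) \<otimes>\<^bsub>presented_group S R\<^esub> word_class S R w = \<one>\<^bsub>presented_group S R\<^esub>"
    using presented_group_mult[OF inverse_word_closed[OF assms] assms, of R]
      word_class_eqI[OF inverse_word_left[OF assms, of R]] by (simp add: one_presented_group)
qed (use assms inverse_word_closed in auto)

lemma presented_group_induct [consumes 1, case_names one letter]:
  assumes p: "p \<in> carrier (presented_group S R)"
    and one: "P (word_class S R [])"
    and letter: "\<And>w s b. w \<in> words S \<Longrightarrow> s \<in> S \<Longrightarrow> P (word_class S R w) \<Longrightarrow>
      P (word_class S R (w @ [(s, b)]))"
  shows "P p"
proof -
  obtain w where w: "w \<in> words S" "p = word_class S R w" using p carrier_presented_group by blast
  from w(1) have "P (word_class S R w)"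
  proof (induction w rule: rev_induct)
    case (snoc a w)
    obtain s b where "a = (s, b)" by force
    then show ?case using letter[of w s b] snoc by auto
  qed (rule one)
  then show ?thesis using w by simp
qed

text \<open>An action on the right: the letters of a word are applied from left to right.\<close>

definition letter_action :: "'x set \<Rightarrow> ('s \<Rightarrow> 'x \<Rightarrow> 'x) \<Rightarrow> 's \<times> bool \<Rightarrow> 'x \<Rightarrow> 'x" where
  "letter_action X \<beta> = (\<lambda>(s, b). if b then \<beta> s else inv_into X (\<beta> s))"

lemma letter_action_simps [simp]:
  "letter_action X \<beta> (s, True) = \<beta> s" "letter_action X \<beta> (s, False) = inv_into X (\<beta> s)"
  by (simp_all add: letter_action_def)

lemma letter_action_closed:
  assumes "bij_betw (\<beta> s) X X" "x \<in> X"
  shows "letter_action X \<beta> (s, b) x \<in> X"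
  using assms bij_betwE[OF assms(1)] bij_betwE[OF bij_betw_inv_into[OF assms(1)]]
  by (auto simp: letter_action_def)

lemma fold_letter_action_closed:
  assumes "\<And>s. s \<in> S \<Longrightarrow> bij_betw (\<beta> s) X X" "w \<in> words S" "x \<in> X"
  shows "fold (letter_action X \<beta>) w x \<in> X"
  using assms(2,3)
proof (induction w arbitrary: x rule: list.induct)
  case (Cons a w)
  obtain s b where a: "a = (s, b)" by force
  have s: "s \<in> S" using Cons.prems a by auto
  show ?case using Cons.IH[of "letter_action X \<beta> a x"] Cons.prems letter_action_closed[of \<beta> s X x b] s assms(1) a
    by auto
qed simp

text \<open>Each generator acts by a permutation of \<open>X\<close>, so a letter followed by its
  inverse acts trivially, in either order; relators act trivially by assumption. Prefixes keep the
  point inside \<open>X\<close>, where both facts apply.\<close>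

lemma fold_letter_action_word_rel:
  assumes bij: "\<And>s. s \<in> S \<Longrightarrow> bij_betw (\<beta> s) X X"
    and relators: "\<And>r x. r \<in> R \<Longrightarrow> r \<in> words S \<Longrightarrow> x \<in> X \<Longrightarrow> fold (letter_action X \<beta>) r x = x"
    and "(u, w) \<in> word_rel S R" "x \<in> X"
  shows "fold (letter_action X \<beta>) u x = fold (letter_action X \<beta>) w x"
  using assms(3,4)
proof (induction arbitrary: x)
  case (cancel u s b v)
  have s: "s \<in> S" "u \<in> words S" using cancel by auto
  let ?y = "fold (letter_action X \<beta>) u x"
  have y: "?y \<in> X" using fold_letter_action_closed[OF bij s(2) cancel(2)] .
  have "letter_action X \<beta> (s, \<not> b) (letter_action X \<beta> (s, b) ?y) = ?y"
    using bij_betw_inv_into_left[OF bij[OF s(1)] y] bij_betw_inv_into_right[OF bij[OF s(1)] y]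
    by (cases b) auto
  then show ?case by simp
next
  case (relator r u v)
  have s: "u \<in> words S" "r \<in> words S" using relator by auto
  show ?case using relators[OF relator(1) s(2) fold_letter_action_closed[OF bij s(1) relator(3)]] by simp
qed auto

text \<open>Serves three times: for the coset permutations in Hall's theorem and, through
  \<open>path_group_action\<close>, for the embedding of vertex groups and for the cocycle. The
  value is read off a chosen representative word; the preceding lemma makes it independent of the
  choice.\<close>

lemma presented_group_action:
  assumes bij: "\<And>s. s \<in> S \<Longrightarrow> bij_betw (\<beta> s) X X"
    and relators: "\<And>r x. r \<in> R \<Longrightarrow> r \<in> words S \<Longrightarrow> x \<in> X \<Longrightarrow> fold (letter_action X \<beta>) r x = x"
  obtains \<alpha> where
    "\<And>w x. w \<in> words S \<Longrightarrow> x \<in> X \<Longrightarrow> \<alpha> (word_class S R w) x = fold (letter_action X \<beta>) w x"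
    "\<And>p x. p \<in> carrier (presented_group S R) \<Longrightarrow> x \<in> X \<Longrightarrow> \<alpha> p x \<in> X"
    "\<And>p q x. p \<in> carrier (presented_group S R) \<Longrightarrow> q \<in> carrier (presented_group S R) \<Longrightarrow> x \<in> X \<Longrightarrow>
      \<alpha> (p \<otimes>\<^bsub>presented_group S R\<^esub> q) x = \<alpha> q (\<alpha> p x)"
proof -
  define \<alpha> where "\<alpha> p = fold (letter_action X \<beta>) (SOME w. w \<in> words S \<and> p = word_class S R w)" for p
  have 1: "\<alpha> (word_class S R w) x = fold (letter_action X \<beta>) w x" if "w \<in> words S" "x \<in> X" for w x
  proof -
    define u where "u = (SOME u. u \<in> words S \<and> word_class S R w = word_class S R u)"
    have u: "u \<in> words S \<and> word_class S R w = word_class S R u"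
      unfolding u_def by (rule someI[where x = w]) (use that in simp)
    then have "(w, u) \<in> word_rel S R" using word_class_eqD[of S R w u] by blast
    from fold_letter_action_word_rel[OF bij relators this that(2)] show ?thesis
      by (simp add: \<alpha>_def u_def)
  qed
  have 2: "\<alpha> p x \<in> X" if "p \<in> carrier (presented_group S R)" "x \<in> X" for p x
  proof -
    obtain w where "w \<in> words S" "p = word_class S R w"
      using \<open>p \<in> _\<close> unfolding carrier_presented_group by (rule imageE)
    then show ?thesis using 1[of w x] fold_letter_action_closed[of S \<beta> X w x] bij that by simp
  qed
  show ?thesis
  proof (rule that[of \<alpha>])
    fix p q x assume p: "p \<in> carrier (presented_group S R)" and q: "q \<in> carrier (presented_group S R)"
      and x: "x \<in> X"
    obtain u w where u: "u \<in> words S" "p = word_class S R u" and w: "w \<in> words S" "q = word_class S R w"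
      using p q unfolding carrier_presented_group by blast
    have "u @ w \<in> words S" using u w by simp
    then show "\<alpha> (p \<otimes>\<^bsub>presented_group S R\<^esub> q) x = \<alpha> q (\<alpha> p x)"
      using 1[OF u(1) x] 1[of w "\<alpha> p x"] 1[of "u @ w" x] 2[OF p x] u w x
      by (simp add: presented_group_mult[OF u(1) w(1)])
  qed (use 1 2 in auto)
qed

section \<open>Homomorphisms out of a presented group\<close>

definition eval_word :: "('a, 'm) monoid_scheme \<Rightarrow> ('s \<Rightarrow> 'a) \<Rightarrow> 's word \<Rightarrow> 'a" where
  "eval_word K f w =
    foldr (\<lambda>(s, b) x. (if b then f s else inv\<^bsub>K\<^esub> (f s)) \<otimes>\<^bsub>K\<^esub> x) w \<one>\<^bsub>K\<^esub>"

lemma eval_word_simps [simp]: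
  "eval_word K f [] = \<one>\<^bsub>K\<^esub>"
  "eval_word K f ((s, b) # w) = (if b then f s else inv\<^bsub>K\<^esub> (f s)) \<otimes>\<^bsub>K\<^esub> eval_word K f w"
  by (simp_all add: eval_word_def)

context group
begin

lemma eval_word_closed: "f \<in> S \<rightarrow> carrier G \<Longrightarrow> w \<in> words S \<Longrightarrow> eval_word G f w \<in> carrier G"
  by (induction w rule: list.induct) (auto simp: Pi_iff split: if_splits)

lemma eval_word_append:
  assumes "f \<in> S \<rightarrow> carrier G" "u \<in> words S" "w \<in> words S"
  shows "eval_word G f (u @ w) = eval_word G f u \<otimes> eval_word G f w"
  using assms(2)
proof (induction u rule: list.induct)
  case (Cons a u)
  obtain s b where a: "a = (s, b)" by force
  have "f s \<in> carrier G" "eval_word G f u \<in> carrier G" "eval_word G f w \<in> carrier G"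
    using Cons.prems a assms eval_word_closed[OF assms(1)] by auto
  then show ?case using Cons a by (auto simp: m_assoc)
qed (use assms eval_word_closed[OF assms(1,3)] in auto)

text \<open>Von Dyck's theorem. \<open>R\<close> may contain words with letters outside
  \<open>S\<close>; \<open>word_rel\<close> never applies them, so only relators over
  \<open>S\<close> have to evaluate to the identity.\<close>

lemma presented_group_hom:
  assumes f: "f \<in> S \<rightarrow> carrier G"
    and relators: "\<And>r. r \<in> R \<Longrightarrow> r \<in> words S \<Longrightarrow> eval_word G f r = \<one>"
  obtains h where "h \<in> hom (presented_group S R) G"
    "\<And>w. w \<in> words S \<Longrightarrow> h (word_class S R w) = eval_word G f w"
    "\<And>s. s \<in> S \<Longrightarrow> h (word_class S R [(s, True)]) = f s"
proof -
  have wd: "eval_word G f u = eval_word G f w" if "(u, w) \<in> word_rel S R" for u w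
    using that
  proof induction
    case (cancel u s b v)
    have s: "s \<in> S" "u \<in> words S" "v \<in> words S" using cancel by auto
    have c: "f s \<in> carrier G" "eval_word G f v \<in> carrier G"
      using s f eval_word_closed[OF f] by auto
    then have "eval_word G f ([(s, b), (s, \<not> b)] @ v) = eval_word G f v"
      by (cases b) (auto simp: m_assoc[symmetric])
    then show ?case using eval_word_append[OF f s(2), of "[(s, b), (s, \<not> b)] @ v"]
      eval_word_append[OF f s(2,3)] s by simp
  next
    case (relator r u v)
    have s: "r \<in> words S" "u \<in> words S" "v \<in> words S" using relator by auto
    show ?case using relators[OF relator(1) s(1)] eval_word_append[OF f s(2), of "r @ v"]
      eval_word_append[OF f s(1,3)] eval_word_append[OF f s(2,3)] s eval_word_closed[OF f s(3)] by simp
  qed auto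
  define h where "h p = eval_word G f (SOME w. w \<in> words S \<and> p = word_class S R w)" for p
  have h: "h (word_class S R w) = eval_word G f w" if "w \<in> words S" for w
  proof -
    define u where "u = (SOME u. u \<in> words S \<and> word_class S R w = word_class S R u)"
    have u: "u \<in> words S \<and> word_class S R w = word_class S R u"
      unfolding u_def by (rule someI[where x = w]) (use that in simp)
    then have "(w, u) \<in> word_rel S R" using word_class_eqD[of S R w u] by blast
    from wd[OF this] show ?thesis by (simp add: h_def u_def)
  qed
  show ?thesis
  proof (rule that[of h])
    show "h \<in> hom (presented_group S R) G"
    proof (rule homI)
      fix p assume "p \<in> carrier (presented_group S R)"
      then obtain w where w: "w \<in> words S" "p = word_class S R w"
        unfolding carrier_presented_group by (rule imageE)
      then show "h p \<in> carrier G" using h[OF w(1)] eval_word_closed[OF f w(1)] by simp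
    next
      fix p q assume "p \<in> carrier (presented_group S R)" "q \<in> carrier (presented_group S R)"
      then obtain u w where u: "u \<in> words S" "p = word_class S R u" and w: "w \<in> words S" "q = word_class S R w"
        unfolding carrier_presented_group by blast
      have "u @ w \<in> words S" using u w by simp
      then show "h (p \<otimes>\<^bsub>presented_group S R\<^esub> q) = h p \<otimes> h q"
        using h[OF u(1)] h[OF w(1)] h[of "u @ w"] u w
        by (simp add: presented_group_mult[OF u(1) w(1)] eval_word_append[OF f u(1) w(1)])
    qed
    show "h (word_class S R [(s, True)]) = f s" if "s \<in> S" for s
    proof -
      have "f s \<in> carrier G" using f that by auto
      then show ?thesis using h[of "[(s, True)]"] that by simp
    qed
  qed (rule h)
qed

text \<open>The uniqueness half of the universal property, used to recognize composites of
  homomorphisms between free groups as the identity.\<close>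

lemma presented_group_hom_eq:
  assumes "h \<in> hom (presented_group S R) G" "h' \<in> hom (presented_group S R) G"
    and gens: "\<And>s. s \<in> S \<Longrightarrow> h (word_class S R [(s, True)]) = h' (word_class S R [(s, True)])"
    and p: "p \<in> carrier (presented_group S R)"
  shows "h p = h' p"
proof -
  let ?P = "presented_group S R"
  interpret P: group ?P by (rule group_presented_group)
  interpret h: group_hom ?P G h using assms(1) by unfold_locales
  interpret h': group_hom ?P G h' using assms(2) by unfold_locales
  have let_eq: "h (word_class S R [(s, b)]) = h' (word_class S R [(s, b)])" if s: "s \<in> S" for s b
  proof (cases b)
    case False
    have t: "[(s, True)] \<in> words S" using s by simp
    have "word_class S R [(s, False)] = inv\<^bsub>?P\<^esub> word_class S R [(s, True)]"
      using inv_word_class[OF t, of R] by (simp add: inverse_word_def)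
    then show ?thesis using False gens[OF s] word_class_in_carrier[OF t, of R]
      by simp
  qed (use gens s in simp)
  show ?thesis using p
  proof (induction rule: presented_group_induct)
    case one
    then show ?case using h.hom_one h'.hom_one by (simp add: one_presented_group)
  next
    case (letter w s b)
    have t: "[(s, b)] \<in> words S" using letter by simp
    show ?case using letter(3) let_eq[OF letter(2), of b] word_class_in_carrier[OF t, of R]
      word_class_in_carrier[OF letter(1), of R] presented_group_mult[OF letter(1) t, of R]
      h.hom_mult h'.hom_mult by metis
  qed
qed

end

section \<open>Subgroups of finite index and separable subgroups\<close>

lemma (in group_hom) subgroup_vimage:
  assumes "subgroup V H" shows "subgroup {x \<in> carrier G. h x \<in> V} G"
proof -
  interpret V: subgroup V H by fact
  show ?thesis by (rule G.subgroupI) (use V.one_closed in \<open>auto intro!: exI[of _ \<one>]\<close>)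
qed

context group
begin

text \<open>Any invariant with finitely many values whose level sets lie in single right cosets
  bounds the index. It need not be constant on cosets, so each application can choose a convenient
  \<open>f\<close>: a pair of cosets, a coset action, a vector of residues or the image of a
  point.\<close>

lemma finite_index_subgroupI:
  assumes "subgroup H G" "finite (f ` carrier G)"
    and f: "\<And>x y. x \<in> carrier G \<Longrightarrow> y \<in> carrier G \<Longrightarrow> f x = f y \<Longrightarrow> x \<otimes> inv y \<in> H"
  shows "finite_index_subgroup H G"
proof -
  interpret H: subgroup H G by fact
  define r where "r t = (SOME x. x \<in> carrier G \<and> f x = t)" for t
  have "H #> x \<in> (\<lambda>t. H #> r t) ` f ` carrier G" if x: "x \<in> carrier G" for x
  proof -
    have r: "r (f x) \<in> carrier G \<and> f (r (f x)) = f x"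
      unfolding r_def by (rule someI[where x = x]) (use x in simp)
    then have "x \<in> H #> r (f x)" using H.rcos_module[OF is_group, of "r (f x)" x] f[of x "r (f x)"] x by auto
    then have "H #> r (f x) = H #> x" using repr_independence r assms(1) by blast
    then show ?thesis using x by force
  qed
  then have "rcosets H \<subseteq> (\<lambda>t. H #> r t) ` f ` carrier G" by (auto simp: RCOSETS_def)
  then show ?thesis using assms finite_surj[OF assms(2)] unfolding finite_index_subgroup_def by blast
qed

lemma r_coset_eqD:
  assumes "subgroup H G" "x \<in> carrier G" "y \<in> carrier G" "H #> x = H #> y"
  shows "x \<otimes> inv y \<in> H"
  using subgroup.rcos_module[OF assms(1) is_group assms(3,2)] rcos_self[OF assms(2,1)] assms(4) by simp

lemma r_coset_eqI:
  assumes "subgroup H G" "x \<in> carrier G" "y \<in> carrier G" "x \<otimes> inv y \<in> H"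
  shows "H #> x = H #> y"
  using subgroup.rcos_module[OF assms(1) is_group assms(3,2)] repr_independence[OF _ assms(3,1)] assms(4) by simp

lemma finite_index_subgroupD:
  assumes "finite_index_subgroup H G"
  shows "subgroup H G" "finite ((\<lambda>x. H #> x) ` carrier G)"
  using assms by (auto simp: finite_index_subgroup_def RCOSETS_def UNION_singleton_eq_range)

lemma finite_index_carrier: "finite_index_subgroup (carrier G) G"
  by (rule finite_index_subgroupI[where f = "\<lambda>_. ()"]) (auto simp: subgroup_self)

lemma finite_index_Int:
  assumes "finite_index_subgroup U G" "finite_index_subgroup V G"
  shows "finite_index_subgroup (U \<inter> V) G"
proof (rule finite_index_subgroupI[where f = "\<lambda>x. (U #> x, V #> x)"])
  note U = finite_index_subgroupD[OF assms(1)] and V = finite_index_subgroupD[OF assms(2)]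
  show "subgroup (U \<inter> V) G" using subgroups_Inter_pair U(1) V(1) by blast
  show "finite ((\<lambda>x. (U #> x, V #> x)) ` carrier G)"
    by (rule finite_subset[OF _ finite_cartesian_product[OF U(2) V(2)]]) auto
qed (use r_coset_eqD finite_index_subgroupD assms in blast)

text \<open>The explicit intersection with \<open>carrier G\<close> makes the empty family yield the
  whole group instead of \<open>UNIV\<close>.\<close>

lemma finite_index_INT:
  assumes "finite I" "\<And>i. i \<in> I \<Longrightarrow> finite_index_subgroup (U i) G"
  shows "finite_index_subgroup (carrier G \<inter> (\<Inter>i\<in>I. U i)) G"
  using assms
proof (induction I)
  case (insert i I)
  have "carrier G \<inter> (\<Inter>i\<in>insert i I. U i) = U i \<inter> (carrier G \<inter> (\<Inter>i\<in>I. U i))" by auto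
  then show ?case using finite_index_Int[of "U i"] insert by simp
qed (simp add: finite_index_carrier)

lemma finite_index_mono:
  assumes "finite_index_subgroup U G" "U \<subseteq> V" "subgroup V G"
  shows "finite_index_subgroup V G"
  by (rule finite_index_subgroupI[where f = "\<lambda>x. U #> x"])
    (use assms finite_index_subgroupD[OF assms(1)] r_coset_eqD in auto)

text \<open>The normal core is the kernel of the action of \<open>G\<close> on the right cosets of
  \<open>U\<close>. The permutation induced by \<open>x\<close>, taken as the invariant, ranges over
  a finite set of functions; comparing two equal permutations at the coset of \<open>a\<close> gives
  the condition on the conjugate by \<open>a\<close>.\<close>

lemma finite_index_core:
  assumes "finite_index_subgroup U G"
  obtains N where "N \<lhd> G" "finite_index_subgroup N G" "N \<subseteq> U"
proof -
  note U = finite_index_subgroupD[OF assms]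
  interpret U: subgroup U G by (rule U(1))
  define N where "N = {x \<in> carrier G. \<forall>a\<in>carrier G. a \<otimes> x \<otimes> inv a \<in> U}"
  have sub: "subgroup N G"
  proof (rule subgroupI)
    show "N \<noteq> {}" using U.one_closed by (auto simp: N_def intro!: exI[of _ \<one>])
    show "inv x \<in> N" if "x \<in> N" for x
    proof -
      have "a \<otimes> inv x \<otimes> inv a = inv (a \<otimes> x \<otimes> inv a)" if "a \<in> carrier G" for a
        using that \<open>x \<in> N\<close> by (simp add: N_def inv_mult_group m_assoc)
      then show ?thesis using that U.m_inv_closed by (auto simp: N_def)
    qed
    show "x \<otimes> y \<in> N" if "x \<in> N" "y \<in> N" for x y
    proof -
      have "a \<otimes> (x \<otimes> y) \<otimes> inv a = (a \<otimes> x \<otimes> inv a) \<otimes> (a \<otimes> y \<otimes> inv a)" if "a \<in> carrier G" for a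
        using that \<open>x \<in> N\<close> \<open>y \<in> N\<close> by (simp add: N_def m_assoc inv_solve_left)
      then show ?thesis using that U.m_closed by (auto simp: N_def)
    qed
  qed (auto simp: N_def)
  have "N \<lhd> G"
  proof (rule normal_invI[OF sub])
    fix x h assume x: "x \<in> carrier G" "h \<in> N"
    have "a \<otimes> (x \<otimes> h \<otimes> inv x) \<otimes> inv a = (a \<otimes> x) \<otimes> h \<otimes> inv (a \<otimes> x)" if "a \<in> carrier G" for a
      using that x by (simp add: N_def m_assoc inv_mult_group)
    then show "x \<otimes> h \<otimes> inv x \<in> N" using x by (auto simp: N_def)
  qed
  moreover have "finite_index_subgroup N G"
  proof (rule finite_index_subgroupI[OF sub])
    let ?f = "\<lambda>x. \<lambda>C\<in>rcosets U. C #> x"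
    have "C #> x \<in> rcosets U" if "x \<in> carrier G" "C \<in> rcosets U" for x C
      using that U.subset by (auto simp: RCOSETS_def coset_mult_assoc)
    then have "?f x \<in> rcosets U \<rightarrow>\<^sub>E rcosets U" if "x \<in> carrier G" for x
      using that by (intro restrict_PiE_iff[THEN iffD2]) blast
    then have "?f ` carrier G \<subseteq> rcosets U \<rightarrow>\<^sub>E rcosets U" by (rule image_subsetI)
    moreover have "finite (rcosets U \<rightarrow>\<^sub>E rcosets U)"
      using assms by (intro finite_PiE) (simp_all add: finite_index_subgroup_def)
    ultimately show "finite (?f ` carrier G)" by (rule finite_subset)
    fix x y assume x: "x \<in> carrier G" and y: "y \<in> carrier G" and f: "?f x = ?f y"
    have "a \<otimes> (x \<otimes> inv y) \<otimes> inv a \<in> U" if a: "a \<in> carrier G" for a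
    proof -
      have "U #> a \<in> rcosets U" using a U.subset rcosetsI by blast
      then have "U #> (a \<otimes> x) = U #> (a \<otimes> y)"
        using fun_cong[OF f, of "U #> a"] a x y U.subset by (simp add: coset_mult_assoc)
      from r_coset_eqD[OF U(1) _ _ this] show ?thesis using a x y by (simp add: m_assoc inv_mult_group)
    qed
    then show "x \<otimes> inv y \<in> N" using x y by (simp add: N_def)
  qed
  moreover have "N \<subseteq> U"
  proof
    fix x assume "x \<in> N"
    then have "\<one> \<otimes> x \<otimes> inv \<one> \<in> U" "x \<in> carrier G" unfolding N_def by blast+
    then show "x \<in> U" by simp
  qed
  ultimately show ?thesis by (rule that)
qed

text \<open>The invariant of \<open>x\<close> is its coset of \<open>F\<close> together with the
  coset of \<open>U\<close> that contains the \<open>F\<close>-part of \<open>x\<close>, measured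
  against a fixed representative. For equal invariants the same representative occurs twice and
  cancels.\<close>

lemma finite_index_trans:
  assumes F: "finite_index_subgroup F G" and U: "finite_index_subgroup U (G\<lparr>carrier := F\<rparr>)"
  shows "finite_index_subgroup U G"
proof -
  note F' = finite_index_subgroupD[OF F]
  interpret F: subgroup F G by (rule F'(1))
  interpret FG: group "G\<lparr>carrier := F\<rparr>" by (rule F.subgroup_is_group[OF is_group])
  note U' = FG.finite_index_subgroupD[OF U]
  have U_sub: "subgroup U G" using incl_subgroup[OF F'(1) U'(1)] .
  define r where "r C = (SOME x. x \<in> carrier G \<and> C = F #> x)" for C
  have r: "r (F #> x) \<in> carrier G" "F #> r (F #> x) = F #> x" if "x \<in> carrier G" for x
    using someI[of "\<lambda>y. y \<in> carrier G \<and> F #> x = F #> y" x] that by (auto simp: r_def)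
  have in_F: "x \<otimes> inv r (F #> x) \<in> F" if "x \<in> carrier G" for x
    using r_coset_eqD[OF F'(1) that r(1)[OF that]] r(2)[OF that] by simp
  show ?thesis
  proof (rule finite_index_subgroupI[OF U_sub])
    let ?f = "\<lambda>x. (F #> x, U #> (x \<otimes> inv r (F #> x)))"
    show "finite (?f ` carrier G)"
      by (rule finite_subset[OF _ finite_cartesian_product[OF F'(2) U'(2)]]) (use in_F in auto)
    fix x y assume x: "x \<in> carrier G" and y: "y \<in> carrier G" and f: "?f x = ?f y"
    let ?r = "r (F #> x)"
    have "F #> x = F #> y" "U #> (x \<otimes> inv ?r) = U #> (y \<otimes> inv r (F #> y))"
      using arg_cong[OF f, of fst] arg_cong[OF f, of snd] by (simp_all only: fst_conv snd_conv)
    then have "U #> (x \<otimes> inv ?r) = U #> (y \<otimes> inv ?r)" by (simp only:)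
    then have "(x \<otimes> inv ?r) \<otimes> inv (y \<otimes> inv ?r) \<in> U"
      using r_coset_eqD[OF U_sub] x y r by simp
    moreover have "inv ?r \<otimes> (?r \<otimes> inv y) = inv y"
      using y r(1)[OF x] by (simp add: m_assoc[symmetric])
    ultimately show "x \<otimes> inv y \<in> U" using x y r(1)[OF x] by (simp add: inv_mult_group m_assoc)
  qed
qed

section \<open>Separable subgroups\<close>

text \<open>Separability can be tested one excluded element at a time. For the backward direction
  the family of all finite-index overgroups is taken; the whole group belongs to it, which keeps the
  family nonempty and its intersection inside the carrier.\<close>

lemma separable_subgroup_iff:
  "separable_subgroup H G \<longleftrightarrow> subgroup H G \<and>
    (\<forall>g\<in>carrier G - H. \<exists>U. finite_index_subgroup U G \<and> H \<subseteq> U \<and> g \<notin> U)"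
proof
  assume "separable_subgroup H G"
  then obtain \<F> where \<F>: "\<F> \<noteq> {}" "\<forall>K\<in>\<F>. finite_index_subgroup K G" "H = \<Inter>\<F>"
    unfolding separable_subgroup_def by blast
  have "subgroup H G" unfolding \<F>(3)
    by (rule subgroups_Inter) (use \<F> finite_index_subgroupD in auto)
  then show "subgroup H G \<and> (\<forall>g\<in>carrier G - H. \<exists>U. finite_index_subgroup U G \<and> H \<subseteq> U \<and> g \<notin> U)"
    using \<F> by blast
next
  assume H: "subgroup H G \<and> (\<forall>g\<in>carrier G - H. \<exists>U. finite_index_subgroup U G \<and> H \<subseteq> U \<and> g \<notin> U)"
  let ?\<F> = "{U. finite_index_subgroup U G \<and> H \<subseteq> U}"
  have c: "carrier G \<in> ?\<F>" using H subgroup.subset finite_index_carrier by auto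
  have "H = \<Inter>?\<F>"
  proof (rule Set.equalityI)
    show "\<Inter>?\<F> \<subseteq> H"
    proof
      fix x assume x: "x \<in> \<Inter>?\<F>"
      then have "x \<in> carrier G" using c by blast
      then show "x \<in> H" using H x by blast
    qed
  qed blast
  moreover have "?\<F> \<noteq> {}" using c by (rule ex_in_conv[THEN iffD1, OF exI])
  ultimately show "separable_subgroup H G" unfolding separable_subgroup_def
    by (intro exI[of _ ?\<F>] conjI) auto
qed

lemma finite_index_vimage:
  assumes h: "h \<in> hom G K" and "group K" and V: "finite_index_subgroup V K"
  shows "finite_index_subgroup {x \<in> carrier G. h x \<in> V} G"
proof -
  interpret K: group K by fact
  interpret h: group_hom G K h using h by unfold_locales
  note V' = K.finite_index_subgroupD[OF V]
  interpret V: subgroup V K by (rule V'(1))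
  have sub: "subgroup {x \<in> carrier G. h x \<in> V} G"
    by (rule h.subgroup_vimage[OF V.subgroup_axioms])
  show ?thesis
  proof (rule finite_index_subgroupI[OF sub, where f = "\<lambda>x. V #>\<^bsub>K\<^esub> h x"])
    show "finite ((\<lambda>x. V #>\<^bsub>K\<^esub> h x) ` carrier G)"
      by (rule finite_subset[OF _ V'(2)]) auto
  qed (use K.r_coset_eqD[OF V'(1)] in auto)
qed

lemma separable_vimage:
  assumes h: "h \<in> hom G K" and "group K" and V: "separable_subgroup V K"
  shows "separable_subgroup {x \<in> carrier G. h x \<in> V} G"
proof -
  interpret K: group K by fact
  interpret h: group_hom G K h using h by unfold_locales
  note V' = V[unfolded K.separable_subgroup_iff]
  interpret V: subgroup V K using V' by blast
  have sub: "subgroup {x \<in> carrier G. h x \<in> V} G"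
    by (rule h.subgroup_vimage[OF V.subgroup_axioms])
  moreover have "\<exists>U. finite_index_subgroup U G \<and> {x \<in> carrier G. h x \<in> V} \<subseteq> U \<and> g \<notin> U"
    if g: "g \<in> carrier G" "h g \<notin> V" for g
  proof -
    obtain U where "finite_index_subgroup U K" "V \<subseteq> U" "h g \<notin> U" using V' g by force
    then show ?thesis using finite_index_vimage[OF h \<open>group K\<close>] by blast
  qed
  ultimately show ?thesis unfolding separable_subgroup_iff by auto
qed

text \<open>Let \<open>g\<close> lie outside \<open>H\<close>. Finitely many \<open>r\<close> in
  \<open>H\<close> represent all cosets of \<open>F\<close> that meet \<open>H\<close>. For each of
  them a finite-index \<open>W r\<close> contains \<open>H \<inter> F\<close> but not
  \<open>g \<otimes> inv r\<close>: by hypothesis if that element lies in \<open>F\<close>, and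
  \<open>F\<close> itself otherwise. With a normal core \<open>N\<close> of all the
  \<open>W r\<close>, the product of \<open>N\<close> and \<open>H\<close> excludes
  \<open>g\<close>: if \<open>g = x \<otimes> h\<close> and \<open>h\<close> is in the coset of
  \<open>r\<close>, then \<open>h \<otimes> inv r\<close> is in \<open>H \<inter> F\<close>, which
  would force \<open>g \<otimes> inv r\<close> into \<open>W r\<close>.\<close>

lemma separable_if_finite_index:
  assumes H: "subgroup H G" and F: "finite_index_subgroup F G"
    and sep: "separable_subgroup (H \<inter> F) (G\<lparr>carrier := F\<rparr>)"
  shows "separable_subgroup H G"
proof -
  note F' = finite_index_subgroupD[OF F]
  interpret H: subgroup H G by fact
  interpret F: subgroup F G by (rule F'(1))
  interpret FG: group "G\<lparr>carrier := F\<rparr>" by (rule F.subgroup_is_group[OF is_group])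
  have "\<exists>U. finite_index_subgroup U G \<and> H \<subseteq> U \<and> g \<notin> U" if g: "g \<in> carrier G" "g \<notin> H" for g
  proof -
    obtain R where R: "R \<subseteq> H" "finite R" "(\<lambda>x. F #> x) ` H = (\<lambda>x. F #> x) ` R"
      using finite_subset_image[of "(\<lambda>x. F #> x) ` H" "\<lambda>x. F #> x" H]
        finite_subset[OF image_mono[OF H.subset] F'(2)] by blast
    have "\<exists>W. finite_index_subgroup W G \<and> H \<inter> F \<subseteq> W \<and> g \<otimes> inv r \<notin> W" if r: "r \<in> R" for r
    proof (cases "g \<otimes> inv r \<in> F")
      case True
      have "g \<otimes> inv r \<notin> H"
      proof
        assume "g \<otimes> inv r \<in> H"
        then have "g \<otimes> inv r \<otimes> r \<in> H" using H.m_closed r R by blast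
        then show False using g r R H.subset by (simp add: m_assoc subset_iff)
      qed
      with True obtain W where "finite_index_subgroup W (G\<lparr>carrier := F\<rparr>)" "H \<inter> F \<subseteq> W" "g \<otimes> inv r \<notin> W"
        using sep unfolding FG.separable_subgroup_iff by auto
      then show ?thesis using finite_index_trans[OF F] by blast
    qed (use F in blast)
    then obtain W where W: "\<And>r. r \<in> R \<Longrightarrow> finite_index_subgroup (W r) G"
      "\<And>r. r \<in> R \<Longrightarrow> H \<inter> F \<subseteq> W r" "\<And>r. r \<in> R \<Longrightarrow> g \<otimes> inv r \<notin> W r" by metis
    obtain N where N: "N \<lhd> G" "finite_index_subgroup N G" "N \<subseteq> carrier G \<inter> (\<Inter>r\<in>R. W r)"
      using finite_index_core[OF finite_index_INT[of R W]] R W by blast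
    have "subgroup (N <#> H) G" using second_isomorphism_grp.normal_set_mult_subgroup[of N G H] N(1) H
      by (simp add: second_isomorphism_grp_def second_isomorphism_grp_axioms_def)
    moreover have "x \<in> N <#> H" if "x \<in> N" for x
    proof -
      have "x \<otimes> \<one> \<in> N <#> H" unfolding set_mult_def using that H.one_closed by blast
      then show ?thesis using that N(3) by auto
    qed
    moreover have "x \<in> N <#> H" if "x \<in> H" for x
    proof -
      have "\<one> \<otimes> x \<in> N <#> H" unfolding set_mult_def
        using that subgroup.one_closed[OF normal_imp_subgroup[OF N(1)]] by blast
      then show ?thesis using that H.subset by auto
    qed
    moreover have "g \<notin> N <#> H"
    proof
      assume "g \<in> N <#> H"
      then obtain x h where x: "x \<in> N" "h \<in> H" "g = x \<otimes> h" by (auto simp: set_mult_def)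
      obtain r where r: "r \<in> R" "F #> h = F #> r" using R(3) x(2) by blast
      have c: "h \<in> carrier G" "r \<in> carrier G" "x \<in> carrier G" using x r R N(3) H.subset by auto
      have "h \<otimes> inv r \<in> F" using r_coset_eqD[OF F'(1) c(1,2) r(2)] .
      moreover have "h \<otimes> inv r \<in> H" using x(2) subsetD[OF R(1) r(1)] H.m_closed H.m_inv_closed by metis
      ultimately have "h \<otimes> inv r \<in> W r" using W(2)[OF r(1)] by (metis IntI subsetD)
      moreover have "x \<in> W r" using N x r by blast
      ultimately have "x \<otimes> (h \<otimes> inv r) \<in> W r"
        using subgroup.m_closed[OF finite_index_subgroupD(1)[OF W(1)[OF r(1)]]] by blast
      then show False using W(3)[OF r(1)] x c by (simp add: m_assoc)
    qed
    ultimately have "finite_index_subgroup (N <#> H) G \<and> H \<subseteq> N <#> H \<and> g \<notin> N <#> H"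
      using finite_index_mono[OF N(2)] by blast
    then show ?thesis by blast
  qed
  then show ?thesis using H separable_subgroup_iff by blast
qed

text \<open>Schreier's lemma: with \<open>r x\<close> the representative of the coset of \<open>x\<close>, the generators are the
  elements \<open>x t (r (x t))\<inverse>\<close> for representatives \<open>x\<close> and \<open>t \<in> T\<close>.\<close>

lemma finitely_generated_Int_finite_index:
  assumes T: "finite T" "T \<subseteq> carrier G" and F: "finite_index_subgroup F G"
  obtains T' where "finite T'" "T' \<subseteq> carrier G" "generate G T' = generate G T \<inter> F"
proof -
  note F' = finite_index_subgroupD[OF F]
  interpret F: subgroup F G by (rule F'(1))
  define H where "H = generate G T"
  have H_sub: "subgroup H G" unfolding H_def by (rule generate_is_subgroup[OF T(2)])
  interpret H: subgroup H G by (rule H_sub)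
  \<comment> \<open>Representatives are taken in \<open>H\<close>, so that the Schreier generators
    lie in \<open>H\<close>. The coset \<open>F\<close> is represented by \<open>\<one>\<close>, so
    that the final formula for an element \<open>h\<close> of \<open>F\<close> reduces to
    \<open>h\<close> itself.\<close>
  define r where "r x = (if x \<in> F then \<one> else SOME y. y \<in> H \<and> F #> x = F #> y)" for x
  have r: "r x \<in> H" "F #> r x = F #> x" if "x \<in> H" for x
  proof -
    have "r x \<in> H \<and> F #> x = F #> r x"
    proof (cases "x \<in> F")
      case True
      then have "F #> x = F #> \<one>" using coset_join2[OF F.mem_carrier F'(1)] F.subset by simp
      then show ?thesis using True by (simp add: r_def)
    next
      case False
      then show ?thesis
        using someI[of "\<lambda>y. y \<in> H \<and> F #> x = F #> y" x] that by (auto simp: r_def)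
    qed
    then show "r x \<in> H" "F #> r x = F #> x" by auto
  qed
  have r_eq: "r x = r y" if "F #> x = F #> y" "x \<in> H" "y \<in> H" for x y
  proof -
    have "x \<in> F \<longleftrightarrow> F #> x = F" if "x \<in> H" for x
      using coset_join1[of F x] coset_join2[OF _ F'(1), of x] F'(1) that H.subset by auto
    then show ?thesis using that by (simp add: r_def)
  qed
  have r_r: "r (r x) = r x" if "x \<in> H" for x using r_eq[OF r(2)] r that by simp
  have "r ` H \<subseteq> (\<lambda>C. r (SOME x. x \<in> H \<and> F #> x = C)) ` (\<lambda>x. F #> x) ` carrier G"
  proof
    fix z assume "z \<in> r ` H"
    then obtain x where x: "x \<in> H" "z = r x" by blast
    let ?y = "SOME y. y \<in> H \<and> F #> y = F #> x"
    have "?y \<in> H \<and> F #> ?y = F #> x" by (rule someI[where x = x]) (use x in simp)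
    then have "z = r ?y" using r_eq[of ?y x] x by simp
    moreover have "F #> x \<in> (\<lambda>x. F #> x) ` carrier G" by (intro imageI H.mem_carrier x(1))
    ultimately show "z \<in> (\<lambda>C. r (SOME x. x \<in> H \<and> F #> x = C)) ` (\<lambda>x. F #> x) ` carrier G"
      by (rule image_eqI)
  qed
  then have fin: "finite (r ` H)" using F'(2) finite_surj by blast
  have H_carrier: "\<And>x. x \<in> H \<Longrightarrow> x \<in> carrier G" by (rule H.mem_carrier)
  define T' where "T' = (\<lambda>(x, t). x \<otimes> t \<otimes> inv r (x \<otimes> t)) ` (r ` H \<times> T)"
  have T_H: "T \<subseteq> H" unfolding H_def by (auto intro: generate.incl)
  have T': "T' \<subseteq> H \<inter> F"
  proof
    fix z assume "z \<in> T'"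
    then obtain x' t where "x' \<in> H" "t \<in> T" "z = r x' \<otimes> t \<otimes> inv r (r x' \<otimes> t)"
      by (auto simp: T'_def)
    moreover define x where "x = r x'"
    ultimately have x: "x \<in> H" "t \<in> H" "z = x \<otimes> t \<otimes> inv r (x \<otimes> t)"
      using r T_H by auto
    have "z \<in> F" unfolding x(3) using r_coset_eqD[OF F'(1), of "x \<otimes> t" "r (x \<otimes> t)"] r[of "x \<otimes> t"] x by auto
    then show "z \<in> H \<inter> F" using x r by auto
  qed
  have T'_c: "T' \<subseteq> carrier G" using T' by auto
  \<comment> \<open>The claim is made for every representative \<open>x\<close>, since reading a
    product moves the base point: after \<open>h1\<close> the walk continues at
    \<open>y = r (x \<otimes> h1)\<close>.\<close>
  have gen: "x \<otimes> h \<otimes> inv r (x \<otimes> h) \<in> generate G T'" if "h \<in> generate G T" "x \<in> r ` H" for h x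
    using that
  proof (induction arbitrary: x)
    case one
    then show ?case using r_r r by (auto intro: generate.one)
  next
    case (incl t)
    then show ?case by (auto simp: T'_def intro!: generate.incl)
  next
    case (inv t)
    have x: "x \<in> H" "t \<in> H" "r x = x" using inv r r_r T_H by auto
    \<comment> \<open>Walking back: since \<open>r (y \<otimes> t) = x\<close>, the element
      belonging to \<open>x\<close> and \<open>inv t\<close> is the inverse of the Schreier
      generator for \<open>y\<close> and \<open>t\<close>.\<close>
    define y where "y = r (x \<otimes> inv t)"
    have y: "y \<in> r ` H" "y \<in> H" "F #> y = F #> (x \<otimes> inv t)" using x r by (auto simp: y_def)
    have "F #> (y \<otimes> t) = F #> (x \<otimes> inv t) #> t"
      using y x H_carrier F.subset by (simp add: coset_mult_assoc[symmetric])
    also have "\<dots> = F #> x" using x H_carrier F.subset by (simp add: coset_mult_assoc m_assoc)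
    finally have "r (y \<otimes> t) = x" using r_eq[of "y \<otimes> t" x] x y by simp
    then have "y \<otimes> t \<otimes> inv x \<in> generate G T'" using y inv by (auto simp: T'_def intro!: generate.incl)
    then have "inv (y \<otimes> t \<otimes> inv x) \<in> generate G T'" using generate_m_inv_closed[OF T'_c] by blast
    then show ?case using x y H_carrier by (simp add: inv_mult_group m_assoc flip: y_def)
  next
    case (eng h1 h2)
    have h: "h1 \<in> H" "h2 \<in> H" "x \<in> H" using eng r by (auto simp: H_def)
    define y where "y = r (x \<otimes> h1)"
    have y: "y \<in> r ` H" "y \<in> H" "F #> y = F #> (x \<otimes> h1)" using h r by (auto simp: y_def)
    have "F #> (y \<otimes> h2) = F #> (x \<otimes> h1) #> h2"
      using y h H_carrier F.subset by (simp add: coset_mult_assoc[symmetric])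
    also have "\<dots> = F #> (x \<otimes> (h1 \<otimes> h2))" using h H_carrier F.subset by (simp add: coset_mult_assoc m_assoc)
    finally have e: "r (y \<otimes> h2) = r (x \<otimes> (h1 \<otimes> h2))"
      by (rule r_eq) (use h y H.m_closed in blast)+
    define z where "z = r (x \<otimes> (h1 \<otimes> h2))"
    have z: "z \<in> H" unfolding z_def by (rule r(1)) (use h in blast)
    have "x \<otimes> h1 \<otimes> inv y \<in> generate G T'" using eng.IH(1)[OF eng.prems] unfolding y_def .
    moreover have "y \<otimes> h2 \<otimes> inv z \<in> generate G T'" using eng.IH(2)[OF y(1)] unfolding e z_def .
    ultimately have "(x \<otimes> h1 \<otimes> inv y) \<otimes> (y \<otimes> h2 \<otimes> inv z) \<in> generate G T'" by (rule generate.eng)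
    also have "inv y \<otimes> (y \<otimes> (h2 \<otimes> inv z)) = h2 \<otimes> inv z"
      using y(2) h z H_carrier by (simp add: m_assoc[symmetric])
    then have "(x \<otimes> h1 \<otimes> inv y) \<otimes> (y \<otimes> h2 \<otimes> inv z) = x \<otimes> (h1 \<otimes> h2) \<otimes> inv z"
      using y(2) h z H_carrier by (simp add: m_assoc)
    finally show ?case unfolding z_def .
  qed
  have "h \<in> generate G T'" if "h \<in> H \<inter> F" for h
  proof -
    have "r \<one> = \<one>" by (simp add: r_def)
    then have "\<one> \<in> r ` H" using H.one_closed by (metis imageI)
    moreover have "h \<in> generate G T" using that by (simp add: H_def)
    ultimately have "\<one> \<otimes> h \<otimes> inv r (\<one> \<otimes> h) \<in> generate G T'" by (intro gen)
    then show ?thesis using that H_carrier by (simp add: r_def)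
  qed
  moreover have "generate G T' \<subseteq> H \<inter> F"
    by (rule generate_subgroup_incl[OF T' subgroups_Inter_pair[OF H_sub F'(1)]])
  moreover have "finite T'" using fin T by (simp add: T'_def)
  ultimately show ?thesis
    by (intro that[of T'] T'_c Set.equalityI subsetI) (auto simp: H_def)
qed

lemma subgroup_separable_finite_index:
  assumes F: "finite_index_subgroup F G" and "subgroup_separable (G\<lparr>carrier := F\<rparr>)"
  shows "subgroup_separable G"
  unfolding subgroup_separable_def
proof (intro allI impI)
  fix T assume T: "finite T \<and> T \<subseteq> carrier G"
  note F' = finite_index_subgroupD[OF F]
  obtain T' where T': "finite T'" "T' \<subseteq> carrier G" "generate G T' = generate G T \<inter> F"
    using finitely_generated_Int_finite_index F T by metis
  have "T' \<subseteq> generate G T'" by (auto intro: generate.incl)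
  then have "T' \<subseteq> F" using T' by auto
  then have "separable_subgroup (generate G T') (G\<lparr>carrier := F\<rparr>)"
    using assms(2) generate_consistent[OF _ F'(1)] T'(1) unfolding subgroup_separable_def by fastforce
  then show "separable_subgroup (generate G T) G"
    using separable_if_finite_index[OF generate_is_subgroup F] T T'(3) by simp
qed

end

lemma subgroup_separable_iso:
  assumes "group G" "group K" "h \<in> iso K G" "subgroup_separable G"
  shows "subgroup_separable K"
  unfolding subgroup_separable_def
proof (intro allI impI)
  fix T assume T: "finite T \<and> T \<subseteq> carrier K"
  interpret G: group G by fact
  interpret K: group K by fact
  have h: "h \<in> hom K G" "inj_on h (carrier K)" using assms(3) by (auto simp: iso_def bij_betw_def)
  interpret h: group_hom K G h using h(1) by unfold_locales
  have hT: "h ` T \<subseteq> carrier G" using T by auto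
  have gen: "generate G (h ` T) = h ` generate K T" using h.generate_img T by simp
  have "separable_subgroup (generate G (h ` T)) G"
    using assms(4) T hT unfolding subgroup_separable_def by blast
  from K.separable_vimage[OF h(1) \<open>group G\<close> this]
  have "separable_subgroup {x \<in> carrier K. h x \<in> h ` generate K T} K" unfolding gen .
  moreover have "{x \<in> carrier K. h x \<in> h ` generate K T} = generate K T"
    using K.generate_incl T h(2) by (auto simp: inj_on_def subset_iff)
  ultimately show "separable_subgroup (generate K T) K" by simp
qed

section \<open>Free groups are subgroup separable\<close>

text \<open>In a finite set the complements of domain and image have the same cardinality, so any
  bijection between them completes the map.\<close>

lemma extend_partial_injection:
  assumes "finite D" "A \<subseteq> D" "inj_on f A" "f ` A \<subseteq> D"
  obtains p where "bij_betw p D D" "\<And>x. x \<in> A \<Longrightarrow> p x = f x"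
proof -
  have "card (D - A) = card (D - f ` A)"
    using assms by (simp add: card_Diff_subset finite_subset[OF assms(2,1)] card_image)
  then obtain h where h: "bij_betw h (D - A) (D - f ` A)"
    using finite_same_card_bij[of "D - A" "D - f ` A"] assms(1) by auto
  let ?p = "\<lambda>x. if x \<in> A then f x else h x"
  have "bij_betw ?p A (f ` A)"
    using bij_betw_cong[of A ?p f] inj_on_imp_bij_betw[OF assms(3)] by simp
  moreover have "bij_betw ?p (D - A) (D - f ` A)"
    using bij_betw_cong[of "D - A" ?p h] h by simp
  ultimately have "bij_betw ?p (A \<union> (D - A)) (f ` A \<union> (D - f ` A))"
    by (rule bij_betw_combine) auto
  moreover have "A \<union> (D - A) = D" "f ` A \<union> (D - f ` A) = D" using assms by auto
  ultimately show ?thesis using that[of ?p] by simp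
qed

text \<open>M. Hall's theorem: the generators act partially on the finitely many cosets of \<open>H\<close> visited
  along the words for the generators of \<open>H\<close> and for \<open>g\<close>; extend these partial injections to
  permutations and take the stabilizer of \<open>H\<close>.\<close>

theorem subgroup_separable_free_group: "subgroup_separable (free_group S)"
  unfolding subgroup_separable_def
proof (intro allI impI)
  let ?P = "free_group S"
  let ?c = "word_class S {}"
  interpret P: group ?P by (rule group_presented_group)
  fix T assume T: "finite T \<and> T \<subseteq> carrier ?P"
  define H where "H = generate ?P T"
  have H: "subgroup H ?P" unfolding H_def using P.generate_is_subgroup T by blast
  interpret H: subgroup H ?P by (rule H)
  have "\<exists>U. finite_index_subgroup U ?P \<and> H \<subseteq> U \<and> g \<notin> U" if g: "g \<in> carrier ?P" "g \<notin> H" for g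
  proof -
    have "\<forall>p\<in>carrier ?P. \<exists>w. w \<in> words S \<and> ?c w = p" unfolding carrier_presented_group by blast
    then obtain wd where wd: "\<And>p. p \<in> carrier ?P \<Longrightarrow> wd p \<in> words S \<and> ?c (wd p) = p" by metis
    define W where "W = wd ` insert g T"
    have W: "finite W" "W \<subseteq> words S" using T g wd unfolding W_def by auto
    \<comment> \<open>All prefixes count, including the empty one, which gives \<open>H\<close>, and
      the full word, which for \<open>g\<close> gives the coset of \<open>g\<close>.\<close>
    define D where "D = (\<lambda>u. H #>\<^bsub>?P\<^esub> ?c u) ` (\<Union>w\<in>W. (\<lambda>k. take k w) ` {..length w})"
    have finD: "finite D" using W by (simp add: D_def)
    have D_take: "H #>\<^bsub>?P\<^esub> ?c (take k w) \<in> D" if "w \<in> W" "k \<le> length w" for k w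
      using that unfolding D_def by blast
    have take_words: "take k w \<in> words S" if "w \<in> W" for k w
      using W that by (meson in_lists_conv_set set_take_subset subsetD)
    have H_one: "H #>\<^bsub>?P\<^esub> ?c [] = H" using P.coset_mult_one[OF H.subset] by (simp add: one_presented_group)
    have HD: "H \<in> D" using D_take[of "wd g" 0] H_one by (simp add: W_def)
    have D_carrier: "C \<subseteq> carrier ?P" if C: "C \<in> D" for C
    proof -
      obtain w k where "w \<in> W" "C = H #>\<^bsub>?P\<^esub> ?c (take k w)" using C unfolding D_def by blast
      then show ?thesis using P.r_coset_subset_G[OF H.subset] word_class_in_carrier[OF take_words] by simp
    qed
    have gen: "?c [(s, True)] \<in> carrier ?P" if "s \<in> S" for s using that by (intro word_class_in_carrier) simp
    define A where "A s = {C \<in> D. C #>\<^bsub>?P\<^esub> ?c [(s, True)] \<in> D}" for s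
    have "\<exists>p. bij_betw p D D \<and> (\<forall>C\<in>A s. p C = C #>\<^bsub>?P\<^esub> ?c [(s, True)])" if s: "s \<in> S" for s
    proof -
      have inj: "inj_on (\<lambda>C. C #>\<^bsub>?P\<^esub> ?c [(s, True)]) (A s)"
      proof (rule inj_onI)
        fix B C assume "B \<in> A s" "C \<in> A s" and eq: "B #>\<^bsub>?P\<^esub> ?c [(s, True)] = C #>\<^bsub>?P\<^esub> ?c [(s, True)]"
        then have BC: "B \<subseteq> carrier ?P" "C \<subseteq> carrier ?P" using D_carrier by (auto simp: A_def)
        have *: "X #>\<^bsub>?P\<^esub> ?c [(s, True)] #>\<^bsub>?P\<^esub> inv\<^bsub>?P\<^esub> ?c [(s, True)] = X" if "X \<subseteq> carrier ?P" for X
          unfolding P.coset_mult_assoc[OF that gen[OF s] P.inv_closed[OF gen[OF s]]] P.r_inv[OF gen[OF s]]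
          by (rule P.coset_mult_one[OF that])
        show "B = C" using *[OF BC(1)] *[OF BC(2)] unfolding eq by (simp only:)
      qed
      have "A s \<subseteq> D" "(\<lambda>C. C #>\<^bsub>?P\<^esub> ?c [(s, True)]) ` A s \<subseteq> D" by (auto simp: A_def)
      then obtain p where "bij_betw p D D" "\<And>C. C \<in> A s \<Longrightarrow> p C = C #>\<^bsub>?P\<^esub> ?c [(s, True)]"
        by (rule extend_partial_injection[OF finD _ inj]) (rule that)
      then show ?thesis by (intro exI[of _ p] conjI ballI)
    qed
    then obtain \<beta> where \<beta>: "\<And>s. s \<in> S \<Longrightarrow> bij_betw (\<beta> s) D D"
      "\<And>s C. s \<in> S \<Longrightarrow> C \<in> A s \<Longrightarrow> \<beta> s C = C #>\<^bsub>?P\<^esub> ?c [(s, True)]" by metis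
    obtain \<alpha> where \<alpha>: "\<And>w x. w \<in> words S \<Longrightarrow> x \<in> D \<Longrightarrow> \<alpha> (?c w) x = fold (letter_action D \<beta>) w x"
      "\<And>p x. p \<in> carrier ?P \<Longrightarrow> x \<in> D \<Longrightarrow> \<alpha> p x \<in> D"
      "\<And>p q x. p \<in> carrier ?P \<Longrightarrow> q \<in> carrier ?P \<Longrightarrow> x \<in> D \<Longrightarrow> \<alpha> (p \<otimes>\<^bsub>?P\<^esub> q) x = \<alpha> q (\<alpha> p x)"
      using presented_group_action[of S \<beta> D "{}"] \<beta>(1) by blast
    have \<alpha>_one: "\<alpha> \<one>\<^bsub>?P\<^esub> x = x" if "x \<in> D" for x using \<alpha>(1)[of "[]" x] that by (simp add: one_presented_group)
    \<comment> \<open>The extended permutations agree with right multiplication for inverse letters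
      too, provided that both cosets lie in \<open>D\<close>: the inverse step reads the forward
      step from the other end.\<close>
    have letter: "letter_action D \<beta> (s, b) C = C #>\<^bsub>?P\<^esub> ?c [(s, b)]"
      if s: "s \<in> S" and C: "C \<in> D" "C #>\<^bsub>?P\<^esub> ?c [(s, b)] \<in> D" for s b C
    proof (cases b)
      case True
      then show ?thesis using \<beta>(2)[OF s, of C] C by (simp add: A_def)
    next
      case False
      let ?C = "C #>\<^bsub>?P\<^esub> ?c [(s, b)]"
      have "inv\<^bsub>?P\<^esub> ?c [(s, True)] = ?c [(s, b)]"
        using inv_word_class[of "[(s, True)]" S "{}"] s False by (simp add: inverse_word_def)
      then have "?C #>\<^bsub>?P\<^esub> ?c [(s, True)] = C #>\<^bsub>?P\<^esub> \<one>\<^bsub>?P\<^esub>"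
        using P.coset_mult_assoc[OF D_carrier[OF C(1)] P.inv_closed[OF gen[OF s]] gen[OF s]]
          P.l_inv[OF gen[OF s]] by (simp only:)
      then have "?C #>\<^bsub>?P\<^esub> ?c [(s, True)] = C" unfolding P.coset_mult_one[OF D_carrier[OF C(1)]] .
      then have "\<beta> s ?C = C" using \<beta>(2)[OF s, of ?C] C by (simp add: A_def)
      then have "inv_into D (\<beta> s) C = ?C" using bij_betw_inv_into_left[OF \<beta>(1)[OF s] C(2)] by simp
      then show ?thesis using False by simp
    qed
    \<comment> \<open>Walking from \<open>H\<close> along a word of \<open>W\<close> never leaves
      \<open>D\<close>, so the arbitrary part of the extended permutations is never
      consulted.\<close>
    have path: "\<alpha> (?c (take k w)) H = H #>\<^bsub>?P\<^esub> ?c (take k w)" if w: "w \<in> W" and k: "k \<le> length w" for k w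
      using k
    proof (induction k)
      case 0
      then show ?case using \<alpha>(1)[of "[]" H] HD H_one by simp
    next
      case (Suc k)
      obtain s b where a: "w ! k = (s, b)" by force
      have "w \<in> words S" using W w by blast
      moreover have "(s, b) \<in> set w" using a Suc.prems nth_mem[of k w] by auto
      ultimately have s: "s \<in> S" by auto
      have tk: "take (Suc k) w = take k w @ [(s, b)]" using Suc.prems a by (simp add: take_Suc_conv_app_nth)
      let ?C = "H #>\<^bsub>?P\<^esub> ?c (take k w)"
      have sb: "[(s, b)] \<in> words S" using s by simp
      have "?c (take (Suc k) w) = ?c (take k w) \<otimes>\<^bsub>?P\<^esub> ?c [(s, b)]"
        using presented_group_mult[OF take_words[OF w] sb, of "{}"] tk by simp
      then have e: "H #>\<^bsub>?P\<^esub> ?c (take (Suc k) w) = ?C #>\<^bsub>?P\<^esub> ?c [(s, b)]"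
        using P.coset_mult_assoc[OF H.subset word_class_in_carrier[OF take_words[OF w]] word_class_in_carrier[OF sb]] by simp
      have "\<alpha> (?c (take (Suc k) w)) H = letter_action D \<beta> (s, b) (\<alpha> (?c (take k w)) H)"
        using \<alpha>(1)[OF take_words[OF w] HD, of "Suc k"] \<alpha>(1)[OF take_words[OF w] HD, of k] tk by simp
      also have "\<dots> = letter_action D \<beta> (s, b) ?C" using Suc by simp
      also have "\<dots> = ?C #>\<^bsub>?P\<^esub> ?c [(s, b)]"
        by (rule letter[OF s]) (use D_take[OF w] Suc.prems e in \<open>auto simp flip: e\<close>)
      finally show ?case using e by simp
    qed
    have act: "\<alpha> p H = H #>\<^bsub>?P\<^esub> p" if "p \<in> insert g T" for p
      using path[of "wd p" "length (wd p)"] that wd[of p] g T by (auto simp: W_def)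
    define U where "U = {x \<in> carrier ?P. \<alpha> x H = H}"
    have U: "subgroup U ?P"
    proof (rule P.subgroupI)
      show "U \<noteq> {}" using \<alpha>_one[OF HD] by (auto simp: U_def)
      show "inv\<^bsub>?P\<^esub> x \<in> U" if "x \<in> U" for x
        using \<alpha>(3)[of x "inv\<^bsub>?P\<^esub> x" H] that HD \<alpha>_one[OF HD] by (simp add: U_def)
      show "x \<otimes>\<^bsub>?P\<^esub> y \<in> U" if "x \<in> U" "y \<in> U" for x y
        using \<alpha>(3)[of x y H] that HD by (simp add: U_def)
    qed (auto simp: U_def)
    have "finite_index_subgroup U ?P"
    proof (rule P.finite_index_subgroupI[OF U, where f = "\<lambda>x. \<alpha> x H"])
      show "finite ((\<lambda>x. \<alpha> x H) ` carrier ?P)"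
        by (rule finite_subset[OF _ finD]) (use \<alpha>(2) HD in blast)
      fix x y assume xy: "x \<in> carrier ?P" "y \<in> carrier ?P" "\<alpha> x H = \<alpha> y H"
      then have "\<alpha> (x \<otimes>\<^bsub>?P\<^esub> inv\<^bsub>?P\<^esub> y) H = \<alpha> (y \<otimes>\<^bsub>?P\<^esub> inv\<^bsub>?P\<^esub> y) H"
        using \<alpha>(3)[OF xy(1) P.inv_closed[OF xy(2)] HD] \<alpha>(3)[OF xy(2) P.inv_closed[OF xy(2)] HD]
        by (simp only:)
      then show "x \<otimes>\<^bsub>?P\<^esub> inv\<^bsub>?P\<^esub> y \<in> U" using xy \<alpha>_one[OF HD] by (simp add: U_def)
    qed
    moreover have "H \<subseteq> U"
    proof -
      have "t \<in> U" if t: "t \<in> T" for t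
      proof -
        have "t \<in> H" using t unfolding H_def by (rule generate.incl)
        then have "\<alpha> t H = H" using act[of t] t P.coset_join2[OF H.mem_carrier H] by simp
        then show ?thesis using t T by (auto simp: U_def)
      qed
      then show ?thesis unfolding H_def by (intro P.generate_subgroup_incl U subsetI)
    qed
    moreover have "g \<notin> U"
    proof
      assume "g \<in> U"
      then have "H #>\<^bsub>?P\<^esub> g = H" using act[of g] by (simp add: U_def)
      then show False using P.coset_join1[OF _ g(1) H] g(2) by blast
    qed
    ultimately show ?thesis by blast
  qed
  then show "separable_subgroup (generate ?P T) ?P"
    using H unfolding H_def[symmetric] P.separable_subgroup_iff by blast
qed

section \<open>Integer vectors\<close>

text \<open>Vectors vanish from index \<open>n\<close> on, in place of the
  \<open>extensional\<close> functions of \<open>Zpow\<close>. Pointwise addition then applies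
  directly, and \<open>int_vec n\<close> is contained in \<open>int_vec (Suc n)\<close>, which the
  inductions on the dimension exploit.\<close>

definition int_vec :: "nat \<Rightarrow> (nat \<Rightarrow> int) set" where
  "int_vec n = {x. \<forall>i\<ge>n. x i = 0}"

definition scale :: "int \<Rightarrow> (nat \<Rightarrow> int) \<Rightarrow> nat \<Rightarrow> int" where
  "scale k x = (\<lambda>i. k * x i)"

definition unit_vec :: "nat \<Rightarrow> nat \<Rightarrow> int" where
  "unit_vec i = (\<lambda>j. if j = i then 1 else 0)"

text \<open>An additive subgroup; no condition on the rank is implied.\<close>

definition int_lattice :: "(nat \<Rightarrow> int) set \<Rightarrow> bool" where
  "int_lattice C \<longleftrightarrow> 0 \<in> C \<and> (\<forall>x\<in>C. \<forall>y\<in>C. x - y \<in> C)"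

lemma scale_apply [simp]: "scale k x i = k * x i"
  by (simp add: scale_def)

lemma scale_simps: "scale (k + l) x = scale k x + scale l x" "scale 0 x = 0" "scale 1 x = x"
  "scale k (x + y) = scale k x + scale k y" "scale (- k) x = - scale k x" "scale (k * l) x = scale k (scale l x)"
  by (auto simp: fun_eq_iff algebra_simps)

lemma int_vec_closed [simp, intro]:
  "0 \<in> int_vec n" "x \<in> int_vec n \<Longrightarrow> y \<in> int_vec n \<Longrightarrow> x + y \<in> int_vec n"
  "x \<in> int_vec n \<Longrightarrow> y \<in> int_vec n \<Longrightarrow> x - y \<in> int_vec n"
  "x \<in> int_vec n \<Longrightarrow> - x \<in> int_vec n" "x \<in> int_vec n \<Longrightarrow> scale k x \<in> int_vec n"
  "i < n \<Longrightarrow> unit_vec i \<in> int_vec n"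
  by (auto simp: int_vec_def unit_vec_def)

lemma int_vec_SucD:
  assumes "x \<in> int_vec (Suc n)" "x n = 0" shows "x \<in> int_vec n"
  unfolding int_vec_def
proof (intro CollectI allI impI)
  fix i assume "n \<le> i"
  then show "x i = 0" using assms by (cases "i = n") (auto simp: int_vec_def)
qed

lemma int_lattice_int_vec: "int_lattice (int_vec n)"
  by (simp add: int_lattice_def)

lemma int_lattice_closed:
  assumes "int_lattice C"
  shows "0 \<in> C" "x \<in> C \<Longrightarrow> y \<in> C \<Longrightarrow> x - y \<in> C" "x \<in> C \<Longrightarrow> - x \<in> C"
    "x \<in> C \<Longrightarrow> y \<in> C \<Longrightarrow> x + y \<in> C" "x \<in> C \<Longrightarrow> scale k x \<in> C"
proof -
  have minus: "x - y \<in> C" if "x \<in> C" "y \<in> C" for x y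
    using assms that by (auto simp: int_lattice_def)
  have 0: "0 \<in> C" using assms by (simp add: int_lattice_def)
  have neg: "- x \<in> C" if "x \<in> C" for x using minus[OF 0 that] by simp
  have plus: "x + y \<in> C" if "x \<in> C" "y \<in> C" for x y using minus[OF that(1) neg[OF that(2)]] by simp
  show "0 \<in> C" "x \<in> C \<Longrightarrow> y \<in> C \<Longrightarrow> x - y \<in> C" "x \<in> C \<Longrightarrow> - x \<in> C"
    "x \<in> C \<Longrightarrow> y \<in> C \<Longrightarrow> x + y \<in> C"
    by (fact 0 minus neg plus)+
  show "scale k x \<in> C" if x: "x \<in> C"
  proof -
    have nat: "scale (int j) x \<in> C" for j
    proof (induction j)
      case (Suc j)
      have "scale (int (Suc j)) x = x + scale (int j) x" by (simp add: fun_eq_iff algebra_simps)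
      then show ?case using plus[OF x Suc] by (simp only:)
    qed (simp only: of_nat_0 scale_simps 0)
    show ?thesis
    proof (cases "0 \<le> k")
      case False
      have "scale k x = - scale (int (nat (- k))) x" using False by (simp add: fun_eq_iff)
      then show ?thesis using neg[OF nat[of "nat (- k)"]] by simp
    qed (use nat[of "nat k"] in simp)
  qed
qed

lemma int_lattice_sum: "int_lattice C \<Longrightarrow> (\<And>i. i \<in> I \<Longrightarrow> f i \<in> C) \<Longrightarrow> sum f I \<in> C"
  by (induction I rule: infinite_finite_induct) (auto intro: int_lattice_closed)

lemma sum_fun_apply: "(sum f I) (j :: 'b) = (\<Sum>i\<in>I. (f i j :: int))"
  by (induction I rule: infinite_finite_induct) auto

lemma int_vec_sum_unit:
  assumes "x \<in> int_vec n" shows "x = (\<Sum>i<n. scale (x i) (unit_vec i))"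
proof
  fix j
  have "(\<Sum>i<n. x i * (if j = i then 1 else 0)) = (\<Sum>i<n. if j = i then x j else 0)"
    by (intro sum.cong) auto
  then show "x j = (\<Sum>i<n. scale (x i) (unit_vec i)) j"
    using assms by (auto simp: sum_fun_apply unit_vec_def int_vec_def)
qed

text \<open>The \<open>k\<close>-th coordinates of elements of \<open>C\<close> form an ideal of the
  integers, and \<open>b\<close> realizes its nonnegative generator, which is 0 if all these
  coordinates vanish. Division with remainder contradicts a smaller positive value.\<close>

lemma int_lattice_coordinate:
  assumes C: "int_lattice C"
  obtains b where "b \<in> C" "b k \<ge> 0" "\<And>c. c \<in> C \<Longrightarrow> b k dvd c k"
proof (cases "\<exists>c\<in>C. c k \<noteq> 0")
  case False
  then show ?thesis using that[of 0] int_lattice_closed(1)[OF C] by auto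
next
  case True
  then obtain c where c: "c \<in> C" "c k \<noteq> 0" by blast
  define P where "P m = (m > 0 \<and> (\<exists>c\<in>C. c k = int m))" for m
  have "P (nat \<bar>c k\<bar>)"
  proof (cases "c k > 0")
    case True
    then show ?thesis using c by (auto simp: P_def)
  next
    case False
    moreover have "- c \<in> C" "(- c) k = \<bar>c k\<bar>" using False int_lattice_closed(3)[OF C c(1)] by auto
    ultimately show ?thesis using c(2) unfolding P_def by (intro conjI bexI[of _ "- c"]) auto
  qed
  then have m: "P (LEAST m. P m)" by (rule LeastI)
  then obtain b where b: "b \<in> C" "b k = int (LEAST m. P m)" "b k > 0" by (auto simp: P_def)
  have "b k dvd c k" if c: "c \<in> C" for c
  proof (rule ccontr)
    assume "\<not> b k dvd c k"
    then have r: "c k mod b k > 0" "c k mod b k < b k" using b(3) by (auto simp: dvd_eq_mod_eq_0 order_le_neq_trans)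
    have "c - scale (c k div b k) b \<in> C" using c b C by (intro int_lattice_closed)
    moreover have "(c - scale (c k div b k) b) k = int (nat (c k mod b k))"
      using r by (simp add: minus_div_mult_eq_mod)
    ultimately have "P (nat (c k mod b k))" unfolding P_def using r(1) zero_less_nat_eq by blast
    then have "(LEAST m. P m) \<le> nat (c k mod b k)" by (rule Least_le)
    then show False using r b(2) by linarith
  qed
  then show ?thesis using that b by auto
qed

lemma int_vec_0: "int_vec 0 = {0}"
  by (auto simp: int_vec_def)

text \<open>Induction on the dimension, splitting off the last coordinate, whose values on
  \<open>C\<close> are the multiples of \<open>b n\<close>. Either the last coordinate of
  \<open>g\<close> is not such a multiple and a modulus for it alone suffices, or a multiple of
  \<open>b\<close> moves \<open>g\<close> into dimension \<open>n\<close>, where the hypothesis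
  applies to \<open>C \<inter> int_vec n\<close>.\<close>

lemma int_lattice_residually_finite:
  assumes "int_lattice C" "C \<subseteq> int_vec n" "g \<in> int_vec n" "g \<notin> C"
  shows "\<exists>m>0. \<forall>c\<in>C. \<forall>z\<in>int_vec n. g \<noteq> c + scale m z"
  using assms
proof (induction n arbitrary: C g)
  case 0
  have "g = 0" using 0(3) unfolding int_vec_0 by blast
  then have False using 0(4) int_lattice_closed(1)[OF 0(1)] by blast
  then show ?case ..
next
  case (Suc n)
  note C = Suc.prems(1)
  obtain b where b: "b \<in> C" "b n \<ge> 0" "\<And>c. c \<in> C \<Longrightarrow> b n dvd c n"
    using int_lattice_coordinate[OF C] by metis
  show ?case
  proof (cases "b n dvd g n")
    case False
    \<comment> \<open>If all last coordinates on \<open>C\<close> vanish, then \<open>g n\<close> is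
      nonzero, and \<open>\<bar>g n\<bar> + 1\<close> is too large to divide it. Otherwise
      \<open>b n\<close> itself is a modulus that \<open>g n\<close> violates.\<close>
    define m where "m = (if b n = 0 then \<bar>g n\<bar> + 1 else b n)"
    have m: "m > 0" using b(2) by (simp add: m_def)
    have "g \<noteq> c + scale m z" if "c \<in> C" for c z
    proof
      assume g: "g = c + scale m z"
      have "g n = c n + m * z n" by (subst g) simp
      moreover have "b n dvd c n" using b(3) that by blast
      ultimately show False
      proof (cases "b n = 0")
        case True
        then have "g n = (\<bar>g n\<bar> + 1) * z n" "g n \<noteq> 0" using \<open>g n = c n + m * z n\<close> \<open>b n dvd c n\<close> False by (auto simp: m_def)
        then have "(\<bar>g n\<bar> + 1) dvd g n" by (metis dvd_triv_left)
        then show False using \<open>g n \<noteq> 0\<close> zdvd_imp_le[of "\<bar>g n\<bar> + 1" "\<bar>g n\<bar>"] by simp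
      qed (use False m_def in auto)
    qed
    then show ?thesis using m by blast
  next
    case True
    then obtain k where k: "g n = b n * k" by blast
    define C' where "C' = C \<inter> int_vec n"
    define g' where "g' = g - scale k b"
    have C': "int_lattice C'" "C' \<subseteq> int_vec n" using C by (auto simp: C'_def int_lattice_def)
    have vec: "x \<in> int_vec n" if "x \<in> int_vec (Suc n)" "x n = 0" for x
      using that by (rule int_vec_SucD)
    have kb: "scale k b \<in> C" using b C by (intro int_lattice_closed)
    have g': "g' \<in> int_vec n" using Suc.prems kb k by (intro vec) (auto simp: g'_def)
    have "g' \<notin> C'"
    proof
      assume "g' \<in> C'"
      then have "g' + scale k b \<in> C" using kb int_lattice_closed(4)[OF C] by (simp only: C'_def Int_iff)
      then show False using Suc.prems by (simp add: g'_def)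
    qed
    from Suc.IH[OF C' g' this] obtain m where m: "m > 0" "\<And>c z. c \<in> C' \<Longrightarrow> z \<in> int_vec n \<Longrightarrow> g' \<noteq> c + scale m z"
      by blast
    \<comment> \<open>The extra factor \<open>b n\<close> makes room for removing the last
      coordinate of \<open>z\<close> with a multiple of \<open>b\<close>, without dividing.\<close>
    define M where "M = (if b n = 0 then m else m * b n)"
    have M: "M > 0" using m b(2) by (auto simp: M_def)
    have "g \<noteq> c + scale M z" if c: "c \<in> C" and z: "z \<in> int_vec (Suc n)" for c z
    proof
      assume g: "g = c + scale M z"
      have cn: "b n dvd c n" using b c by blast
      show False
      proof (cases "b n = 0")
        case True
        then have "c n = 0" "g n = 0" using cn k by auto
        have "g n = c n + M * z n" by (subst g) simp
        then have "z n = 0" using \<open>c n = 0\<close> \<open>g n = 0\<close> M by simp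
        have "c - scale k b \<in> C" using c kb by (rule int_lattice_closed(2)[OF C])
        moreover from this have "c - scale k b \<in> int_vec n"
          using Suc.prems(2) \<open>c n = 0\<close> True by (intro vec) auto
        ultimately have "c - scale k b \<in> C'" by (simp only: C'_def Int_iff)
        moreover have "g' = (c - scale k b) + scale m z" using g True by (simp add: g'_def M_def)
        ultimately show False using m(2) vec[OF z \<open>z n = 0\<close>] by blast
      next
        case False
        \<comment> \<open>The last coordinate cancels, so \<open>y\<close> lies in dimension
          \<open>n\<close>, and \<open>scale M z\<close> is \<open>scale m y\<close> plus a multiple
          of \<open>b\<close>; that multiple is absorbed by \<open>c'\<close>, which stays in
          \<open>C\<close>.\<close>
        define y where "y = scale (b n) z - scale (z n) b"
        have y: "y \<in> int_vec n" using z b Suc.prems(2) by (intro vec) (auto simp: y_def)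
        define c' where "c' = c - scale k b + scale (m * z n) b"
        have g'_eq: "g' = c' + scale m y"
          using g False by (auto simp: g'_def c'_def y_def M_def fun_eq_iff algebra_simps)
        have "c' \<in> C" unfolding c'_def using c b C by (intro int_lattice_closed)
        moreover have "c' \<in> int_vec n"
        proof -
          have "c' = g' - scale m y" using g'_eq by simp
          then show ?thesis using g' y by simp
        qed
        ultimately have "c' \<in> C'" by (simp only: C'_def Int_iff)
        then show False using m(2)[OF _ y] g'_eq by blast
      qed
    qed
    then show ?thesis using M by blast
  qed
qed

text \<open>A torsion quotient means full rank, and a full-rank sublattice is again free of rank
  \<open>n\<close>. A basis of \<open>C \<inter> int_vec n\<close> is completed by \<open>b\<close>,
  whose last coordinate generates the last coordinates of \<open>C\<close>; torsion applied to the
  last unit vector makes that generator nonzero.\<close>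

lemma int_lattice_basis:
  assumes "int_lattice C" "C \<subseteq> int_vec n" "\<And>z. z \<in> int_vec n \<Longrightarrow> \<exists>m>0. scale m z \<in> C"
  shows "\<exists>\<phi>. bij_betw \<phi> (int_vec n) C \<and> (\<forall>x\<in>int_vec n. \<forall>y\<in>int_vec n. \<phi> (x + y) = \<phi> x + \<phi> y)"
  using assms
proof (induction n arbitrary: C)
  case 0
  then have "C = {0}" using int_lattice_closed(1)[of C] by (auto simp: int_vec_0)
  then show ?case by (intro exI[of _ "\<lambda>x. x"]) (auto simp: int_vec_0 bij_betw_def)
next
  case (Suc n)
  note C = Suc.prems(1)
  obtain b where b: "b \<in> C" "b n \<ge> 0" "\<And>c. c \<in> C \<Longrightarrow> b n dvd c n"
    using int_lattice_coordinate[OF C] by metis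
  have "unit_vec n \<in> int_vec (Suc n)" by simp
  then obtain m where m: "m > 0" "scale m (unit_vec n) \<in> C" using Suc.prems(3) by blast
  have "b n dvd m" using b(3)[OF m(2)] by (simp add: unit_vec_def)
  then have bn: "b n > 0" using b(2) m(1) by (cases "b n = 0") auto
  define C' where "C' = C \<inter> int_vec n"
  have vec: "x \<in> int_vec n" if "x \<in> int_vec (Suc n)" "x n = 0" for x
    using that by (rule int_vec_SucD)
  have vec': "x \<in> int_vec (Suc n)" "x n = 0" if "x \<in> int_vec n" for x
    using that by (auto simp: int_vec_def)
  have C': "int_lattice C'" "C' \<subseteq> int_vec n" using C by (auto simp: C'_def int_lattice_def)
  have "\<exists>m>0. scale m z \<in> C'" if "z \<in> int_vec n" for z
    using Suc.prems(3)[OF vec'(1)[OF that]] int_vec_closed(5)[OF that] unfolding C'_def by blast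
  from Suc.IH[OF C' this] obtain \<phi> where \<phi>: "bij_betw \<phi> (int_vec n) C'"
    "\<And>x y. x \<in> int_vec n \<Longrightarrow> y \<in> int_vec n \<Longrightarrow> \<phi> (x + y) = \<phi> x + \<phi> y" by blast
  \<comment> \<open>The last entry of \<open>x\<close> becomes the coefficient of the new basis
    vector \<open>b\<close>; the other entries are handled in dimension \<open>n\<close>.\<close>
  define \<psi> where "\<psi> x = \<phi> (x(n := 0)) + scale (x n) b" for x
  have upd: "x(n := 0) \<in> int_vec n" if "x \<in> int_vec (Suc n)" for x
    using that by (intro vec) (auto simp: int_vec_def)
  have \<phi>_C': "\<phi> x \<in> C'" if "x \<in> int_vec n" for x using \<phi>(1) that by (auto simp: bij_betw_def)
  have \<psi>_n: "\<psi> x n = x n * b n" if "x \<in> int_vec (Suc n)" for x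
    using \<phi>_C'[OF upd[OF that]] by (auto simp: \<psi>_def C'_def dest: vec')
  have "inj_on \<psi> (int_vec (Suc n))"
  proof (rule inj_onI)
    fix x y assume x: "x \<in> int_vec (Suc n)" and y: "y \<in> int_vec (Suc n)" and eq: "\<psi> x = \<psi> y"
    have n: "x n = y n" using \<psi>_n[OF x] \<psi>_n[OF y] eq bn by simp
    then have "\<phi> (x(n := 0)) = \<phi> (y(n := 0))" using eq by (simp add: \<psi>_def)
    then have "x(n := 0) = y(n := 0)" using \<phi>(1) upd[OF x] upd[OF y] by (auto simp: bij_betw_def inj_on_def)
    then show "x = y" using n by (metis fun_upd_triv fun_upd_upd)
  qed
  moreover have "\<psi> ` int_vec (Suc n) = C"
  proof (intro Set.equalityI subsetI)
    fix c assume "c \<in> \<psi> ` int_vec (Suc n)"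
    then obtain x where "x \<in> int_vec (Suc n)" "c = \<psi> x" by blast
    then show "c \<in> C" using \<phi>_C'[OF upd] b C by (auto simp: \<psi>_def C'_def intro!: int_lattice_closed)
  next
    fix c assume c: "c \<in> C"
    then obtain k where k: "c n = b n * k" using b(3) by blast
    have "c - scale k b \<in> C" using c b C by (intro int_lattice_closed)
    moreover have "c - scale k b \<in> int_vec n" using c b Suc.prems(2) k by (intro vec) auto
    ultimately obtain z where z: "z \<in> int_vec n" "c - scale k b = \<phi> z"
      using \<phi>(1) by (auto simp: C'_def bij_betw_def)
    have "(z(n := k))(n := 0) = z" using vec'(2)[OF z(1)] by (simp add: fun_upd_idem)
    then have "\<psi> (z(n := k)) = c" unfolding \<psi>_def using z(2)[symmetric] by simp
    moreover have "z(n := k) \<in> int_vec (Suc n)" using z(1) by (auto simp: int_vec_def)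
    ultimately show "c \<in> \<psi> ` int_vec (Suc n)" by blast
  qed
  moreover have "\<psi> (x + y) = \<psi> x + \<psi> y" if x: "x \<in> int_vec (Suc n)" and y: "y \<in> int_vec (Suc n)" for x y
  proof -
    have "(x + y)(n := 0) = x(n := 0) + y(n := 0)" by (auto simp: fun_eq_iff)
    then show ?thesis using \<phi>(2)[OF upd[OF x] upd[OF y]] by (simp add: \<psi>_def scale_simps algebra_simps)
  qed
  ultimately show ?case unfolding bij_betw_def by blast
qed

section \<open>Counting integer points in boxes\<close>

definition int_box :: "nat \<Rightarrow> int set \<Rightarrow> (nat \<Rightarrow> int) set" where
  "int_box n A = {x \<in> int_vec n. \<forall>i<n. x i \<in> A}"

lemma card_int_box:
  assumes "finite A" shows "finite (int_box n A) \<and> card (int_box n A) = card A ^ n"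
proof (induction n)
  case 0
  have "int_box 0 A = {0}" by (auto simp: int_box_def int_vec_0)
  then show ?case by simp
next
  case (Suc n)
  let ?f = "\<lambda>(x :: nat \<Rightarrow> int, a). x(n := a)"
  have "int_box (Suc n) A = ?f ` (int_box n A \<times> A)"
  proof (intro Set.equalityI subsetI)
    fix x assume x: "x \<in> int_box (Suc n) A"
    then have "x(n := 0) \<in> int_box n A" "x n \<in> A"
      by (auto simp: int_box_def int_vec_def less_Suc_eq le_Suc_eq Suc_le_eq)
    moreover have "x = ?f (x(n := 0), x n)" by simp
    ultimately show "x \<in> ?f ` (int_box n A \<times> A)" by blast
  qed (auto simp: int_box_def int_vec_def less_Suc_eq)
  moreover have "inj_on ?f (int_box n A \<times> A)"
  proof (rule inj_onI, clarify)
    fix x a y b assume xy: "x \<in> int_box n A" "y \<in> int_box n A" "x(n := a) = y(n := b)"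
    have "x = y"
    proof
      fix i show "x i = y i"
        using xy(1,2) fun_upd_apply[of x n a i] fun_upd_apply[of y n b i]
        unfolding xy(3) by (cases "i = n") (auto simp: int_box_def int_vec_def)
    qed
    moreover have "a = b" using fun_upd_same[of x n a] fun_upd_same[of y n b] unfolding xy(3) by simp
    ultimately show "x = y \<and> a = b" by blast
  qed
  ultimately show ?case using Suc assms by (simp add: card_image card_cartesian_product)
qed

text \<open>Additive maps are linear over the integers, hence determined by the unit vectors. This
  turns additivity into the linear growth bound needed for the box count.\<close>

lemma additive_sum_unit:
  assumes add: "\<And>x y. x \<in> int_vec n \<Longrightarrow> y \<in> int_vec n \<Longrightarrow> f (x + y) = f x + f y"
    and x: "x \<in> int_vec n"
  shows "(f x :: nat \<Rightarrow> int) = (\<Sum>i<n. scale (x i) (f (unit_vec i)))"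
proof -
  have f0: "f 0 = 0" using add[of 0 0] by simp
  have neg: "f (- y) = - f y" if "y \<in> int_vec n" for y using add[of y "- y"] that f0 by (simp add: eq_neg_iff_add_eq_0 add.commute)
  have nat: "f (scale (int j) y) = scale (int j) (f y)" if y: "y \<in> int_vec n" for j y
  proof (induction j)
    case (Suc j)
    have e: "scale (int (Suc j)) z = z + scale (int j) z" for z by (simp add: fun_eq_iff algebra_simps)
    show ?case unfolding e add[OF y int_vec_closed(5)[OF y]] Suc ..
  qed (simp only: of_nat_0 scale_simps f0)
  have sc: "f (scale k y) = scale k (f y)" if "y \<in> int_vec n" for k y
  proof (cases "0 \<le> k")
    case False
    then have e: "scale k z = - scale (int (nat (- k))) z" for z by (simp add: fun_eq_iff)
    show ?thesis unfolding e neg[OF int_vec_closed(5)[OF that]] nat[OF that] ..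
  qed (use nat[OF that, of "nat k"] in simp)
  have sm: "f (\<Sum>i\<in>I. g i) = (\<Sum>i\<in>I. f (g i))" if "finite I" "\<And>i. i \<in> I \<Longrightarrow> g i \<in> int_vec n" for g and I :: "nat set"
    using that
  proof (induction I)
    case (insert i I)
    have "sum g I \<in> int_vec n" by (rule int_lattice_sum[OF int_lattice_int_vec]) (use insert in auto)
    have "f (g i + sum g I) = f (g i) + f (sum g I)" by (rule add) (use insert \<open>sum g I \<in> _\<close> in auto)
    moreover have "f (sum g I) = (\<Sum>i\<in>I. f (g i))" by (rule insert.IH) (use insert in auto)
    ultimately show ?case by (simp only: sum.insert[OF insert(1,2)])
  qed (use f0 in simp)
  have "f x = f (\<Sum>i<n. scale (x i) (unit_vec i))" using int_vec_sum_unit[OF x] by simp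
  also have "\<dots> = (\<Sum>i<n. f (scale (x i) (unit_vec i)))" by (rule sm) auto
  also have "\<dots> = (\<Sum>i<n. scale (x i) (f (unit_vec i)))" by (intro sum.cong) (auto simp: sc)
  finally show ?thesis .
qed

text \<open>Otherwise \<open>(x, k) \<mapsto> f x + k z\<close> would embed $\mathbb{Z}^{n+1}$ into $\mathbb{Z}^n$, which is
  impossible since boxes grow too fast.\<close>

lemma injective_additive_torsion:
  assumes f: "f \<in> int_vec n \<rightarrow> int_vec n" "inj_on f (int_vec n)"
    and add: "\<And>x y. x \<in> int_vec n \<Longrightarrow> y \<in> int_vec n \<Longrightarrow> f (x + y) = f x + f y"
    and z: "z \<in> int_vec n"
  shows "\<exists>m>0. scale m z \<in> f ` int_vec n"
proof (rule ccontr)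
  assume contra: "\<not> ?thesis"
  have f0: "f 0 = 0" using add[of 0 0] by simp
  have neg: "f (- y) = - f y" if "y \<in> int_vec n" for y using add[of y "- y"] that f0 by (simp add: eq_neg_iff_add_eq_0 add.commute)
  have diff: "f (x - y) = f x - f y" if "x \<in> int_vec n" "y \<in> int_vec n" for x y
    using add[of x "- y"] neg[of y] that by simp
  \<comment> \<open>No nonzero multiple of \<open>z\<close> lies in the image, negative ones
    included since the image is closed under negation. This is the injectivity of the map to be
    counted.\<close>
  have no: "k = 0" if "x \<in> int_vec n" "f x = scale k z" for x k
  proof (rule ccontr)
    assume "k \<noteq> 0"
    moreover have "scale (- k) z = f (- x)" using that neg by (simp add: scale_simps)
    ultimately show False using contra that int_vec_closed(4)[OF that(1)] by (cases "k > 0") (force)+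
  qed
  \<comment> \<open>A crude operator norm: if \<open>k\<close> and all entries of \<open>x\<close>
    are at most \<open>N\<close> in absolute value, each coordinate of
    \<open>f x + scale k z\<close> is at most \<open>c * N\<close>. The sum over \<open>j\<close>
    replaces a maximum.\<close>
  define c where "c = (\<Sum>j<n. (\<Sum>i<n. \<bar>f (unit_vec i) j\<bar>) + \<bar>z j\<bar>)"
  have c0: "c \<ge> 0" by (auto simp: c_def intro!: sum_nonneg)
  \<comment> \<open>Injectivity gives \<open>N ^ n * N \<le> (2 * c * N + 1) ^ n\<close>, and the
    right side is at most \<open>((2 * c + 1) * N) ^ n\<close>. Hence
    \<open>N \<le> (2 * c + 1) ^ n\<close>, which this choice exceeds by one.\<close>
  define N where "N = nat ((2 * c + 1) ^ n + 1)"
  have N: "int N = (2 * c + 1) ^ n + 1" "N \<ge> 1" using c0 by (auto simp: N_def nat_add_distrib)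
  define X where "X = int_box n {0..<int N} \<times> {0..<int N}"
  define B where "B = int_box n {- (c * int N)..c * int N}"
  define F where "F = (\<lambda>(x, k). f x + scale k z)"
  have XB: "finite B" "card B = nat (2 * c * int N + 1) ^ n" "card X = N ^ n * N"
    using card_int_box[of "{- (c * int N)..c * int N}" n] card_int_box[of "{0..<int N}" n]
    by (auto simp: B_def X_def card_cartesian_product mult.assoc)
  have "inj_on F X"
  proof (rule inj_onI, clarify)
    fix x k y l assume *: "(x, k) \<in> X" "(y, l) \<in> X" "F (x, k) = F (y, l)"
    then have xy: "x \<in> int_vec n" "y \<in> int_vec n" by (auto simp: X_def int_box_def)
    have "f x + scale k z = f y + scale l z" using *(3) by (simp only: F_def prod.case)
    then have "f (x - y) = scale l z - scale k z" unfolding diff[OF xy] by (simp only: algebra_simps)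
    then have "f (x - y) = scale (l - k) z" by (simp add: fun_eq_iff algebra_simps)
    from no[OF _ this] have "l = k" using xy by simp
    then show "x = y \<and> k = l" using *(3) f(2) xy by (auto simp: F_def inj_on_def)
  qed
  moreover have "F ` X \<subseteq> B"
  proof clarify
    fix x k assume *: "(x, k) \<in> X"
    then have x: "x \<in> int_vec n" "\<And>i. i < n \<Longrightarrow> \<bar>x i\<bar> \<le> int N" "\<bar>k\<bar> \<le> int N" by (auto simp: X_def int_box_def)
    have "\<bar>F (x, k) j\<bar> \<le> c * int N" if j: "j < n" for j
    proof -
      have "\<bar>F (x, k) j\<bar> \<le> \<bar>f x j\<bar> + \<bar>k * z j\<bar>" by (simp add: F_def)
      also have "\<bar>f x j\<bar> \<le> (\<Sum>i<n. \<bar>x i * f (unit_vec i) j\<bar>)"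
        using additive_sum_unit[of n f x, OF add x(1)] by (simp add: sum_fun_apply sum_abs)
      also have "\<dots> \<le> (\<Sum>i<n. int N * \<bar>f (unit_vec i) j\<bar>)"
        by (intro sum_mono) (use x in \<open>auto simp: abs_mult intro: mult_right_mono\<close>)
      also have "\<bar>k * z j\<bar> \<le> int N * \<bar>z j\<bar>" using x by (simp add: abs_mult mult_right_mono)
      finally have "\<bar>F (x, k) j\<bar> \<le> int N * ((\<Sum>i<n. \<bar>f (unit_vec i) j\<bar>) + \<bar>z j\<bar>)"
        by (simp add: sum_distrib_left distrib_left)
      also have "\<dots> \<le> int N * c" unfolding c_def
        by (intro mult_left_mono member_le_sum[of j "{..<n}" "\<lambda>j. (\<Sum>i<n. \<bar>f (unit_vec i) j\<bar>) + \<bar>z j\<bar>"])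
          (use j in \<open>auto intro!: add_nonneg_nonneg sum_nonneg\<close>)
      finally show ?thesis by (simp add: mult.commute)
    qed
    moreover have "F (x, k) \<in> int_vec n" using f x z by (auto simp: F_def Pi_iff)
    ultimately show "F (x, k) \<in> B" by (auto simp: B_def int_box_def abs_le_iff minus_le_iff)
  qed
  ultimately have "card X \<le> card B" using card_inj_on_le XB(1) by blast
  then have "int (N ^ n * N) \<le> int (nat (2 * c * int N + 1) ^ n)" unfolding XB by (rule of_nat_mono)
  then have "int N ^ n * int N \<le> (2 * c * int N + 1) ^ n" using c0 by simp
  also have "\<dots> \<le> ((2 * c + 1) * int N) ^ n" using N(2) c0 by (intro power_mono) (auto simp: algebra_simps)
  finally have "int N ^ n * int N \<le> int N ^ n * (2 * c + 1) ^ n" by (simp add: power_mult_distrib mult.commute)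
  then have "int N \<le> (2 * c + 1) ^ n" using N(2) by simp
  then show False using N(1) by simp
qed

text \<open>Finite generation makes the torsion uniform: the product of the multipliers for the unit
  vectors works for every \<open>z\<close>.\<close>

lemma int_lattice_exponent:
  assumes C: "int_lattice C" and tor: "\<And>z. z \<in> int_vec n \<Longrightarrow> \<exists>m>0. scale m z \<in> C"
  obtains m where "m > 0" "\<And>z. z \<in> int_vec n \<Longrightarrow> scale m z \<in> C"
proof -
  have "\<forall>i<n. \<exists>m>0. scale m (unit_vec i) \<in> C" using tor by simp
  then obtain k where k: "\<And>i. i < n \<Longrightarrow> k i > 0 \<and> scale (k i) (unit_vec i) \<in> C" by metis
  define m where "m = prod k {..<n}"
  have u: "scale m (unit_vec i) \<in> C" if "i < n" for i
  proof -
    have "k i dvd m" unfolding m_def using that by (intro dvd_prodI) auto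
    then obtain l where l: "m = l * k i" by (metis dvd_def mult.commute)
    show ?thesis unfolding l scale_simps(6) using k[OF that] int_lattice_closed(5)[OF C] by blast
  qed
  have "scale m z \<in> C" if z: "z \<in> int_vec n" for z
  proof -
    have "scale m z = (\<Sum>i<n. scale (z i) (scale m (unit_vec i)))"
      by (subst int_vec_sum_unit[OF z]) (auto simp: fun_eq_iff sum_fun_apply sum_distrib_left algebra_simps)
    also have "\<dots> \<in> C" by (rule int_lattice_sum[OF C], rule int_lattice_closed(5)[OF C], rule u) simp
    finally show ?thesis .
  qed
  moreover have "m > 0" using k by (auto simp: m_def intro!: prod_pos)
  ultimately show ?thesis using that by blast
qed

section \<open>The additive group of integer vectors\<close>

definition int_vec_group :: "nat \<Rightarrow> (nat \<Rightarrow> int) monoid" where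
  "int_vec_group n = \<lparr>carrier = int_vec n, monoid.mult = (+), one = 0\<rparr>"

lemma int_vec_group_simps [simp]:
  "carrier (int_vec_group n) = int_vec n" "x \<otimes>\<^bsub>int_vec_group n\<^esub> y = x + y" "\<one>\<^bsub>int_vec_group n\<^esub> = 0"
  by (simp_all add: int_vec_group_def)

lemma comm_group_int_vec_group: "comm_group (int_vec_group n)"
proof (rule comm_groupI)
  show "\<exists>y\<in>carrier (int_vec_group n). y \<otimes>\<^bsub>int_vec_group n\<^esub> x = \<one>\<^bsub>int_vec_group n\<^esub>"
    if "x \<in> carrier (int_vec_group n)" for x
    using that by (intro bexI[of _ "- x"]) auto
qed (auto simp: add.assoc add.commute)

lemma group_int_vec_group: "group (int_vec_group n)"
  using comm_group_int_vec_group comm_group.axioms(2) by blast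

lemma inv_int_vec_group [simp]:
  "x \<in> int_vec n \<Longrightarrow> inv\<^bsub>int_vec_group n\<^esub> x = - x"
  by (rule group.inv_equality[OF group_int_vec_group]) auto

lemma int_vec_group_iso_Zpow: "int_vec_group n \<cong> Zpow n"
proof -
  have "(\<lambda>x. restrict x {..<n}) \<in> iso (int_vec_group n) (Zpow n)"
  proof (rule isoI)
    show "(\<lambda>x. restrict x {..<n}) \<in> hom (int_vec_group n) (Zpow n)"
      by (rule homI) (auto simp: Zpow_def integer_group_def)
    show "bij_betw (\<lambda>x. restrict x {..<n}) (carrier (int_vec_group n)) (carrier (Zpow n))"
    proof (rule bij_betwI[where g = "\<lambda>y i. if i < n then y i else 0"])
      show "(\<lambda>x. restrict x {..<n}) \<in> carrier (int_vec_group n) \<rightarrow> carrier (Zpow n)"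
        by (auto simp: Zpow_def integer_group_def)
      show "(\<lambda>y i. if i < n then y i else 0) \<in> carrier (Zpow n) \<rightarrow> carrier (int_vec_group n)"
        by (auto simp: int_vec_def)
    qed (auto simp: Zpow_def int_vec_def fun_eq_iff PiE_def extensional_def)
  qed
  then show ?thesis by (auto simp: is_iso_def)
qed

lemma subgroup_int_vec_iff: "subgroup C (int_vec_group n) \<longleftrightarrow> int_lattice C \<and> C \<subseteq> int_vec n"
proof
  assume C: "subgroup C (int_vec_group n)"
  have sub: "C \<subseteq> int_vec n" using subgroup.subset[OF C] by simp
  moreover have "x - y \<in> C" if "x \<in> C" "y \<in> C" for x y
    using subgroup.m_closed[OF C that(1) subgroup.m_inv_closed[OF C that(2)]] that sub by auto
  ultimately show "int_lattice C \<and> C \<subseteq> int_vec n"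
    using subgroup.one_closed[OF C] by (simp add: int_lattice_def)
next
  assume C: "int_lattice C \<and> C \<subseteq> int_vec n"
  then show "subgroup C (int_vec_group n)"
    by (intro group.subgroupI[OF group_int_vec_group])
      (use int_lattice_closed in \<open>auto simp: subset_iff\<close>)
qed

lemma generate_unit_vecs:
  "generate (int_vec_group n) (unit_vec ` {..<n}) = int_vec n"
proof
  interpret group "int_vec_group n" by (rule group_int_vec_group)
  show "generate (int_vec_group n) (unit_vec ` {..<n}) \<subseteq> int_vec n"
    using generate_incl[of "unit_vec ` {..<n}"] by auto
  have sub: "subgroup (generate (int_vec_group n) (unit_vec ` {..<n})) (int_vec_group n)"
    by (rule generate_is_subgroup) auto
  then have lat: "int_lattice (generate (int_vec_group n) (unit_vec ` {..<n}))"
    by (simp add: subgroup_int_vec_iff)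
  show "int_vec n \<subseteq> generate (int_vec_group n) (unit_vec ` {..<n})"
  proof
    fix x assume x: "x \<in> int_vec n"
    show "x \<in> generate (int_vec_group n) (unit_vec ` {..<n})"
      by (subst int_vec_sum_unit[OF x], intro int_lattice_sum[OF lat] int_lattice_closed[OF lat] generate.incl) auto
  qed
qed

section \<open>Extensions of free abelian groups by free groups\<close>

lemma set_multI: "a \<in> A \<Longrightarrow> b \<in> B \<Longrightarrow> a \<otimes>\<^bsub>G\<^esub> b \<in> A <#>\<^bsub>G\<^esub> B"
  unfolding set_mult_def by blast

text \<open>The vector of residues modulo \<open>m\<close> is the finite invariant: vectors with
  equal residues differ by \<open>m\<close> times a vector, which lies in \<open>C\<close>.\<close>

lemma finite_index_int_lattice:
  assumes C: "subgroup C (int_vec_group n)" and m: "m > 0" "\<And>z. z \<in> int_vec n \<Longrightarrow> scale m z \<in> C"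
  shows "finite_index_subgroup C (int_vec_group n)"
proof (rule group.finite_index_subgroupI[OF group_int_vec_group C, where f = "\<lambda>z i. z i mod m"])
  have "(\<lambda>i. z i mod m) \<in> int_box n {0..<m}" if "z \<in> int_vec n" for z
    using that m by (auto simp: int_box_def int_vec_def)
  then have "(\<lambda>z i. z i mod m) ` int_vec n \<subseteq> int_box n {0..<m}" by (rule image_subsetI)
  then show "finite ((\<lambda>z i. z i mod m) ` carrier (int_vec_group n))"
    unfolding int_vec_group_simps by (rule finite_subset) (simp add: card_int_box)
  fix x y assume "x \<in> carrier (int_vec_group n)" "y \<in> carrier (int_vec_group n)"
    and eq: "(\<lambda>i. x i mod m) = (\<lambda>i. y i mod m)"
  then have xy: "x \<in> int_vec n" "y \<in> int_vec n" by simp_all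
  define z where "z = (\<lambda>i. (x i - y i) div m)"
  have "m dvd x i - y i" for i using fun_cong[OF eq, of i] by (simp add: mod_eq_dvd_iff)
  then have "scale m z = x - y" by (auto simp: z_def scale_def)
  moreover have "z \<in> int_vec n" using xy by (auto simp: z_def int_vec_def)
  ultimately show "x \<otimes>\<^bsub>int_vec_group n\<^esub> inv\<^bsub>int_vec_group n\<^esub> y \<in> C" using m(2)[of z] xy by simp
qed

lemma int_lattice_scale: "int_lattice (scale m ` int_vec n)"
  unfolding int_lattice_def
proof (intro conjI ballI)
  show "0 \<in> scale m ` int_vec n" by (rule image_eqI[of _ _ 0]) (auto simp: fun_eq_iff)
  fix x y assume "x \<in> scale m ` int_vec n" "y \<in> scale m ` int_vec n"
  then obtain u w where "u \<in> int_vec n" "x = scale m u" "w \<in> int_vec n" "y = scale m w" by blast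
  then show "x - y \<in> scale m ` int_vec n"
    by (intro image_eqI[of _ _ "u - w"]) (auto simp: fun_eq_iff algebra_simps)
qed

text \<open>Translates multiples into powers. It shows that the image of the \<open>m\<close>-fold
  vectors is invariant under conjugation, and later that the order of an element of a finite group
  kills a multiple.\<close>

lemma additive_scale_pow:
  assumes "group K" "\<phi> \<in> hom (int_vec_group n) K" "z \<in> int_vec n"
  shows "\<phi> (scale (int k) z) = \<phi> z [^]\<^bsub>K\<^esub> k"
proof (induction k)
  interpret K: group K by fact
  case 0
  have "\<phi> 0 = \<one>\<^bsub>K\<^esub>" using hom_one[OF assms(2) group_int_vec_group \<open>group K\<close>] by simp
  then show ?case by (simp only: of_nat_0 scale_simps K.nat_pow_0)
next
  interpret K: group K by fact
  case (Suc k)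
  have "scale (int (Suc k)) z = scale (int k) z + z" by (simp add: fun_eq_iff algebra_simps)
  moreover have "\<phi> (scale (int k) z + z) = \<phi> (scale (int k) z) \<otimes>\<^bsub>K\<^esub> \<phi> z"
    using hom_mult[OF assms(2), of "scale (int k) z" z] assms(3) int_vec_closed(5)[OF assms(3)] by simp
  ultimately show ?case by (simp only: Suc K.nat_pow_Suc)
qed

lemma (in group) conj_nat_pow:
  assumes "x \<in> carrier G" "a \<in> carrier G"
  shows "x \<otimes> a [^] (k :: nat) \<otimes> inv x = (x \<otimes> a \<otimes> inv x) [^] k"
proof (induction k)
  case (Suc k)
  have "inv x \<otimes> (x \<otimes> (a \<otimes> inv x)) = a \<otimes> inv x" using assms by (simp add: m_assoc[symmetric])
  then have "(x \<otimes> a [^] k \<otimes> inv x) \<otimes> (x \<otimes> a \<otimes> inv x) = x \<otimes> a [^] Suc k \<otimes> inv x"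
    using assms by (simp add: m_assoc)
  then show ?case using Suc assms by simp
qed (use assms in simp)

text \<open>Free groups are projective: arbitrary preimages of the basis define
  \<open>\<sigma>\<close>, and its composite with \<open>\<pi>\<close> fixes the basis.\<close>

lemma free_group_section:
  assumes "group K" and \<pi>: "\<pi> \<in> hom K (free_group S)" "\<pi> ` carrier K = carrier (free_group S)"
  obtains \<sigma> where "\<sigma> \<in> hom (free_group S) K" "\<And>p. p \<in> carrier (free_group S) \<Longrightarrow> \<pi> (\<sigma> p) = p"
proof -
  interpret K: group K by fact
  interpret P: group "free_group S" by (rule group_presented_group)
  have gen: "word_class S {} [(s, True)] \<in> carrier (free_group S)" if "s \<in> S" for s
    using that by (intro word_class_in_carrier) simp
  have "\<exists>x\<in>carrier K. \<pi> x = word_class S {} [(s, True)]" if "s \<in> S" for s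
    using gen[OF that] \<pi>(2) by (metis imageE)
  then obtain f where f: "\<And>s. s \<in> S \<Longrightarrow> f s \<in> carrier K \<and> \<pi> (f s) = word_class S {} [(s, True)]" by metis
  then have "f \<in> S \<rightarrow> carrier K" by blast
  then obtain \<sigma> where \<sigma>: "\<sigma> \<in> hom (free_group S) K" "\<And>s. s \<in> S \<Longrightarrow> \<sigma> (word_class S {} [(s, True)]) = f s"
    using K.presented_group_hom[of f S "{}"] by blast
  have "\<pi> (\<sigma> p) = p" if "p \<in> carrier (free_group S)" for p
  proof -
    have "(\<lambda>x. x) \<in> hom (free_group S) (free_group S)" by (simp add: hom_def)
    then have "(\<pi> \<circ> \<sigma>) p = (\<lambda>x. x) p"
      by (rule P.presented_group_hom_eq[OF hom_compose[OF \<sigma>(1) \<pi>(1)] _ _ that])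
        (simp add: \<sigma>(2) f)
    then show ?thesis by simp
  qed
  then show ?thesis using that \<sigma>(1) by blast
qed

text \<open>The case where the finitely generated subgroup contains a normal subgroup
  \<open>N\<close> of \<open>K\<close> that has finite index in \<open>A\<close>. A section of
  \<open>\<pi>\<close> yields a finite-index subgroup \<open>F1\<close> of \<open>K\<close> with
  \<open>F1 \<inter> A = N\<close>. On \<open>F1\<close> the kernel of \<open>\<pi>\<close> lies in
  \<open>H\<close>, so \<open>H \<inter> F1\<close> is the full preimage of a finitely generated
  subgroup of the free group, and Hall's theorem pulls back.\<close>

lemma subgroup_separable_modulo:
  assumes K: "group K" and \<pi>: "\<pi> \<in> hom K (free_group S)" "\<pi> ` carrier K = carrier (free_group S)"
    and A: "A = {x \<in> carrier K. \<pi> x = \<one>\<^bsub>free_group S\<^esub>}"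
    and N: "N \<lhd> K" "finite_index_subgroup N (K\<lparr>carrier := A\<rparr>)"
    and T: "finite T" "T \<subseteq> carrier K" "N \<subseteq> generate K T"
  shows "separable_subgroup (generate K T) K"
proof -
  let ?F = "free_group S"
  interpret K: group K by fact
  interpret P: group ?F by (rule group_presented_group)
  interpret \<pi>: group_hom K ?F \<pi> using \<pi>(1) by unfold_locales
  have A_iff: "x \<in> A \<longleftrightarrow> x \<in> carrier K \<and> \<pi> x = \<one>\<^bsub>?F\<^esub>" for x unfolding A by simp
  have A_sub: "subgroup A K" unfolding A using \<pi>.subgroup_kernel by (simp add: kernel_def)
  interpret A: subgroup A K by (rule A_sub)
  interpret KA: group "K\<lparr>carrier := A\<rparr>" by (rule A.subgroup_is_group[OF K])
  note NA = KA.finite_index_subgroupD[OF N(2)]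
  have N_A: "N \<subseteq> A" using subgroup.subset[OF NA(1)] by simp
  interpret N: normal N K by (rule N(1))
  obtain \<sigma> where \<sigma>: "\<sigma> \<in> hom ?F K" "\<And>p. p \<in> carrier ?F \<Longrightarrow> \<pi> (\<sigma> p) = p"
    using free_group_section[OF K \<pi>] by blast
  interpret \<sigma>: group_hom ?F K \<sigma> using \<sigma>(1) by unfold_locales
  \<comment> \<open>Modulo \<open>N\<close> this is a complement of the finite normal subgroup
    \<open>A / N\<close>, hence of finite index.\<close>
  define F1 where "F1 = N <#>\<^bsub>K\<^esub> \<sigma> ` carrier ?F"
  have F1_sub: "subgroup F1 K" unfolding F1_def
    using second_isomorphism_grp.normal_set_mult_subgroup[of N K "\<sigma> ` carrier ?F"] N(1)
      \<sigma>.img_is_subgroup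
    by (simp add: second_isomorphism_grp_def second_isomorphism_grp_axioms_def)
  interpret F1: subgroup F1 K by (rule F1_sub)
  \<comment> \<open>The \<open>A\<close>-component of \<open>x\<close> relative to the section. Its
    coset modulo \<open>N\<close> takes finitely many values and decides the coset of
    \<open>F1\<close>.\<close>
  let ?a = "\<lambda>x. inv\<^bsub>K\<^esub> \<sigma> (\<pi> x) \<otimes>\<^bsub>K\<^esub> x"
  have a: "?a x \<in> A" if "x \<in> carrier K" for x
  proof -
    have "\<pi> x \<in> carrier ?F" "\<sigma> (\<pi> x) \<in> carrier K" using that by simp_all
    then have "\<pi> (?a x) = \<one>\<^bsub>?F\<^esub>" using that \<sigma>(2)[of "\<pi> x"] by (simp only: \<pi>.hom_mult \<pi>.hom_inv K.inv_closed P.l_inv)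
    then show ?thesis unfolding A_iff using that by simp
  qed
  have F1: "finite_index_subgroup F1 K"
  proof (rule K.finite_index_subgroupI[OF F1_sub, where f = "\<lambda>x. N #>\<^bsub>K\<^esub> ?a x"])
    show "finite ((\<lambda>x. N #>\<^bsub>K\<^esub> ?a x) ` carrier K)"
      by (rule finite_subset[OF _ NA(2)]) (use a in auto)
    fix x y assume x: "x \<in> carrier K" and y: "y \<in> carrier K" and eq: "N #>\<^bsub>K\<^esub> ?a x = N #>\<^bsub>K\<^esub> ?a y"
    define s t n where "s = \<sigma> (\<pi> x)" and "t = \<sigma> (\<pi> y)" and "n = ?a x \<otimes>\<^bsub>K\<^esub> inv\<^bsub>K\<^esub> ?a y"
    have st: "s \<in> carrier K" "t \<in> carrier K" using x y by (simp_all add: s_def t_def)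
    have n: "n \<in> N" unfolding n_def by (rule K.r_coset_eqD[OF N.subgroup_axioms _ _ eq]) (use x y in auto)
    have "?a x = n \<otimes>\<^bsub>K\<^esub> ?a y" unfolding n_def using x y by (simp add: K.m_assoc)
    then have "s \<otimes>\<^bsub>K\<^esub> ?a x = s \<otimes>\<^bsub>K\<^esub> (n \<otimes>\<^bsub>K\<^esub> ?a y)" by (rule arg_cong)
    moreover have "s \<otimes>\<^bsub>K\<^esub> ?a x = x"
      unfolding s_def using x by (simp add: K.m_assoc[symmetric])
    ultimately have "x = s \<otimes>\<^bsub>K\<^esub> (n \<otimes>\<^bsub>K\<^esub> ?a y)" by simp
    then have "x = s \<otimes>\<^bsub>K\<^esub> n \<otimes>\<^bsub>K\<^esub> inv\<^bsub>K\<^esub> t \<otimes>\<^bsub>K\<^esub> y"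
      unfolding t_def[symmetric] using st n y by (simp add: K.m_assoc)
    then have "x \<otimes>\<^bsub>K\<^esub> inv\<^bsub>K\<^esub> y = s \<otimes>\<^bsub>K\<^esub> n \<otimes>\<^bsub>K\<^esub> inv\<^bsub>K\<^esub> t \<otimes>\<^bsub>K\<^esub> y \<otimes>\<^bsub>K\<^esub> inv\<^bsub>K\<^esub> y" by simp
    also have "\<dots> = s \<otimes>\<^bsub>K\<^esub> n \<otimes>\<^bsub>K\<^esub> inv\<^bsub>K\<^esub> t" using st n y by (simp add: K.m_assoc)
    also have "\<dots> = (s \<otimes>\<^bsub>K\<^esub> n \<otimes>\<^bsub>K\<^esub> inv\<^bsub>K\<^esub> s) \<otimes>\<^bsub>K\<^esub> (s \<otimes>\<^bsub>K\<^esub> inv\<^bsub>K\<^esub> t)"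
    proof -
      have "inv\<^bsub>K\<^esub> s \<otimes>\<^bsub>K\<^esub> (s \<otimes>\<^bsub>K\<^esub> inv\<^bsub>K\<^esub> t) = inv\<^bsub>K\<^esub> t" using st by (simp add: K.m_assoc[symmetric])
      then show ?thesis using st n by (simp add: K.m_assoc)
    qed
    also have "s \<otimes>\<^bsub>K\<^esub> inv\<^bsub>K\<^esub> t = \<sigma> (\<pi> x \<otimes>\<^bsub>?F\<^esub> inv\<^bsub>?F\<^esub> \<pi> y)" using x y by (simp add: s_def t_def)
    finally have "x \<otimes>\<^bsub>K\<^esub> inv\<^bsub>K\<^esub> y =
      s \<otimes>\<^bsub>K\<^esub> n \<otimes>\<^bsub>K\<^esub> inv\<^bsub>K\<^esub> s \<otimes>\<^bsub>K\<^esub> \<sigma> (\<pi> x \<otimes>\<^bsub>?F\<^esub> inv\<^bsub>?F\<^esub> \<pi> y)" .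
    moreover have "\<pi> x \<otimes>\<^bsub>?F\<^esub> inv\<^bsub>?F\<^esub> \<pi> y \<in> carrier ?F" using x y by simp
    ultimately show "x \<otimes>\<^bsub>K\<^esub> inv\<^bsub>K\<^esub> y \<in> F1"
      unfolding F1_def by (simp only: set_multI[OF N.inv_op_closed2[OF st(1) n] imageI])
  qed
  have AF1: "x \<in> N" if x: "x \<in> F1" "x \<in> A" for x
  proof -
    obtain n p where np: "n \<in> N" "p \<in> carrier ?F" "x = n \<otimes>\<^bsub>K\<^esub> \<sigma> p"
      using x(1) unfolding F1_def set_mult_def by blast
    have "\<pi> n = \<one>\<^bsub>?F\<^esub>" "n \<in> carrier K" using subsetD[OF N_A np(1)] unfolding A_iff by simp_all
    then have "\<pi> x = p" using np \<sigma>(2)[OF np(2)] by simp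
    then have "p = \<one>\<^bsub>?F\<^esub>" using x(2) unfolding A_iff by simp
    then show ?thesis using np \<open>n \<in> carrier K\<close> by simp
  qed
  define H where "H = generate K T"
  have H_sub: "subgroup H K" unfolding H_def by (rule K.generate_is_subgroup[OF T(2)])
  interpret H: subgroup H K by (rule H_sub)
  obtain T' where T': "finite T'" "T' \<subseteq> carrier K" "generate K T' = H \<inter> F1"
    using K.finitely_generated_Int_finite_index[OF T(1,2) F1] unfolding H_def by blast
  have "\<pi> ` T' \<subseteq> carrier ?F" using T'(2) by (blast intro: \<pi>.hom_closed)
  then have "separable_subgroup (generate ?F (\<pi> ` T')) ?F"
    using subgroup_separable_free_group[of S] T'(1) by (auto simp: subgroup_separable_def)
  then have sep: "separable_subgroup (\<pi> ` (H \<inter> F1)) ?F"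
    using \<pi>.generate_img[OF T'(2)] T'(3) by simp
  interpret KF: group "K\<lparr>carrier := F1\<rparr>" by (rule F1.subgroup_is_group[OF K])
  have "\<pi> \<in> hom (K\<lparr>carrier := F1\<rparr>) ?F" using \<pi>(1) by (auto simp: hom_def)
  from KF.separable_vimage[OF this group_presented_group sep]
  have "separable_subgroup {x \<in> F1. \<pi> x \<in> \<pi> ` (H \<inter> F1)} (K\<lparr>carrier := F1\<rparr>)" by simp
  \<comment> \<open>Two elements of \<open>F1\<close> with the same image differ by an element of
    \<open>F1 \<inter> A\<close>, hence of \<open>N\<close>, which \<open>H\<close>
    contains.\<close>
  moreover have "{x \<in> F1. \<pi> x \<in> \<pi> ` (H \<inter> F1)} = H \<inter> F1"
  proof (intro Set.equalityI subsetI)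
    fix x assume "x \<in> {x \<in> F1. \<pi> x \<in> \<pi> ` (H \<inter> F1)}"
    then obtain y where y: "x \<in> F1" "y \<in> H" "y \<in> F1" "\<pi> x = \<pi> y" by blast
    have c: "x \<in> carrier K" "y \<in> carrier K" using y by auto
    have "x \<otimes>\<^bsub>K\<^esub> inv\<^bsub>K\<^esub> y \<in> A" using y(4) c unfolding A_iff by simp
    then have "x \<otimes>\<^bsub>K\<^esub> inv\<^bsub>K\<^esub> y \<in> H" using AF1 y T(3) unfolding H_def by blast
    then have "x \<otimes>\<^bsub>K\<^esub> inv\<^bsub>K\<^esub> y \<otimes>\<^bsub>K\<^esub> y \<in> H" using y(2) by (rule H.m_closed)
    then show "x \<in> H \<inter> F1" using y c by (simp add: K.m_assoc)
  qed auto
  ultimately have "separable_subgroup (H \<inter> F1) (K\<lparr>carrier := F1\<rparr>)" by simp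
  from K.separable_if_finite_index[OF H_sub F1 this] show ?thesis unfolding H_def .
qed

text \<open>For \<open>g\<close> outside \<open>H\<close>, a normal subgroup \<open>N\<close> of
  finite index in \<open>A\<close> is found such that \<open>g\<close> avoids the product of
  \<open>N\<close> and \<open>H\<close>. Adjoining finitely many generators of \<open>N\<close> to
  \<open>T\<close> then gives a subgroup that still misses \<open>g\<close> and to which the
  preceding lemma applies.\<close>

lemma subgroup_separable_int_vec_by_free:
  assumes K: "group K" and \<pi>: "\<pi> \<in> hom K (free_group S)" "\<pi> ` carrier K = carrier (free_group S)"
    and A: "A = {x \<in> carrier K. \<pi> x = \<one>\<^bsub>free_group S\<^esub>}"
    and iso: "\<phi> \<in> iso (int_vec_group n) (K\<lparr>carrier := A\<rparr>)"
  shows "subgroup_separable K"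
  unfolding subgroup_separable_def
proof (intro allI impI)
  fix T assume T: "finite T \<and> T \<subseteq> carrier K"
  interpret K: group K by fact
  interpret \<pi>: group_hom K "free_group S" \<pi> using \<pi>(1) K group_presented_group by (simp add: group_hom_def group_hom_axioms_def)
  have A_normal: "A \<lhd> K" unfolding A using \<pi>.normal_kernel by (simp add: kernel_def)
  interpret A: normal A K by (rule A_normal)
  interpret KA: group "K\<lparr>carrier := A\<rparr>" by (rule A.subgroup_is_group[OF K])
  have \<phi>: "\<phi> \<in> hom (int_vec_group n) (K\<lparr>carrier := A\<rparr>)" "bij_betw \<phi> (int_vec n) A"
    using iso by (auto simp: iso_def)
  have \<phi>K: "\<phi> \<in> hom (int_vec_group n) K" using \<phi>(1) A.subset by (auto simp: hom_def Pi_iff)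
  interpret \<phi>: group_hom "int_vec_group n" K \<phi> using \<phi>K K group_int_vec_group by (simp add: group_hom_def group_hom_axioms_def)
  have \<phi>_A: "\<phi> z \<in> A" if "z \<in> int_vec n" for z using \<phi>(2) that by (auto simp: bij_betw_def)
  define H where "H = generate K T"
  have H_sub: "subgroup H K" unfolding H_def using K.generate_is_subgroup T by blast
  interpret H: subgroup H K by (rule H_sub)
  have "\<exists>U. finite_index_subgroup U K \<and> H \<subseteq> U \<and> g \<notin> U" if g: "g \<in> carrier K" "g \<notin> H" for g
  proof -
    \<comment> \<open>If some \<open>h\<close> brings \<open>g\<close> into \<open>A\<close>, the
      resulting vector \<open>z0\<close> lies outside the lattice of \<open>H \<inter> A\<close>,
      and residual finiteness of the quotient supplies \<open>m\<close>. If none does,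
      \<open>g\<close> is not even in the product of \<open>A\<close> and \<open>H\<close>, so
      \<open>m = 1\<close> suffices.\<close>
    have "\<exists>m>0. \<forall>z\<in>int_vec n. \<forall>h\<in>H. g \<noteq> \<phi> (scale (int m) z) \<otimes>\<^bsub>K\<^esub> h"
    proof (cases "\<exists>h\<in>H. g \<otimes>\<^bsub>K\<^esub> inv\<^bsub>K\<^esub> h \<in> A")
      case True
      then obtain h where h: "h \<in> H" "g \<otimes>\<^bsub>K\<^esub> inv\<^bsub>K\<^esub> h \<in> A" by blast
      then obtain z0 where z0: "z0 \<in> int_vec n" "\<phi> z0 = g \<otimes>\<^bsub>K\<^esub> inv\<^bsub>K\<^esub> h"
        using \<phi>(2) by (metis bij_betw_imp_surj_on imageE)
      define C where "C = {z \<in> int_vec n. \<phi> z \<in> H}"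
      have "subgroup C (int_vec_group n)"
        using \<phi>.subgroup_vimage[OF H_sub] by (simp add: C_def)
      then have C: "int_lattice C" "C \<subseteq> int_vec n" by (auto simp: subgroup_int_vec_iff)
      have "z0 \<notin> C"
      proof
        assume "z0 \<in> C"
        then have "g \<otimes>\<^bsub>K\<^esub> inv\<^bsub>K\<^esub> h \<otimes>\<^bsub>K\<^esub> h \<in> H" using z0 h H.m_closed by (simp add: C_def)
        then show False using g h by (simp add: K.m_assoc)
      qed
      from int_lattice_residually_finite[OF C z0(1) this] obtain m where
        m: "m > 0" "\<And>c z. c \<in> C \<Longrightarrow> z \<in> int_vec n \<Longrightarrow> z0 \<noteq> c + scale m z" by blast
      have "g \<noteq> \<phi> (scale m z) \<otimes>\<^bsub>K\<^esub> h'" if z: "z \<in> int_vec n" and h': "h' \<in> H" for z h'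
      proof
        assume eq: "g = \<phi> (scale m z) \<otimes>\<^bsub>K\<^esub> h'"
        have sc: "scale m z \<in> int_vec n" using z by (rule int_vec_closed)
        define c where "c = z0 - scale m z"
        have c: "c \<in> int_vec n" unfolding c_def using z0(1) sc by (rule int_vec_closed)
        have "z0 = scale m z + c" by (simp add: c_def)
        then have "\<phi> z0 = \<phi> (scale m z) \<otimes>\<^bsub>K\<^esub> \<phi> c" using \<phi>.hom_mult[of "scale m z" c] sc c by simp
        then have "\<phi> (scale m z) \<otimes>\<^bsub>K\<^esub> \<phi> c = \<phi> (scale m z) \<otimes>\<^bsub>K\<^esub> (h' \<otimes>\<^bsub>K\<^esub> inv\<^bsub>K\<^esub> h)"
          using z0(2) eq sc h h' \<phi>.hom_closed by (simp add: K.m_assoc)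
        then have "\<phi> c = h' \<otimes>\<^bsub>K\<^esub> inv\<^bsub>K\<^esub> h" using sc c h h' \<phi>.hom_closed by simp
        then have "c \<in> C" using c h h' by (simp add: C_def)
        moreover have "z0 = c + scale m z" by (simp add: c_def)
        ultimately show False using m(2) z by blast
      qed
      then show ?thesis using m(1) by (intro exI[of _ "nat m"]) auto
    next
      case False
      have "g \<noteq> \<phi> (scale (int 1) z) \<otimes>\<^bsub>K\<^esub> h" if "z \<in> int_vec n" "h \<in> H" for z h
      proof
        assume "g = \<phi> (scale (int 1) z) \<otimes>\<^bsub>K\<^esub> h"
        then have "g = \<phi> z \<otimes>\<^bsub>K\<^esub> h" by (simp add: scale_def)
        then have "g \<otimes>\<^bsub>K\<^esub> inv\<^bsub>K\<^esub> h = \<phi> z" using that \<phi>.hom_closed by (simp add: K.m_assoc)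
        then show False using False \<phi>_A that by metis
      qed
      then show ?thesis by (intro exI[of _ 1]) simp
    qed
    then obtain m :: nat where m: "m > 0"
      "\<And>z h. z \<in> int_vec n \<Longrightarrow> h \<in> H \<Longrightarrow> g \<noteq> \<phi> (scale (int m) z) \<otimes>\<^bsub>K\<^esub> h" by blast
    have lat: "subgroup (scale (int m) ` int_vec n) (int_vec_group n)"
      unfolding subgroup_int_vec_iff using int_lattice_scale int_vec_closed(5) by blast
    define N where "N = \<phi> ` scale (int m) ` int_vec n"
    have N_sub: "subgroup N K" unfolding N_def using \<phi>.subgroup_img_is_subgroup[OF lat] .
    \<comment> \<open>Written as the set of \<open>m\<close>-th powers in the normal subgroup
      \<open>A\<close>, the subgroup \<open>N\<close> is visibly stable under conjugation by
      \<open>K\<close>.\<close>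
    have N_eq: "N = (\<lambda>a. a [^]\<^bsub>K\<^esub> m) ` A"
    proof -
      have "N = (\<lambda>z. \<phi> z [^]\<^bsub>K\<^esub> m) ` int_vec n"
        unfolding N_def image_image using additive_scale_pow[OF K \<phi>K] by (intro image_cong) auto
      also have "\<dots> = (\<lambda>a. a [^]\<^bsub>K\<^esub> m) ` \<phi> ` int_vec n" by (simp add: image_image)
      finally show ?thesis using \<phi>(2) by (simp add: bij_betw_def)
    qed
    have N_normal: "N \<lhd> K"
    proof (rule K.normal_invI[OF N_sub])
      fix x h assume x: "x \<in> carrier K" "h \<in> N"
      then obtain a where a: "a \<in> A" "h = a [^]\<^bsub>K\<^esub> m" unfolding N_eq by blast
      have "x \<otimes>\<^bsub>K\<^esub> a \<otimes>\<^bsub>K\<^esub> inv\<^bsub>K\<^esub> x \<in> A" using A.inv_op_closed2[OF x(1) a(1)] .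
      then show "x \<otimes>\<^bsub>K\<^esub> h \<otimes>\<^bsub>K\<^esub> inv\<^bsub>K\<^esub> x \<in> N"
        unfolding N_eq a(2) K.conj_nat_pow[OF x(1) A.mem_carrier[OF a(1)]] by blast
    qed
    have "inv_into (int_vec n) \<phi> \<in> iso (K\<lparr>carrier := A\<rparr>) (int_vec_group n)"
      using group.iso_set_sym[OF group_int_vec_group iso] by simp
    then have inv_hom: "inv_into (int_vec n) \<phi> \<in> hom (K\<lparr>carrier := A\<rparr>) (int_vec_group n)" by (simp add: iso_def)
    have "finite_index_subgroup (scale (int m) ` int_vec n) (int_vec_group n)"
      by (rule finite_index_int_lattice[OF lat, of "int m"]) (use m in auto)
    from KA.finite_index_vimage[OF inv_hom group_int_vec_group this]
    have "finite_index_subgroup {x \<in> A. inv_into (int_vec n) \<phi> x \<in> scale (int m) ` int_vec n} (K\<lparr>carrier := A\<rparr>)" by simp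
    moreover have "{x \<in> A. inv_into (int_vec n) \<phi> x \<in> scale (int m) ` int_vec n} = N"
    proof (intro Set.equalityI subsetI)
      fix x assume "x \<in> {x \<in> A. inv_into (int_vec n) \<phi> x \<in> scale (int m) ` int_vec n}"
      then show "x \<in> N" unfolding N_def using bij_betw_inv_into_right[OF \<phi>(2), of x] by (metis (no_types, lifting) imageI mem_Collect_eq)
    next
      fix x assume "x \<in> N"
      then obtain z where z: "z \<in> int_vec n" "x = \<phi> (scale (int m) z)" unfolding N_def by blast
      have "scale (int m) z \<in> int_vec n" using z(1) by (rule int_vec_closed)
      then show "x \<in> {x \<in> A. inv_into (int_vec n) \<phi> x \<in> scale (int m) ` int_vec n}"
        unfolding z(2) using bij_betw_inv_into_left[OF \<phi>(2)] \<phi>_A z(1) by simp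
    qed
    ultimately have N_fin: "finite_index_subgroup N (K\<lparr>carrier := A\<rparr>)" by simp
    define B where "B = \<phi> ` scale (int m) ` unit_vec ` {..<n}"
    have B: "finite B" "B \<subseteq> N" unfolding B_def N_def by auto
    have B_c: "B \<subseteq> carrier K" using B(2) N_sub subgroup.subset by blast
    have gen_B: "generate K B = N"
    proof -
      have "\<phi> \<circ> scale (int m) \<in> hom (int_vec_group n) K"
      proof (rule homI)
        fix x y assume "x \<in> carrier (int_vec_group n)" "y \<in> carrier (int_vec_group n)"
        then have xy: "scale (int m) x \<in> int_vec n" "scale (int m) y \<in> int_vec n" by (simp_all add: int_vec_def)
        have "scale (int m) (x + y) = scale (int m) x + scale (int m) y" by (rule scale_simps)
        then show "(\<phi> \<circ> scale (int m)) (x \<otimes>\<^bsub>int_vec_group n\<^esub> y) = (\<phi> \<circ> scale (int m)) x \<otimes>\<^bsub>K\<^esub> (\<phi> \<circ> scale (int m)) y"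
          using \<phi>.hom_mult[of "scale (int m) x" "scale (int m) y"] xy by simp
      next
        fix x assume "x \<in> carrier (int_vec_group n)"
        then have "scale (int m) x \<in> int_vec n" by (simp add: int_vec_def)
        then show "(\<phi> \<circ> scale (int m)) x \<in> carrier K" using \<phi>.hom_closed by simp
      qed
      then interpret \<phi>m: group_hom "int_vec_group n" K "\<phi> \<circ> scale (int m)"
        using K group_int_vec_group by (simp add: group_hom_def group_hom_axioms_def)
      have "generate K ((\<phi> \<circ> scale (int m)) ` unit_vec ` {..<n})
        = (\<phi> \<circ> scale (int m)) ` generate (int_vec_group n) (unit_vec ` {..<n})"
        by (rule \<phi>m.generate_img) auto
      then show ?thesis unfolding generate_unit_vecs B_def N_def by (simp only: image_comp o_assoc)
    qed
    \<comment> \<open>The enlarged generating set stays inside the product of \<open>N\<close> and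
      \<open>H\<close>, so \<open>g\<close> is still excluded, while the generated subgroup now
      contains \<open>N\<close>.\<close>
    define T1 where "T1 = T \<union> B"
    have T1: "finite T1" "T1 \<subseteq> carrier K" using T B B_c by (auto simp: T1_def)
    have "N \<subseteq> generate K T1" unfolding gen_B[symmetric] by (rule K.mono_generate) (simp add: T1_def)
    from subgroup_separable_modulo[OF K \<pi> A N_normal N_fin T1 this]
    have sep: "separable_subgroup (generate K T1) K" .
    have "subgroup (N <#>\<^bsub>K\<^esub> H) K"
      using second_isomorphism_grp.normal_set_mult_subgroup[of N K H] N_normal H_sub
      by (simp add: second_isomorphism_grp_def second_isomorphism_grp_axioms_def)
    moreover have "T1 \<subseteq> N <#>\<^bsub>K\<^esub> H"
    proof
      fix x assume x: "x \<in> T1"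
      show "x \<in> N <#>\<^bsub>K\<^esub> H"
      proof (cases "x \<in> T")
        case True
        then have "x \<in> H" unfolding H_def by (rule generate.incl)
        then have "\<one>\<^bsub>K\<^esub> \<otimes>\<^bsub>K\<^esub> x \<in> N <#>\<^bsub>K\<^esub> H" by (rule set_multI[OF subgroup.one_closed[OF N_sub]])
        then show ?thesis using \<open>x \<in> H\<close> by simp
      next
        case False
        then have "x \<in> N" using x B by (auto simp: T1_def)
        then have "x \<otimes>\<^bsub>K\<^esub> \<one>\<^bsub>K\<^esub> \<in> N <#>\<^bsub>K\<^esub> H" by (rule set_multI[OF _ H.one_closed])
        then show ?thesis using subgroup.mem_carrier[OF N_sub \<open>x \<in> N\<close>] by simp
      qed
    qed
    ultimately have "generate K T1 \<subseteq> N <#>\<^bsub>K\<^esub> H" by (intro K.generate_subgroup_incl)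
    moreover have "g \<notin> N <#>\<^bsub>K\<^esub> H" using m(2) unfolding N_def set_mult_def by blast
    ultimately obtain U where "finite_index_subgroup U K" "generate K T1 \<subseteq> U" "g \<notin> U"
      using sep g(1) unfolding K.separable_subgroup_iff by blast
    moreover have "H \<subseteq> generate K T1" unfolding H_def by (rule K.mono_generate) (simp add: T1_def)
    ultimately show ?thesis by blast
  qed
  then show "separable_subgroup (generate K T) K"
    using H_sub unfolding H_def[symmetric] K.separable_subgroup_iff by blast
qed

text \<open>The quotient map followed by the isomorphism to a free group gives a surjection with
  kernel \<open>A\<close>, the form in which the extension lemma is stated; afterwards separability
  passes from \<open>H\<close> to \<open>G\<close>.\<close>

theorem subgroup_separable_if_virtually_Zpow_by_free:
  fixes G :: "('a, 'm) monoid_scheme"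
  assumes G: "group G" and "virtually_Zpow_by_free n G"
  shows "subgroup_separable G"
proof -
  obtain H A where H: "finite_index_subgroup H G" and A: "A \<lhd> G\<lparr>carrier := H\<rparr>"
    "G\<lparr>carrier := H, carrier := A\<rparr> \<cong> Zpow n" "is_free_group (G\<lparr>carrier := H\<rparr> Mod A)"
    using assms(2) by (auto simp: virtually_Zpow_by_free_def Zpow_by_free_def)
  interpret G: group G by fact
  let ?K = "G\<lparr>carrier := H\<rparr>"
  interpret A: normal A ?K by (rule A(1))
  have K: "group ?K" using A.is_group .
  obtain S :: "'a set set" and \<iota> where \<iota>: "\<iota> \<in> iso (?K Mod A) (free_group S)"
    using A(3) unfolding is_free_group_def is_iso_def by blast
  define \<pi> where "\<pi> = \<iota> \<circ> (\<lambda>x. A #>\<^bsub>?K\<^esub> x)"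
  have \<iota>h: "\<iota> \<in> hom (?K Mod A) (free_group S)" "bij_betw \<iota> (carrier (?K Mod A)) (carrier (free_group S))"
    using \<iota> by (auto simp: iso_def)
  have \<pi>: "\<pi> \<in> hom ?K (free_group S)" unfolding \<pi>_def
    by (rule hom_compose[OF A.r_coset_hom_Mod \<iota>h(1)])
  have \<pi>_surj: "\<pi> ` carrier ?K = carrier (free_group S)"
    using \<iota>h(2) unfolding \<pi>_def image_comp[symmetric] carrier_FactGroup[symmetric] by (simp only: bij_betw_def)
  have "\<pi> x = \<one>\<^bsub>free_group S\<^esub> \<longleftrightarrow> x \<in> A" if x: "x \<in> carrier ?K" for x
  proof -
    have \<iota>1: "\<iota> A = \<one>\<^bsub>free_group S\<^esub>"
      using hom_one[OF \<iota>h(1) A.factorgroup_is_group group_presented_group] by simp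
    have "A #>\<^bsub>?K\<^esub> x \<in> carrier (?K Mod A)" "A \<in> carrier (?K Mod A)"
      using x group.is_monoid[OF A.factorgroup_is_group] monoid.one_closed[of "?K Mod A"] carrier_FactGroup by (blast, simp)
    then have "\<pi> x = \<iota> A \<longleftrightarrow> A #>\<^bsub>?K\<^esub> x = A"
      using \<iota>h(2) by (auto simp: \<pi>_def bij_betw_def inj_on_def)
    also have "\<dots> \<longleftrightarrow> x \<in> A"
      using group.coset_join1[OF K _ x A.subgroup_axioms] group.coset_join2[OF K x A.subgroup_axioms] by blast
    finally show ?thesis using \<iota>1 by simp
  qed
  then have A_eq: "A = {x \<in> carrier ?K. \<pi> x = \<one>\<^bsub>free_group S\<^esub>}" using A.subset by blast
  have KA: "group (?K\<lparr>carrier := A\<rparr>)" by (rule A.subgroup_is_group[OF K])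
  have "Zpow n \<cong> ?K\<lparr>carrier := A\<rparr>" using group.iso_sym[OF KA] A(2) by simp
  then have "int_vec_group n \<cong> ?K\<lparr>carrier := A\<rparr>" using iso_trans[OF int_vec_group_iso_Zpow] by blast
  then obtain \<phi> where "\<phi> \<in> iso (int_vec_group n) (?K\<lparr>carrier := A\<rparr>)" unfolding is_iso_def by blast
  from subgroup_separable_int_vec_by_free[OF K \<pi> \<pi>_surj A_eq this]
  show ?thesis by (rule G.subgroup_separable_finite_index[OF H])
qed

section \<open>The path group of a graph of groups\<close>

lemma relator_class:
  "r \<in> R \<Longrightarrow> r \<in> words S \<Longrightarrow> word_class S R r = \<one>\<^bsub>presented_group S R\<^esub>"
  using word_class_eqI[OF word_rel.relator[of r R "[]" "[]" S]] by (simp add: one_presented_group)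

lemma (in group) eq_if_mult_inv_eq_one:
  assumes "a \<otimes> inv b = \<one>" "a \<in> carrier G" "b \<in> carrier G" shows "a = b"
  using inv_equality[OF assms(1)] assms by simp

context graph_of_groups
begin

abbreviation "V \<equiv> verts (base_graph Y)"
abbreviation "E \<equiv> arcs (base_graph Y)"
abbreviation "src \<equiv> tail (base_graph Y)"
abbreviation "tgt \<equiv> head (base_graph Y)"
abbreviation "PG \<equiv> path_group Y"

abbreviation gens_class :: "('v \<times> 'g + 'e) word \<Rightarrow> ('v \<times> 'g + 'e) word set" where
  "gens_class \<equiv> word_class (path_gens Y) (path_relators Y)"

definition vertex_elem :: "'v \<Rightarrow> 'g \<Rightarrow> ('v \<times> 'g + 'e) word set" where
  "vertex_elem v g = gens_class [(Inl (v, g), True)]"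

definition arc_elem :: "'e \<Rightarrow> ('v \<times> 'g + 'e) word set" where
  "arc_elem e = gens_class [(Inr e, True)]"

lemma src_tgt [simp, intro]: "e \<in> E \<Longrightarrow> src e \<in> V" "e \<in> E \<Longrightarrow> tgt e \<in> V"
  using wf_graph by (auto simp: wf_digraph_def)

lemma emb_hom:
  assumes "e \<in> E"
  shows "tail_emb Y e \<in> hom (egroup Y e) (vgroup Y (src e))" "head_emb Y e \<in> hom (egroup Y e) (vgroup Y (tgt e))"
    "inj_on (tail_emb Y e) (carrier (egroup Y e))" "inj_on (head_emb Y e) (carrier (egroup Y e))"
  using tail_emb_mon[OF assms] head_emb_mon[OF assms] by (auto simp: mon_def)

lemma emb_closed [simp, intro]:
  assumes "e \<in> E" "a \<in> carrier (egroup Y e)"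
  shows "tail_emb Y e a \<in> carrier (vgroup Y (src e))" "head_emb Y e a \<in> carrier (vgroup Y (tgt e))"
  using emb_hom[OF assms(1)] assms(2) by (auto simp: hom_def)

lemma in_path_gens [simp]:
  "Inl (v, g) \<in> path_gens Y \<longleftrightarrow> v \<in> V \<and> g \<in> carrier (vgroup Y v)" "Inr e \<in> path_gens Y \<longleftrightarrow> e \<in> E"
  by (auto simp: path_gens_def)

lemma group_path_group: "group PG"
  unfolding path_group_def by (rule group_presented_group)

sublocale PG: group "path_group Y" by (rule group_path_group)

lemma vertex_elem_closed [simp, intro]:
  "v \<in> V \<Longrightarrow> g \<in> carrier (vgroup Y v) \<Longrightarrow> vertex_elem v g \<in> carrier PG"
  unfolding vertex_elem_def path_group_def by (intro word_class_in_carrier) simp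

lemma arc_elem_closed [simp, intro]: "e \<in> E \<Longrightarrow> arc_elem e \<in> carrier PG"
  unfolding arc_elem_def path_group_def by (intro word_class_in_carrier) simp

lemma gens_class_Nil: "gens_class [] = \<one>\<^bsub>PG\<^esub>"
  by (simp add: path_group_def one_presented_group)

lemma gens_class_append:
  "u \<in> words (path_gens Y) \<Longrightarrow> w \<in> words (path_gens Y) \<Longrightarrow>
    gens_class (u @ w) = gens_class u \<otimes>\<^bsub>PG\<^esub> gens_class w"
  unfolding path_group_def by (rule presented_group_mult[symmetric])

lemma gens_class_Cons:
  assumes "s \<in> path_gens Y" "w \<in> words (path_gens Y)"
  shows "gens_class ((s, True) # w) = gens_class [(s, True)] \<otimes>\<^bsub>PG\<^esub> gens_class w"
    "gens_class ((s, False) # w) = inv\<^bsub>PG\<^esub> gens_class [(s, True)] \<otimes>\<^bsub>PG\<^esub> gens_class w"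
proof -
  have "inv\<^bsub>PG\<^esub> gens_class [(s, True)] = gens_class [(s, False)]"
    using inv_word_class[of "[(s, True)]" "path_gens Y" "path_relators Y"] assms
    by (simp add: inverse_word_def path_group_def)
  then show "gens_class ((s, True) # w) = gens_class [(s, True)] \<otimes>\<^bsub>PG\<^esub> gens_class w"
    "gens_class ((s, False) # w) = inv\<^bsub>PG\<^esub> gens_class [(s, True)] \<otimes>\<^bsub>PG\<^esub> gens_class w"
    using gens_class_append[of "[(s, True)]" w] gens_class_append[of "[(s, False)]" w] assms by auto
qed

lemma gens_class_vertex:
  assumes "v \<in> V" "g \<in> carrier (vgroup Y v)" "w \<in> words (path_gens Y)"
  shows "gens_class ((Inl (v, g), True) # w) = vertex_elem v g \<otimes>\<^bsub>PG\<^esub> gens_class w"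
    "gens_class ((Inl (v, g), False) # w) = inv\<^bsub>PG\<^esub> vertex_elem v g \<otimes>\<^bsub>PG\<^esub> gens_class w"
  unfolding vertex_elem_def using assms by (auto intro!: gens_class_Cons)

lemma gens_class_arc:
  assumes "e \<in> E" "w \<in> words (path_gens Y)"
  shows "gens_class ((Inr e, True) # w) = arc_elem e \<otimes>\<^bsub>PG\<^esub> gens_class w"
    "gens_class ((Inr e, False) # w) = inv\<^bsub>PG\<^esub> arc_elem e \<otimes>\<^bsub>PG\<^esub> gens_class w"
  unfolding arc_elem_def using assms by (auto intro!: gens_class_Cons)

lemma vertex_elem_hom: 
  assumes v: "v \<in> V" shows "vertex_elem v \<in> hom (vgroup Y v) PG"
proof (rule homI)
  fix g h assume gh: "g \<in> carrier (vgroup Y v)" "h \<in> carrier (vgroup Y v)"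
  interpret Gv: group "vgroup Y v" by (rule group_vgroup[OF v])
  let ?k = "g \<otimes>\<^bsub>vgroup Y v\<^esub> h"
  let ?r = "[(Inl (v, g), True), (Inl (v, h), True), (Inl (v, ?k), False)] :: ('v \<times> 'g + 'e) word"
  have k: "?k \<in> carrier (vgroup Y v)" using gh by simp
  have "?r \<in> path_relators Y" unfolding path_relators_def using v gh by blast
  moreover have "?r \<in> words (path_gens Y)" using v gh k by simp
  ultimately have "gens_class ?r = \<one>\<^bsub>PG\<^esub>" unfolding path_group_def by (rule relator_class)
  moreover have "gens_class ?r = vertex_elem v g \<otimes>\<^bsub>PG\<^esub> (vertex_elem v h \<otimes>\<^bsub>PG\<^esub> (inv\<^bsub>PG\<^esub> vertex_elem v ?k \<otimes>\<^bsub>PG\<^esub> \<one>\<^bsub>PG\<^esub>))"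
    using v gh k by (simp add: gens_class_vertex gens_class_Nil)
  ultimately have "vertex_elem v g \<otimes>\<^bsub>PG\<^esub> vertex_elem v h \<otimes>\<^bsub>PG\<^esub> inv\<^bsub>PG\<^esub> vertex_elem v ?k = \<one>\<^bsub>PG\<^esub>"
    using v gh k by (simp add: PG.m_assoc)
  from PG.eq_if_mult_inv_eq_one[OF this] show "vertex_elem v ?k = vertex_elem v g \<otimes>\<^bsub>PG\<^esub> vertex_elem v h"
    using v gh k by simp
qed (use v in simp)

lemma vertex_elem_mult:
  "v \<in> V \<Longrightarrow> g \<in> carrier (vgroup Y v) \<Longrightarrow> h \<in> carrier (vgroup Y v) \<Longrightarrow>
    vertex_elem v (g \<otimes>\<^bsub>vgroup Y v\<^esub> h) = vertex_elem v g \<otimes>\<^bsub>PG\<^esub> vertex_elem v h"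
  by (rule hom_mult[OF vertex_elem_hom])

lemma vertex_elem_one: "v \<in> V \<Longrightarrow> vertex_elem v \<one>\<^bsub>vgroup Y v\<^esub> = \<one>\<^bsub>PG\<^esub>"
  by (rule hom_one[OF vertex_elem_hom group_vgroup group_path_group])

lemma vertex_elem_inv:
  assumes "v \<in> V" "g \<in> carrier (vgroup Y v)"
  shows "vertex_elem v (inv\<^bsub>vgroup Y v\<^esub> g) = inv\<^bsub>PG\<^esub> vertex_elem v g"
  using group_hom.hom_inv[of "vgroup Y v" PG "vertex_elem v" g] assms vertex_elem_hom group_vgroup group_path_group
  by (simp add: group_hom_def group_hom_axioms_def)

lemma arc_relation:
  assumes e: "e \<in> E" and a: "a \<in> carrier (egroup Y e)"
  shows "arc_elem e \<otimes>\<^bsub>PG\<^esub> vertex_elem (tgt e) (head_emb Y e a) = vertex_elem (src e) (tail_emb Y e a) \<otimes>\<^bsub>PG\<^esub> arc_elem e"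
proof -
  let ?r = "[(Inr e, True), (Inl (tgt e, head_emb Y e a), True), (Inr e, False),
      (Inl (src e, tail_emb Y e a), False)] :: ('v \<times> 'g + 'e) word"
  have "?r \<in> path_relators Y" unfolding path_relators_def using e a by blast
  moreover have "?r \<in> words (path_gens Y)" using e a by simp
  ultimately have "gens_class ?r = \<one>\<^bsub>PG\<^esub>" unfolding path_group_def by (rule relator_class)
  moreover have "gens_class ?r = arc_elem e \<otimes>\<^bsub>PG\<^esub> (vertex_elem (tgt e) (head_emb Y e a) \<otimes>\<^bsub>PG\<^esub>
      (inv\<^bsub>PG\<^esub> arc_elem e \<otimes>\<^bsub>PG\<^esub> (inv\<^bsub>PG\<^esub> vertex_elem (src e) (tail_emb Y e a) \<otimes>\<^bsub>PG\<^esub> \<one>\<^bsub>PG\<^esub>)))"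
    using e a by (simp add: gens_class_vertex gens_class_arc gens_class_Nil)
  ultimately have "arc_elem e \<otimes>\<^bsub>PG\<^esub> vertex_elem (tgt e) (head_emb Y e a) \<otimes>\<^bsub>PG\<^esub> inv\<^bsub>PG\<^esub> (vertex_elem (src e) (tail_emb Y e a) \<otimes>\<^bsub>PG\<^esub> arc_elem e) = \<one>\<^bsub>PG\<^esub>"
    using e a by (simp add: PG.m_assoc PG.inv_mult_group)
  then show ?thesis by (rule PG.eq_if_mult_inv_eq_one) (use e a in auto)
qed

text \<open>Von Dyck's theorem for the path group: homomorphisms on the vertex groups and arbitrary
  elements for the arcs extend as soon as the arc relations hold. It is the source of the retraction
  onto the fundamental group.\<close>

lemma path_group_hom:
  assumes "group K" and f: "\<And>v. v \<in> V \<Longrightarrow> f v \<in> hom (vgroup Y v) K" and t: "\<And>e. e \<in> E \<Longrightarrow> t e \<in> carrier K"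
    and rel: "\<And>e a. e \<in> E \<Longrightarrow> a \<in> carrier (egroup Y e) \<Longrightarrow>
      t e \<otimes>\<^bsub>K\<^esub> f (tgt e) (head_emb Y e a) = f (src e) (tail_emb Y e a) \<otimes>\<^bsub>K\<^esub> t e"
  obtains h where "h \<in> hom PG K" "\<And>v g. v \<in> V \<Longrightarrow> g \<in> carrier (vgroup Y v) \<Longrightarrow> h (vertex_elem v g) = f v g"
    "\<And>e. e \<in> E \<Longrightarrow> h (arc_elem e) = t e"
proof -
  interpret K: group K by fact
  let ?f = "case_sum (\<lambda>(v, g). f v g) t"
  have fc: "f v g \<in> carrier K" if "v \<in> V" "g \<in> carrier (vgroup Y v)" for v g
    using f[OF that(1)] that(2) by (auto simp: hom_def)
  have fP: "?f \<in> path_gens Y \<rightarrow> carrier K" unfolding path_gens_def using fc t by auto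
  have ev: "eval_word K ?f r = \<one>\<^bsub>K\<^esub>" if "r \<in> path_relators Y" "r \<in> words (path_gens Y)" for r
    using that(1) unfolding path_relators_def
  proof (elim UnE CollectE exE conjE)
    fix v g h assume r: "r = [(Inl (v, g), True), (Inl (v, h), True), (Inl (v, g \<otimes>\<^bsub>vgroup Y v\<^esub> h), False)]"
      and v: "v \<in> V" "g \<in> carrier (vgroup Y v)" "h \<in> carrier (vgroup Y v)"
    have "f v (g \<otimes>\<^bsub>vgroup Y v\<^esub> h) = f v g \<otimes>\<^bsub>K\<^esub> f v h" using hom_mult[OF f[OF v(1)] v(2,3)] .
    then show ?thesis using fc[OF v(1,2)] fc[OF v(1,3)] by (simp add: r K.m_assoc[symmetric])
  next
    fix e a assume r: "r = [(Inr e, True), (Inl (tgt e, head_emb Y e a), True), (Inr e, False), (Inl (src e, tail_emb Y e a), False)]"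
      and e: "e \<in> E" "a \<in> carrier (egroup Y e)"
    have c: "t e \<in> carrier K" "f (tgt e) (head_emb Y e a) \<in> carrier K" "f (src e) (tail_emb Y e a) \<in> carrier K"
      using e t fc by auto
    have "eval_word K ?f r = (t e \<otimes>\<^bsub>K\<^esub> f (tgt e) (head_emb Y e a)) \<otimes>\<^bsub>K\<^esub> (inv\<^bsub>K\<^esub> t e \<otimes>\<^bsub>K\<^esub> inv\<^bsub>K\<^esub> f (src e) (tail_emb Y e a))"
      using c by (simp add: r K.m_assoc)
    also have "\<dots> = \<one>\<^bsub>K\<^esub>" unfolding rel[OF e] using c by (simp add: K.inv_mult_group[symmetric])
    finally show ?thesis .
  qed
  obtain h where h: "h \<in> hom (presented_group (path_gens Y) (path_relators Y)) K"
    "\<And>w. w \<in> words (path_gens Y) \<Longrightarrow> h (gens_class w) = eval_word K ?f w"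
    "\<And>s. s \<in> path_gens Y \<Longrightarrow> h (gens_class [(s, True)]) = ?f s"
    by (rule K.presented_group_hom[OF fP, where R = "path_relators Y"]) (erule (1) ev, rule that)
  show ?thesis
  proof (rule that[of h])
    show "h \<in> hom PG K" unfolding path_group_def by (rule h(1))
    show "h (vertex_elem v g) = f v g" if "v \<in> V" "g \<in> carrier (vgroup Y v)" for v g
      using h(3)[of "Inl (v, g)"] that by (simp add: vertex_elem_def)
    show "h (arc_elem e) = t e" if "e \<in> E" for e
      using h(3)[of "Inr e"] that by (simp add: arc_elem_def)
  qed
qed

text \<open>For a right action the arc relation becomes the intertwining property of
  \<open>b e\<close> between the two actions of the edge group. Bijectivity is demanded of the arcs
  alone; an element of a vertex group is inverted by the action of its inverse.\<close>

lemma path_group_action: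
  assumes \<phi>: "\<And>v g x. v \<in> V \<Longrightarrow> g \<in> carrier (vgroup Y v) \<Longrightarrow> x \<in> X \<Longrightarrow> \<phi> v g x \<in> X"
    and \<phi>_mult: "\<And>v g h x. v \<in> V \<Longrightarrow> g \<in> carrier (vgroup Y v) \<Longrightarrow> h \<in> carrier (vgroup Y v) \<Longrightarrow> x \<in> X \<Longrightarrow>
      \<phi> v (g \<otimes>\<^bsub>vgroup Y v\<^esub> h) x = \<phi> v h (\<phi> v g x)"
    and \<phi>_one: "\<And>v x. v \<in> V \<Longrightarrow> x \<in> X \<Longrightarrow> \<phi> v \<one>\<^bsub>vgroup Y v\<^esub> x = x"
    and b: "\<And>e. e \<in> E \<Longrightarrow> bij_betw (b e) X X"
    and rel: "\<And>e a x. e \<in> E \<Longrightarrow> a \<in> carrier (egroup Y e) \<Longrightarrow> x \<in> X \<Longrightarrow>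
      b e (\<phi> (src e) (tail_emb Y e a) x) = \<phi> (tgt e) (head_emb Y e a) (b e x)"
  obtains \<alpha> where
    "\<And>v g x. v \<in> V \<Longrightarrow> g \<in> carrier (vgroup Y v) \<Longrightarrow> x \<in> X \<Longrightarrow> \<alpha> (vertex_elem v g) x = \<phi> v g x"
    "\<And>e x. e \<in> E \<Longrightarrow> x \<in> X \<Longrightarrow> \<alpha> (arc_elem e) x = b e x"
    "\<And>p x. p \<in> carrier PG \<Longrightarrow> x \<in> X \<Longrightarrow> \<alpha> p x \<in> X"
    "\<And>p q x. p \<in> carrier PG \<Longrightarrow> q \<in> carrier PG \<Longrightarrow> x \<in> X \<Longrightarrow> \<alpha> (p \<otimes>\<^bsub>PG\<^esub> q) x = \<alpha> q (\<alpha> p x)"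
proof -
  let ?\<beta> = "case_sum (\<lambda>(v, g). \<phi> v g) b"
  let ?P = "presented_group (path_gens Y) (path_relators Y)"
  have bij\<phi>: "bij_betw (\<phi> v g) X X" if v: "v \<in> V" "g \<in> carrier (vgroup Y v)" for v g
  proof -
    interpret Gv: group "vgroup Y v" by (rule group_vgroup[OF v(1)])
    show ?thesis
      by (rule bij_betwI[where g = "\<phi> v (inv\<^bsub>vgroup Y v\<^esub> g)"])
        (use v \<phi> \<phi>_one \<phi>_mult[of v g "inv\<^bsub>vgroup Y v\<^esub> g", symmetric] \<phi>_mult[of v "inv\<^bsub>vgroup Y v\<^esub> g" g, symmetric] in auto)
  qed
  have bij: "bij_betw (?\<beta> s) X X" if "s \<in> path_gens Y" for s
    using that bij\<phi> b unfolding path_gens_def by auto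
  have ev: "fold (letter_action X ?\<beta>) r x = x"
    if "r \<in> path_relators Y" "r \<in> words (path_gens Y)" and x: "x \<in> X" for r x
    using that(1) unfolding path_relators_def
  proof (elim UnE CollectE exE conjE)
    fix v g h assume r: "r = [(Inl (v, g), True), (Inl (v, h), True), (Inl (v, g \<otimes>\<^bsub>vgroup Y v\<^esub> h), False)]"
      and v: "v \<in> V" "g \<in> carrier (vgroup Y v)" "h \<in> carrier (vgroup Y v)"
    interpret Gv: group "vgroup Y v" by (rule group_vgroup[OF v(1)])
    have k: "g \<otimes>\<^bsub>vgroup Y v\<^esub> h \<in> carrier (vgroup Y v)" using v by simp
    show ?thesis using bij_betw_inv_into_left[OF bij\<phi>[OF v(1) k] x] \<phi>_mult[OF v x] by (simp add: r)
  next
    fix e a assume r: "r = [(Inr e, True), (Inl (tgt e, head_emb Y e a), True), (Inr e, False), (Inl (src e, tail_emb Y e a), False)]"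
      and e: "e \<in> E" "a \<in> carrier (egroup Y e)"
    let ?y = "\<phi> (src e) (tail_emb Y e a) x"
    have y: "?y \<in> X" using e x by (intro \<phi>) auto
    have "inv_into X (b e) (\<phi> (tgt e) (head_emb Y e a) (b e x)) = ?y"
      using bij_betw_inv_into_left[OF b[OF e(1)] y] rel[OF e x] by simp
    then show ?thesis using bij_betw_inv_into_left[OF bij\<phi>[of "src e" "tail_emb Y e a"] x] e by (simp add: r)
  qed
  obtain \<alpha> where \<alpha>:
    "\<And>w x. w \<in> words (path_gens Y) \<Longrightarrow> x \<in> X \<Longrightarrow> \<alpha> (gens_class w) x = fold (letter_action X ?\<beta>) w x"
    "\<And>p x. p \<in> carrier ?P \<Longrightarrow> x \<in> X \<Longrightarrow> \<alpha> p x \<in> X"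
    "\<And>p q x. p \<in> carrier ?P \<Longrightarrow> q \<in> carrier ?P \<Longrightarrow> x \<in> X \<Longrightarrow> \<alpha> (p \<otimes>\<^bsub>?P\<^esub> q) x = \<alpha> q (\<alpha> p x)"
    by (rule presented_group_action[where R = "path_relators Y", OF bij]) (assumption, erule (2) ev, rule that)
  show ?thesis
  proof (rule that[of \<alpha>])
    show "\<alpha> (vertex_elem v g) x = \<phi> v g x" if "v \<in> V" "g \<in> carrier (vgroup Y v)" "x \<in> X" for v g x
      using \<alpha>(1)[of "[(Inl (v, g), True)]" x] that by (simp add: vertex_elem_def)
    show "\<alpha> (arc_elem e) x = b e x" if "e \<in> E" "x \<in> X" for e x
      using \<alpha>(1)[of "[(Inr e, True)]" x] that by (simp add: arc_elem_def)
  qed (fact \<alpha>(2,3)[folded path_group_def])+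
qed

section \<open>The fundamental groupoid inside the path group\<close>

text \<open>The morphisms from \<open>v\<close> to \<open>w\<close> in the fundamental groupoid.
  Open paths are kept because later arguments transport vertex groups and follow tree paths between
  different vertices.\<close>

definition paths :: "'v \<Rightarrow> 'v \<Rightarrow> ('v \<times> 'g + 'e) word set set" where
  "paths v w = {gens_class c | c. gog_path Y v w c}"

lemma gog_path_words:
  assumes "gog_path Y v w c" shows "c \<in> words (path_gens Y) \<and> v \<in> V \<and> w \<in> V"
  using assms by induction auto

lemma paths_closed:
  assumes "x \<in> paths v w" shows "x \<in> carrier PG" "v \<in> V" "w \<in> V"
proof -
  obtain c where c: "gog_path Y v w c" "x = gens_class c" using assms unfolding paths_def by blast
  note c' = gog_path_words[OF c(1)]
  show "x \<in> carrier PG" unfolding c(2) path_group_def using c' by (intro word_class_in_carrier) (rule conjunct1)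
  show "v \<in> V" "w \<in> V" using c' by (rule conjunct2[THEN conjunct1], rule conjunct2[THEN conjunct2])
qed

lemma gog_path_class:
  assumes "gog_path Y v (src e) c" "e \<in> E" "g \<in> carrier (vgroup Y (tgt e))"
  shows "gens_class (c @ [(Inr e, True), (Inl (tgt e, g), True)]) = gens_class c \<otimes>\<^bsub>PG\<^esub> arc_elem e \<otimes>\<^bsub>PG\<^esub> vertex_elem (tgt e) g"
proof -
  have c: "c \<in> words (path_gens Y)" "gens_class c \<in> carrier PG"
    using gog_path_words[OF assms(1)] unfolding path_group_def by (auto intro!: word_class_in_carrier)
  have "gens_class [(Inr e, True), (Inl (tgt e, g), True)] = arc_elem e \<otimes>\<^bsub>PG\<^esub> vertex_elem (tgt e) g"
    unfolding arc_elem_def vertex_elem_def by (rule gens_class_Cons) (use assms in auto)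
  moreover have "[(Inr e, True), (Inl (tgt e, g), True)] \<in> words (path_gens Y)" using assms by simp
  ultimately show ?thesis using gens_class_append[OF c(1)] PG.m_assoc[OF c(2), of "arc_elem e" "vertex_elem (tgt e) g"] assms
    by simp
qed

lemma gog_path_class_backward:
  assumes "gog_path Y v (tgt e) c" "e \<in> E" "g \<in> carrier (vgroup Y (src e))"
  shows "gens_class (c @ [(Inr e, False), (Inl (src e, g), True)]) = gens_class c \<otimes>\<^bsub>PG\<^esub> inv\<^bsub>PG\<^esub> arc_elem e \<otimes>\<^bsub>PG\<^esub> vertex_elem (src e) g"
proof -
  have c: "c \<in> words (path_gens Y)" "gens_class c \<in> carrier PG"
    using gog_path_words[OF assms(1)] unfolding path_group_def by (auto intro!: word_class_in_carrier)
  have "gens_class [(Inr e, False), (Inl (src e, g), True)] = inv\<^bsub>PG\<^esub> arc_elem e \<otimes>\<^bsub>PG\<^esub> vertex_elem (src e) g"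
    unfolding arc_elem_def vertex_elem_def by (rule gens_class_Cons) (use assms in auto)
  moreover have "[(Inr e, False), (Inl (src e, g), True)] \<in> words (path_gens Y)" using assms by simp
  ultimately show ?thesis using gens_class_append[OF c(1)] PG.m_assoc[OF c(2), of "inv\<^bsub>PG\<^esub> arc_elem e" "vertex_elem (src e) g"] assms
    by simp
qed

lemma paths_base:
  assumes "v \<in> V" "g \<in> carrier (vgroup Y v)" shows "vertex_elem v g \<in> paths v v"
  unfolding paths_def vertex_elem_def using gog_path.base[OF assms] by blast

lemma paths_forward:
  assumes "x \<in> paths v (src e)" "e \<in> E" "g \<in> carrier (vgroup Y (tgt e))"
  shows "x \<otimes>\<^bsub>PG\<^esub> arc_elem e \<otimes>\<^bsub>PG\<^esub> vertex_elem (tgt e) g \<in> paths v (tgt e)"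
proof -
  obtain c where c: "gog_path Y v (src e) c" "x = gens_class c" using assms(1) unfolding paths_def by blast
  show ?thesis unfolding c(2) gog_path_class[OF c(1) assms(2,3), symmetric] paths_def
    using gog_path.forward[OF c(1) assms(2,3)] by blast
qed

lemma paths_backward:
  assumes "x \<in> paths v (tgt e)" "e \<in> E" "g \<in> carrier (vgroup Y (src e))"
  shows "x \<otimes>\<^bsub>PG\<^esub> inv\<^bsub>PG\<^esub> arc_elem e \<otimes>\<^bsub>PG\<^esub> vertex_elem (src e) g \<in> paths v (src e)"
proof -
  obtain c where c: "gog_path Y v (tgt e) c" "x = gens_class c" using assms(1) unfolding paths_def by blast
  show ?thesis unfolding c(2) gog_path_class_backward[OF c(1) assms(2,3), symmetric] paths_def
    using gog_path.backward[OF c(1) assms(2,3)] by blast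
qed

lemma paths_induct [consumes 1, case_names base forward backward]:
  assumes x: "x \<in> paths v w"
    and base: "\<And>g. v \<in> V \<Longrightarrow> g \<in> carrier (vgroup Y v) \<Longrightarrow> P v (vertex_elem v g)"
    and fwd: "\<And>x e g. x \<in> paths v (src e) \<Longrightarrow> P (src e) x \<Longrightarrow> e \<in> E \<Longrightarrow> g \<in> carrier (vgroup Y (tgt e)) \<Longrightarrow>
      P (tgt e) (x \<otimes>\<^bsub>PG\<^esub> arc_elem e \<otimes>\<^bsub>PG\<^esub> vertex_elem (tgt e) g)"
    and bwd: "\<And>x e g. x \<in> paths v (tgt e) \<Longrightarrow> P (tgt e) x \<Longrightarrow> e \<in> E \<Longrightarrow> g \<in> carrier (vgroup Y (src e)) \<Longrightarrow>
      P (src e) (x \<otimes>\<^bsub>PG\<^esub> inv\<^bsub>PG\<^esub> arc_elem e \<otimes>\<^bsub>PG\<^esub> vertex_elem (src e) g)"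
  shows "P w x"
proof -
  obtain c where c: "gog_path Y v w c" "x = gens_class c" using x unfolding paths_def by blast
  from c(1) have "P w (gens_class c)"
  proof induction
    case (base g)
    then show ?case using assms(2) unfolding vertex_elem_def by blast
  next
    case (forward e c g)
    then show ?case using fwd[of "gens_class c" e g] unfolding gog_path_class[OF forward(1,2,3)]
      by (auto simp: paths_def)
  next
    case (backward e c g)
    then show ?case using bwd[of "gens_class c" e g] unfolding gog_path_class_backward[OF backward(1,2,3)]
      by (auto simp: paths_def)
  qed
  then show ?thesis using c(2) by simp
qed

text \<open>A path word always ends in a vertex letter, so a further element of that vertex group is
  absorbed by multiplying inside the group.\<close>

lemma paths_vertex:
  assumes "x \<in> paths v w" "h \<in> carrier (vgroup Y w)"
  shows "x \<otimes>\<^bsub>PG\<^esub> vertex_elem w h \<in> paths v w"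
  using assms
proof (induction rule: paths_induct)
  case (base g)
  interpret Gv: group "vgroup Y v" by (rule group_vgroup[OF base(1)])
  have "g \<otimes>\<^bsub>vgroup Y v\<^esub> h \<in> carrier (vgroup Y v)" using base by simp
  then show ?case using paths_base[OF base(1)] base by (metis vertex_elem_mult)
next
  case (forward x e g)
  interpret Gv: group "vgroup Y (tgt e)" by (rule group_vgroup) (use forward in auto)
  have x: "x \<in> carrier PG" using forward paths_closed by blast
  have "x \<otimes>\<^bsub>PG\<^esub> arc_elem e \<otimes>\<^bsub>PG\<^esub> vertex_elem (tgt e) (g \<otimes>\<^bsub>vgroup Y (tgt e)\<^esub> h) \<in> paths v (tgt e)"
    by (rule paths_forward) (use forward in auto)
  then show ?case using forward x by (simp add: vertex_elem_mult PG.m_assoc)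
next
  case (backward x e g)
  interpret Gv: group "vgroup Y (src e)" by (rule group_vgroup) (use backward in auto)
  have x: "x \<in> carrier PG" using backward paths_closed by blast
  have "x \<otimes>\<^bsub>PG\<^esub> inv\<^bsub>PG\<^esub> arc_elem e \<otimes>\<^bsub>PG\<^esub> vertex_elem (src e) (g \<otimes>\<^bsub>vgroup Y (src e)\<^esub> h) \<in> paths v (src e)"
    by (rule paths_backward) (use backward in auto)
  then show ?case using backward x by (simp add: vertex_elem_mult PG.m_assoc)
qed

lemma paths_arc:
  assumes "x \<in> paths v (src e)" "e \<in> E" shows "x \<otimes>\<^bsub>PG\<^esub> arc_elem e \<in> paths v (tgt e)"
  using paths_forward[OF assms, of "\<one>\<^bsub>vgroup Y (tgt e)\<^esub>"] assms paths_closed[OF assms(1)]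
    group.is_monoid[OF group_vgroup, of "tgt e"] by (simp add: vertex_elem_one monoid.one_closed)

lemma paths_arc_inv:
  assumes "x \<in> paths v (tgt e)" "e \<in> E" shows "x \<otimes>\<^bsub>PG\<^esub> inv\<^bsub>PG\<^esub> arc_elem e \<in> paths v (src e)"
  using paths_backward[OF assms, of "\<one>\<^bsub>vgroup Y (src e)\<^esub>"] assms paths_closed[OF assms(1)]
    group.is_monoid[OF group_vgroup, of "src e"] by (simp add: vertex_elem_one monoid.one_closed)

lemma paths_one: "v \<in> V \<Longrightarrow> \<one>\<^bsub>PG\<^esub> \<in> paths v v"
  using paths_base[of v "\<one>\<^bsub>vgroup Y v\<^esub>"] group.is_monoid[OF group_vgroup, of v]
  by (simp add: vertex_elem_one monoid.one_closed)

lemma paths_mult: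
  assumes "y \<in> paths v w" "x \<in> paths u v" shows "x \<otimes>\<^bsub>PG\<^esub> y \<in> paths u w"
proof -
  have x: "x \<in> carrier PG" using assms(2) paths_closed by blast
  from assms(1) show ?thesis
  proof (induction rule: paths_induct)
    case (base g)
    then show ?case using paths_vertex[OF assms(2)] by blast
  next
    case (forward y e g)
    have "y \<in> carrier PG" using forward paths_closed by blast
    then show ?case using paths_forward[OF forward.IH forward.hyps(2,3)] x forward by (simp add: PG.m_assoc)
  next
    case (backward y e g)
    have "y \<in> carrier PG" using backward paths_closed by blast
    then show ?case using paths_backward[OF backward.IH backward.hyps(2,3)] x backward by (simp add: PG.m_assoc)
  qed
qed

lemma paths_inv:
  assumes "x \<in> paths v w" shows "inv\<^bsub>PG\<^esub> x \<in> paths w v"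
proof -
  have inv_vertex: "inv\<^bsub>PG\<^esub> vertex_elem u g \<in> paths u u" if "u \<in> V" "g \<in> carrier (vgroup Y u)" for u g
    using that paths_base[of u "inv\<^bsub>vgroup Y u\<^esub> g"] group.inv_closed[OF group_vgroup, of u]
    by (simp add: vertex_elem_inv)
  from assms show ?thesis
  proof (induction rule: paths_induct)
    case (base g)
    then show ?case by (rule inv_vertex)
  next
    case (forward x e g)
    have "x \<in> carrier PG" using forward paths_closed by blast
    moreover have "inv\<^bsub>PG\<^esub> vertex_elem (tgt e) g \<otimes>\<^bsub>PG\<^esub> inv\<^bsub>PG\<^esub> arc_elem e \<otimes>\<^bsub>PG\<^esub> inv\<^bsub>PG\<^esub> x \<in> paths (tgt e) v"
      by (rule paths_mult[OF forward.IH], rule paths_arc_inv, rule inv_vertex) (use forward in auto)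
    ultimately show ?case using forward by (simp add: PG.inv_mult_group PG.m_assoc)
  next
    case (backward x e g)
    have "x \<in> carrier PG" using backward paths_closed by blast
    moreover have "inv\<^bsub>PG\<^esub> vertex_elem (src e) g \<otimes>\<^bsub>PG\<^esub> arc_elem e \<otimes>\<^bsub>PG\<^esub> inv\<^bsub>PG\<^esub> x \<in> paths (src e) v"
      by (rule paths_mult[OF backward.IH], rule paths_arc, rule inv_vertex) (use backward in auto)
    ultimately show ?case using backward by (simp add: PG.inv_mult_group PG.m_assoc)
  qed
qed

lemma subgroup_paths:
  assumes "v \<in> V" shows "subgroup (paths v v) PG"
proof (rule PG.subgroupI)
  show "paths v v \<subseteq> carrier PG" by (rule subsetI) (rule paths_closed)
  show "paths v v \<noteq> {}" using paths_one[OF assms] by auto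
qed (rule paths_inv paths_mult; assumption)+

lemma fundamental_group_eq: "fundamental_group Y v = PG\<lparr>carrier := paths v v\<rparr>"
  by (simp add: fundamental_group_def paths_def)

lemma paths_connected:
  assumes "Digraph_Component.connected (base_graph Y)" "v \<in> V" "w \<in> V"
  shows "paths v w \<noteq> {}"
proof -
  interpret wf_digraph "with_proj (mk_symmetric (base_graph Y))"
    unfolding wf_digraph_wp_iff by (rule wf_digraph.wellformed_mk_symmetric[OF wf_graph])
  have "v \<rightarrow>\<^sup>*\<^bsub>with_proj (mk_symmetric (base_graph Y))\<^esub> w"
    using assms by (auto simp: Digraph_Component.connected_def strongly_connected_def)
  then show ?thesis
  proof (induction rule: reachable_induct)
    case base
    then show ?case using paths_one by auto
  next
    case (step x y)
    have "(x, y) \<in> parcs (mk_symmetric (base_graph Y))" using step(2) by simp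
    then obtain e where "e \<in> E" "(x = src e \<and> y = tgt e) \<or> (x = tgt e \<and> y = src e)"
      by (auto simp: parcs_mk_symmetric)
    moreover obtain p where "p \<in> paths v x" using step by blast
    ultimately show ?case using paths_arc[of p v e] paths_arc_inv[of p v e] by blast
  qed
qed

end

section \<open>Vertex groups embed into the path group\<close>

text \<open>Replacing the group \<open>G\<close> by \<open>G \<times> UNIV\<close> makes the number of orbits of the subgroup infinite,
  so that the subgroup action no longer depends on the index of the subgroup.\<close>

lemma (in group) equivariant_bijection:
  fixes K :: "('k, 'm) monoid_scheme"
  assumes "group K" and i: "i \<in> hom K G" "inj_on i (carrier K)" and count: "countable (carrier G)"
  obtains \<beta> where "bij_betw \<beta> (carrier G \<times> (UNIV :: nat set)) (carrier K \<times> (UNIV :: nat set))"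
    "\<And>x k a. x \<in> carrier G \<Longrightarrow> a \<in> carrier K \<Longrightarrow>
      \<beta> (x \<otimes> i a, k) = (fst (\<beta> (x, k)) \<otimes>\<^bsub>K\<^esub> a, snd (\<beta> (x, k)))"
proof -
  interpret K: group K by fact
  interpret i: group_hom K G i using i(1) by unfold_locales
  define P where "P x y \<longleftrightarrow> y \<in> carrier G \<and> (\<exists>a\<in>carrier K. x = y \<otimes> i a)" for x y
  define r where "r x = (SOME y. P x y)" for x
  have P_r: "P x (r x)" if "x \<in> carrier G" for x
    unfolding r_def by (rule someI[of "P x" x]) (use that in \<open>auto simp: P_def intro!: bexI[of _ "\<one>\<^bsub>K\<^esub>"]\<close>)
  \<comment> \<open>Points in one orbit under right translation satisfy the same predicate, so
    \<open>SOME\<close> selects one common representative for the whole orbit.\<close>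
  have P_mult: "P (x \<otimes> i a) y \<longleftrightarrow> P x y" if x: "x \<in> carrier G" and a: "a \<in> carrier K" for x a y
  proof
    assume "P (x \<otimes> i a) y"
    then obtain b where b: "y \<in> carrier G" "b \<in> carrier K" "x \<otimes> i a = y \<otimes> i b" by (auto simp: P_def)
    have "x = x \<otimes> i a \<otimes> i (inv\<^bsub>K\<^esub> a)" using x a by (simp add: m_assoc)
    also have "\<dots> = y \<otimes> i (b \<otimes>\<^bsub>K\<^esub> inv\<^bsub>K\<^esub> a)" unfolding b(3) using a b(1,2) by (simp add: m_assoc)
    finally have "x = y \<otimes> i (b \<otimes>\<^bsub>K\<^esub> inv\<^bsub>K\<^esub> a)" .
    moreover have "b \<otimes>\<^bsub>K\<^esub> inv\<^bsub>K\<^esub> a \<in> carrier K" using a b(2) by simp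
    ultimately show "P x y" unfolding P_def using b(1) by blast
  next
    assume "P x y"
    then obtain b where b: "y \<in> carrier G" "b \<in> carrier K" "x = y \<otimes> i b" by (auto simp: P_def)
    have "x \<otimes> i a = y \<otimes> i (b \<otimes>\<^bsub>K\<^esub> a)" unfolding b(3) using a b(1,2) by (simp add: m_assoc)
    moreover have "b \<otimes>\<^bsub>K\<^esub> a \<in> carrier K" using a b(2) by simp
    ultimately show "P (x \<otimes> i a) y" unfolding P_def using b(1) by blast
  qed
  have r_mult: "r (x \<otimes> i a) = r x" if "x \<in> carrier G" "a \<in> carrier K" for x a
    unfolding r_def P_mult[OF that] ..
  \<comment> \<open>The coordinate of \<open>x\<close> in \<open>K\<close> relative to the
    representative of its orbit; injectivity of \<open>i\<close> makes it unique and hence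
    equivariant.\<close>
  define d where "d x = (THE a. a \<in> carrier K \<and> x = r x \<otimes> i a)" for x
  have d_eq: "d x = a" if "x \<in> carrier G" "a \<in> carrier K" "x = r x \<otimes> i a" for x a
    unfolding d_def
  proof (rule the_equality)
    show "a \<in> carrier K \<and> x = r x \<otimes> i a" using that(2,3) ..
    fix b assume "b \<in> carrier K \<and> x = r x \<otimes> i b"
    then have "r x \<otimes> i b = r x \<otimes> i a" "b \<in> carrier K" using that(3) by simp_all
    then have "i b = i a" using P_r[OF that(1)] that(2) by (simp add: P_def)
    then show "b = a" using i(2) that(2) \<open>b \<in> carrier K\<close> by (simp add: inj_on_def)
  qed
  have d: "d x \<in> carrier K" "x = r x \<otimes> i (d x)" "r x \<in> carrier G" if x: "x \<in> carrier G" for x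
  proof -
    obtain a where a: "a \<in> carrier K" "x = r x \<otimes> i a" using P_r[OF x] by (auto simp: P_def)
    then show "d x \<in> carrier K" "x = r x \<otimes> i (d x)" using d_eq[OF x a] by simp_all
    show "r x \<in> carrier G" using P_r[OF x] by (simp add: P_def)
  qed
  have d_mult: "d (x \<otimes> i a) = d x \<otimes>\<^bsub>K\<^esub> a" if x: "x \<in> carrier G" and a: "a \<in> carrier K" for x a
  proof (rule d_eq)
    have "x \<otimes> i a = r x \<otimes> i (d x) \<otimes> i a" using d(2)[OF x] by simp
    also have "\<dots> = r x \<otimes> i (d x \<otimes>\<^bsub>K\<^esub> a)" using d(1,3)[OF x] a by (simp add: m_assoc)
    finally show "x \<otimes> i a = r (x \<otimes> i a) \<otimes> i (d x \<otimes>\<^bsub>K\<^esub> a)" unfolding r_mult[OF x a] .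
  qed (use d x a in auto)
  have r_r: "r (r x) = r x" if x: "x \<in> carrier G" for x
    using r_mult[of "r x" "d x"] d[OF x] by simp
  \<comment> \<open>Orbit representatives paired with naturals form a countably infinite set
    whatever the number of orbits. Hence \<open>c\<close> can take all naturals as values, and the
    target has exactly one copy of \<open>K\<close> for each natural number.\<close>
  define T where "T = r ` carrier G"
  have T: "countable (T \<times> (UNIV :: nat set))" "infinite (T \<times> (UNIV :: nat set))"
    using count by (auto simp: T_def finite_cartesian_product_iff)
  define c where "c = to_nat_on (T \<times> (UNIV :: nat set))"
  have c: "bij_betw c (T \<times> UNIV) UNIV" unfolding c_def using to_nat_on_infinite[OF T] .
  define \<beta> where "\<beta> = (\<lambda>(x, k). (d x, c (r x, k)))"
  have "bij_betw \<beta> (carrier G \<times> (UNIV :: nat set)) (carrier K \<times> UNIV)"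
  proof (rule bij_betw_imageI)
    show "inj_on \<beta> (carrier G \<times> UNIV)"
    proof (rule inj_onI, clarify)
      fix x k y l assume x: "x \<in> carrier G" and y: "y \<in> carrier G" and eq: "\<beta> (x, k) = \<beta> (y, l)"
      have "(r x, k) \<in> T \<times> UNIV" "(r y, l) \<in> T \<times> UNIV" using x y by (auto simp: T_def)
      moreover have "c (r x, k) = c (r y, l)" and dxy: "d x = d y" using eq by (simp_all add: \<beta>_def)
      ultimately have "(r x, k) = (r y, l)" using inj_onD[OF bij_betw_imp_inj_on[OF c]] by blast
      then have "r x = r y" "k = l" "d x = d y" using dxy by simp_all
      then show "x = y \<and> k = l" using d(2)[OF x] d(2)[OF y] by simp
    qed
    show "\<beta> ` (carrier G \<times> UNIV) = carrier K \<times> UNIV"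
    proof (intro Set.equalityI subsetI)
      fix z assume "z \<in> \<beta> ` (carrier G \<times> UNIV)"
      then show "z \<in> carrier K \<times> UNIV" using d(1) by (auto simp: \<beta>_def)
    next
      fix z assume "z \<in> carrier K \<times> (UNIV :: nat set)"
      then obtain a m where z: "z = (a, m)" "a \<in> carrier K" by blast
      have "m \<in> c ` (T \<times> UNIV)" using c by (simp add: bij_betw_def)
      then obtain x k where x: "x \<in> carrier G" "m = c (r x, k)" unfolding T_def by blast
      have "d (r x \<otimes> i a) = a" by (rule d_eq) (use z d[OF x(1)] r_mult r_r x in auto)
      then have "\<beta> (r x \<otimes> i a, k) = z" using z x r_mult[of "r x" a] r_r d(3) by (simp add: \<beta>_def)
      moreover have "r x \<otimes> i a \<in> carrier G" using z d(3)[OF x(1)] by simp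
      ultimately show "z \<in> \<beta> ` (carrier G \<times> UNIV)" by blast
    qed
  qed
  moreover have "\<beta> (x \<otimes> i a, k) = (fst (\<beta> (x, k)) \<otimes>\<^bsub>K\<^esub> a, snd (\<beta> (x, k)))"
    if "x \<in> carrier G" "a \<in> carrier K" for x k a
    using d_mult[OF that] r_mult[OF that] by (simp add: \<beta>_def)
  ultimately show ?thesis by (rule that)
qed

text \<open>The path group is made to act on the natural numbers so that each vertex group acts as
  by right translation on countably many copies of itself. Under the edge group the tail side and
  the head side are both isomorphic to countably many copies of the edge group, so suitable
  bijections for the arcs exist. Right translation is free, so equal elements of the path group come
  from equal elements of the vertex group.\<close>

lemma (in graph_of_groups) vertex_elem_inj:
  assumes count: "\<And>v. v \<in> V \<Longrightarrow> countable (carrier (vgroup Y v))" and v0: "v0 \<in> V"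
  shows "inj_on (vertex_elem v0) (carrier (vgroup Y v0))"
proof -
  define X where "X v = carrier (vgroup Y v) \<times> (UNIV :: nat set)" for v
  have X: "countable (X v)" "infinite (X v)" if v: "v \<in> V" for v
    using count[OF v] group.is_monoid[OF group_vgroup[OF v]] monoid.one_closed
    by (auto simp: X_def finite_cartesian_product_iff)
  \<comment> \<open>The underlying set must be the same for all vertices; numbering the sets
    \<open>X v\<close> moves every translation action to the naturals.\<close>
  define enc dec where "enc v = to_nat_on (X v)" and "dec v = from_nat_into (X v)" for v
  have dec: "dec v n \<in> X v" "enc v (dec v n) = n" if v: "v \<in> V" for v n
    using X[OF v] from_nat_into[of "X v" n] infinite_imp_nonempty[OF X(2)[OF v]] unfolding enc_def dec_def by auto
  have enc: "dec v (enc v z) = z" if "v \<in> V" "z \<in> X v" for v z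
    using X[OF that(1)] that(2) unfolding enc_def dec_def by simp
  define \<phi> where "\<phi> v g n = enc v (fst (dec v n) \<otimes>\<^bsub>vgroup Y v\<^esub> g, snd (dec v n))" for v g n
  have \<phi>_dec: "dec v (\<phi> v g n) = (fst (dec v n) \<otimes>\<^bsub>vgroup Y v\<^esub> g, snd (dec v n))"
    if v: "v \<in> V" "g \<in> carrier (vgroup Y v)" for v g n
  proof -
    interpret Gv: group "vgroup Y v" by (rule group_vgroup[OF v(1)])
    show ?thesis unfolding \<phi>_def by (rule enc[OF v(1)]) (use dec(1)[OF v(1), of n] v in \<open>auto simp: X_def\<close>)
  qed
  have "\<exists>b. bij_betw b (UNIV :: nat set) UNIV \<and> (\<forall>a\<in>carrier (egroup Y e). \<forall>n.
    b (\<phi> (src e) (tail_emb Y e a) n) = \<phi> (tgt e) (head_emb Y e a) (b n))" if e: "e \<in> E" for e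
  proof -
    have st: "src e \<in> V" "tgt e \<in> V" using e by simp_all
    obtain \<beta> where \<beta>: "bij_betw \<beta> (X (src e)) (carrier (egroup Y e) \<times> (UNIV :: nat set))"
      "\<And>x k a. x \<in> carrier (vgroup Y (src e)) \<Longrightarrow> a \<in> carrier (egroup Y e) \<Longrightarrow>
        \<beta> (x \<otimes>\<^bsub>vgroup Y (src e)\<^esub> tail_emb Y e a, k) = (fst (\<beta> (x, k)) \<otimes>\<^bsub>egroup Y e\<^esub> a, snd (\<beta> (x, k)))"
      unfolding X_def
      by (rule group.equivariant_bijection[OF group_vgroup[OF st(1)] group_egroup[OF e] emb_hom(1,3)[OF e] count[OF st(1)]])
        (rule that[unfolded X_def])
    obtain \<gamma> where \<gamma>: "bij_betw \<gamma> (X (tgt e)) (carrier (egroup Y e) \<times> (UNIV :: nat set))"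
      "\<And>x k a. x \<in> carrier (vgroup Y (tgt e)) \<Longrightarrow> a \<in> carrier (egroup Y e) \<Longrightarrow>
        \<gamma> (x \<otimes>\<^bsub>vgroup Y (tgt e)\<^esub> head_emb Y e a, k) = (fst (\<gamma> (x, k)) \<otimes>\<^bsub>egroup Y e\<^esub> a, snd (\<gamma> (x, k)))"
      unfolding X_def
      by (rule group.equivariant_bijection[OF group_vgroup[OF st(2)] group_egroup[OF e] emb_hom(2,4)[OF e] count[OF st(2)]])
        (rule that[unfolded X_def])
    \<comment> \<open>The two equivariant bijections are composed through the copies of the edge
      group, which intertwines translation on the tail side with translation on the head
      side.\<close>
    define \<delta> where "\<delta> = inv_into (X (tgt e)) \<gamma> \<circ> \<beta>"
    have \<delta>_bij: "bij_betw \<delta> (X (src e)) (X (tgt e))"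
      unfolding \<delta>_def by (rule bij_betw_trans[OF \<beta>(1) bij_betw_inv_into[OF \<gamma>(1)]])
    have \<gamma>_\<delta>: "\<gamma> (\<delta> z) = \<beta> z" if "z \<in> X (src e)" for z
    proof -
      have "\<beta> z \<in> carrier (egroup Y e) \<times> UNIV" using \<beta>(1) that by (auto simp: bij_betw_def)
      then show ?thesis unfolding \<delta>_def using bij_betw_inv_into_right[OF \<gamma>(1)] by simp
    qed
    have \<delta>_mult: "\<delta> (x \<otimes>\<^bsub>vgroup Y (src e)\<^esub> tail_emb Y e a, k) =
        (fst (\<delta> (x, k)) \<otimes>\<^bsub>vgroup Y (tgt e)\<^esub> head_emb Y e a, snd (\<delta> (x, k)))"
      if x: "x \<in> carrier (vgroup Y (src e))" and a: "a \<in> carrier (egroup Y e)" for x a k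
    proof -
      interpret Gs: group "vgroup Y (src e)" by (rule group_vgroup[OF st(1)])
      interpret Gt: group "vgroup Y (tgt e)" by (rule group_vgroup[OF st(2)])
      have x1: "(x, k) \<in> X (src e)" "(x \<otimes>\<^bsub>vgroup Y (src e)\<^esub> tail_emb Y e a, k) \<in> X (src e)"
        using x a e by (auto simp: X_def)
      have y: "\<delta> z \<in> X (tgt e)" if "z \<in> X (src e)" for z using \<delta>_bij that by (auto simp: bij_betw_def)
      obtain y l where yl: "\<delta> (x, k) = (y, l)" by force
      have yc: "y \<in> carrier (vgroup Y (tgt e))" using y[OF x1(1)] yl by (simp add: X_def)
      have "\<gamma> (y \<otimes>\<^bsub>vgroup Y (tgt e)\<^esub> head_emb Y e a, l) = (fst (\<gamma> (y, l)) \<otimes>\<^bsub>egroup Y e\<^esub> a, snd (\<gamma> (y, l)))"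
        by (rule \<gamma>(2)[OF yc a])
      also have "\<gamma> (y, l) = \<beta> (x, k)" using \<gamma>_\<delta>[OF x1(1)] yl by simp
      also have "(fst (\<beta> (x, k)) \<otimes>\<^bsub>egroup Y e\<^esub> a, snd (\<beta> (x, k))) = \<gamma> (\<delta> (x \<otimes>\<^bsub>vgroup Y (src e)\<^esub> tail_emb Y e a, k))"
        unfolding \<gamma>_\<delta>[OF x1(2)] by (rule \<beta>(2)[OF x a, symmetric])
      finally have eq: "\<gamma> (y \<otimes>\<^bsub>vgroup Y (tgt e)\<^esub> head_emb Y e a, l) = \<gamma> (\<delta> (x \<otimes>\<^bsub>vgroup Y (src e)\<^esub> tail_emb Y e a, k))" .
      have "(y \<otimes>\<^bsub>vgroup Y (tgt e)\<^esub> head_emb Y e a, l) \<in> X (tgt e)" using yc a e by (auto simp: X_def)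
      then have "(y \<otimes>\<^bsub>vgroup Y (tgt e)\<^esub> head_emb Y e a, l) = \<delta> (x \<otimes>\<^bsub>vgroup Y (src e)\<^esub> tail_emb Y e a, k)"
        using eq y[OF x1(2)] \<gamma>(1) unfolding bij_betw_def inj_on_def by blast
      then show ?thesis by (simp add: yl)
    qed
    have dec_bij: "bij_betw (dec v) UNIV (X v)" and enc_bij: "bij_betw (enc v) (X v) UNIV" if "v \<in> V" for v
      using X[OF that] to_nat_on_infinite[of "X v"] bij_betw_from_nat_into[of "X v"] by (simp_all add: enc_def dec_def)
    define b where "b = enc (tgt e) \<circ> (\<delta> \<circ> dec (src e))"
    have "bij_betw b UNIV UNIV" unfolding b_def
      by (rule bij_betw_trans[OF bij_betw_trans[OF dec_bij[OF st(1)] \<delta>_bij] enc_bij[OF st(2)]])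
    moreover have "b (\<phi> (src e) (tail_emb Y e a) n) = \<phi> (tgt e) (head_emb Y e a) (b n)"
      if a: "a \<in> carrier (egroup Y e)" for a n
    proof -
      obtain x k where xk: "dec (src e) n = (x, k)" by force
      then have x: "x \<in> carrier (vgroup Y (src e))" using dec(1)[OF st(1), of n] by (simp add: X_def)
      have "\<delta> (x, k) \<in> X (tgt e)" using \<delta>_bij dec(1)[OF st(1), of n] xk by (auto simp: bij_betw_def)
      then have db: "dec (tgt e) (b n) = \<delta> (x, k)" using enc[OF st(2)] xk by (simp add: b_def)
      have "b (\<phi> (src e) (tail_emb Y e a) n) = enc (tgt e) (\<delta> (x \<otimes>\<^bsub>vgroup Y (src e)\<^esub> tail_emb Y e a, k))"
        using \<phi>_dec[OF st(1), of "tail_emb Y e a" n] a e xk by (simp add: b_def)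
      also have "\<dots> = \<phi> (tgt e) (head_emb Y e a) (b n)" unfolding \<delta>_mult[OF x a] \<phi>_def db ..
      finally show ?thesis .
    qed
    ultimately show ?thesis by blast
  qed
  then obtain b where b: "\<And>e. e \<in> E \<Longrightarrow> bij_betw (b e) (UNIV :: nat set) UNIV"
    "\<And>e a n. e \<in> E \<Longrightarrow> a \<in> carrier (egroup Y e) \<Longrightarrow>
      b e (\<phi> (src e) (tail_emb Y e a) n) = \<phi> (tgt e) (head_emb Y e a) (b e n)" by metis
  have \<phi>_mult: "\<phi> v (g \<otimes>\<^bsub>vgroup Y v\<^esub> h) n = \<phi> v h (\<phi> v g n)"
    if v: "v \<in> V" "g \<in> carrier (vgroup Y v)" "h \<in> carrier (vgroup Y v)" for v g h n
  proof -
    interpret Gv: group "vgroup Y v" by (rule group_vgroup[OF v(1)])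
    have "fst (dec v n) \<in> carrier (vgroup Y v)" using dec(1)[OF v(1), of n] by (auto simp: X_def)
    then show ?thesis using v unfolding \<phi>_def[of v h "\<phi> v g n"] \<phi>_dec[OF v(1,2)] by (simp add: \<phi>_def Gv.m_assoc)
  qed
  have \<phi>_one: "\<phi> v \<one>\<^bsub>vgroup Y v\<^esub> n = n" if v: "v \<in> V" for v n
  proof -
    interpret Gv: group "vgroup Y v" by (rule group_vgroup[OF v])
    have "fst (dec v n) \<in> carrier (vgroup Y v)" using dec(1)[OF v, of n] by (auto simp: X_def)
    then show ?thesis using dec(2)[OF v] by (simp add: \<phi>_def)
  qed
  have "\<exists>\<alpha>. \<forall>v g n. v \<in> V \<longrightarrow> g \<in> carrier (vgroup Y v) \<longrightarrow> \<alpha> (vertex_elem v g) n = \<phi> v g n"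
  proof (rule path_group_action[of "UNIV :: nat set" \<phi> b], goal_cases)
    case (6 \<alpha>)
    then show ?case by (intro exI[of _ \<alpha>]) simp
  qed (simp_all add: b \<phi>_mult \<phi>_one)
  then obtain \<alpha> where \<alpha>: "\<And>v g n. v \<in> V \<Longrightarrow> g \<in> carrier (vgroup Y v) \<Longrightarrow> \<alpha> (vertex_elem v g) n = \<phi> v g n"
    by blast
  show ?thesis
  proof (rule inj_onI)
    fix g h assume g: "g \<in> carrier (vgroup Y v0)" and h: "h \<in> carrier (vgroup Y v0)"
      and eq: "vertex_elem v0 g = vertex_elem v0 h"
    interpret Gv: group "vgroup Y v0" by (rule group_vgroup[OF v0])
    \<comment> \<open>The code of an identity element: translating it by \<open>g\<close> reveals
      \<open>g\<close>.\<close>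
    define n where "n = enc v0 (\<one>\<^bsub>vgroup Y v0\<^esub>, 0)"
    have n: "dec v0 n = (\<one>\<^bsub>vgroup Y v0\<^esub>, 0)" unfolding n_def by (rule enc[OF v0]) (simp add: X_def)
    have "\<phi> v0 g n = \<phi> v0 h n" using \<alpha>[OF v0 g, of n] \<alpha>[OF v0 h, of n] eq by simp
    then have "dec v0 (\<phi> v0 g n) = dec v0 (\<phi> v0 h n)" by simp
    then show "g = h" unfolding \<phi>_dec[OF v0 g] \<phi>_dec[OF v0 h] n using g h by simp
  qed
qed

section \<open>Finite quotients with kernel inside the edge groups\<close>

text \<open>\<open>\<rho>\<close> is defined on the whole path group, so that its kernels at
  different vertices can be compared. The last two assumptions put the kernel at a vertex inside the
  images of all adjacent edge groups, which lets the arcs carry these kernels onto each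
  other.\<close>

locale finite_quotient = graph_of_groups Y
  for Y :: "('v, 'e, 'g, 'h) gog" +
  fixes v0 :: 'v and Q :: "('q, 'm) monoid_scheme" and \<rho> :: "('v \<times> 'g + 'e) word set \<Rightarrow> 'q"
  assumes v0: "v0 \<in> verts (base_graph Y)"
    and finite_graph: "finite (verts (base_graph Y))" "finite (arcs (base_graph Y))"
    and group_Q: "group Q" and finite_Q: "finite (carrier Q)"
    and \<rho>_hom: "\<rho> \<in> hom (path_group Y) Q"
    and ker_tail: "e \<in> arcs (base_graph Y) \<Longrightarrow> g \<in> carrier (vgroup Y (tail (base_graph Y) e)) \<Longrightarrow>
      \<rho> (graph_of_groups.vertex_elem Y (tail (base_graph Y) e) g) = \<one>\<^bsub>Q\<^esub> \<Longrightarrow> g \<in> tail_emb Y e ` carrier (egroup Y e)"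
    and ker_head: "e \<in> arcs (base_graph Y) \<Longrightarrow> g \<in> carrier (vgroup Y (head (base_graph Y) e)) \<Longrightarrow>
      \<rho> (graph_of_groups.vertex_elem Y (head (base_graph Y) e) g) = \<one>\<^bsub>Q\<^esub> \<Longrightarrow> g \<in> head_emb Y e ` carrier (egroup Y e)"
begin

sublocale Q: group Q by (rule group_Q)

sublocale rho: group_hom "path_group Y" Q \<rho>
  using \<rho>_hom by unfold_locales

abbreviation pmult (infixl "\<cdot>" 70) where "x \<cdot> y \<equiv> x \<otimes>\<^bsub>PG\<^esub> y"
abbreviation pinv where "pinv x \<equiv> inv\<^bsub>PG\<^esub> x"

lemma path_group_generated:
  assumes x: "x \<in> carrier PG" and one: "P \<one>\<^bsub>PG\<^esub>"
    and mult: "\<And>x y. x \<in> carrier PG \<Longrightarrow> y \<in> carrier PG \<Longrightarrow> P x \<Longrightarrow> P y \<Longrightarrow> P (x \<cdot> y)"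
    and inv: "\<And>x. x \<in> carrier PG \<Longrightarrow> P x \<Longrightarrow> P (pinv x)"
    and vertex: "\<And>v g. v \<in> V \<Longrightarrow> g \<in> carrier (vgroup Y v) \<Longrightarrow> P (vertex_elem v g)"
    and arc: "\<And>e. e \<in> E \<Longrightarrow> P (arc_elem e)"
  shows "P x"
  using x unfolding path_group_def
proof (induction rule: presented_group_induct)
  case one
  then show ?case using assms(2) by (simp add: gens_class_Nil)
next
  case (letter w s b)
  have "\<exists>y\<in>carrier PG. P y \<and> gens_class [(s, b)] = (if b then y else pinv y)"
  proof (cases s)
    case (Inl vg)
    then obtain v g where s: "s = Inl (v, g)" by (cases vg) auto
    have "v \<in> V" "g \<in> carrier (vgroup Y v)" using letter(2) s by simp_all
    then show ?thesis using vertex gens_class_vertex[of v g "[]"] s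
      by (intro bexI[of _ "vertex_elem v g"]) (auto simp: gens_class_Nil)
  next
    case (Inr e)
    then have "e \<in> E" using letter(2) by simp
    then show ?thesis using arc gens_class_arc[of e "[]"] Inr
      by (intro bexI[of _ "arc_elem e"]) (auto simp: gens_class_Nil)
  qed
  then obtain y where y: "y \<in> carrier PG" "P y" "gens_class [(s, b)] = (if b then y else pinv y)" by blast
  then have "P (gens_class [(s, b)])" "gens_class [(s, b)] \<in> carrier PG" using inv by simp_all
  moreover have "gens_class w \<in> carrier PG" unfolding path_group_def using letter(1) by (rule word_class_in_carrier)
  moreover have "gens_class (w @ [(s, b)]) = gens_class w \<cdot> gens_class [(s, b)]"
    by (rule gens_class_append) (use letter in auto)
  ultimately show ?case using mult letter(3) by simp
qed

section \<open>Vertex kernels and their conjugates\<close>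

definition vertex_kernel :: "'v \<Rightarrow> ('v \<times> 'g + 'e) word set set" where
  "vertex_kernel v = {vertex_elem v g | g. g \<in> carrier (vgroup Y v) \<and> \<rho> (vertex_elem v g) = \<one>\<^bsub>Q\<^esub>}"

text \<open>Conjugation by \<open>p\<close> carries the kernel at \<open>v\<close> onto the kernel
  at \<open>u\<close>. Spelling out both inclusions makes the notion symmetric under
  inverses.\<close>

definition conjugates :: "('v \<times> 'g + 'e) word set \<Rightarrow> 'v \<Rightarrow> 'v \<Rightarrow> bool" where
  "conjugates p u v \<longleftrightarrow> p \<in> carrier PG \<and> (\<forall>a\<in>vertex_kernel v. p \<cdot> a \<cdot> pinv p \<in> vertex_kernel u) \<and>
    (\<forall>a\<in>vertex_kernel u. pinv p \<cdot> a \<cdot> p \<in> vertex_kernel v)"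

lemma vertex_kernel_closed: "v \<in> V \<Longrightarrow> a \<in> vertex_kernel v \<Longrightarrow> a \<in> carrier PG"
  by (auto simp: vertex_kernel_def)

lemma conjugates_mult:
  assumes "conjugates p u v" "conjugates q v w" "u \<in> V" "w \<in> V"
  shows "conjugates (p \<cdot> q) u w"
proof -
  have c: "p \<in> carrier PG" "q \<in> carrier PG" using assms by (auto simp: conjugates_def)
  have "(p \<cdot> q) \<cdot> a \<cdot> pinv (p \<cdot> q) = p \<cdot> (q \<cdot> a \<cdot> pinv q) \<cdot> pinv p" if "a \<in> vertex_kernel w" for a
    using c vertex_kernel_closed[OF assms(4) that] by (simp add: PG.m_assoc PG.inv_mult_group)
  moreover have "pinv (p \<cdot> q) \<cdot> a \<cdot> (p \<cdot> q) = pinv q \<cdot> (pinv p \<cdot> a \<cdot> p) \<cdot> q" if "a \<in> vertex_kernel u" for a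
    using c vertex_kernel_closed[OF assms(3) that] by (simp add: PG.m_assoc PG.inv_mult_group)
  ultimately show ?thesis using assms c unfolding conjugates_def by simp
qed

lemma conjugates_inv: "conjugates p u v \<Longrightarrow> conjugates (pinv p) v u"
  unfolding conjugates_def by simp

lemma conjugates_vertex:
  assumes v: "v \<in> V" and g: "g \<in> carrier (vgroup Y v)"
  shows "conjugates (vertex_elem v g) v v"
proof -
  interpret Gv: group "vgroup Y v" by (rule group_vgroup[OF v])
  have 1: "vertex_elem v h \<cdot> a \<cdot> pinv (vertex_elem v h) \<in> vertex_kernel v"
    if h: "h \<in> carrier (vgroup Y v)" and a: "a \<in> vertex_kernel v" for h a
  proof -
    obtain k where k: "a = vertex_elem v k" "k \<in> carrier (vgroup Y v)" "\<rho> a = \<one>\<^bsub>Q\<^esub>"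
      using a by (auto simp: vertex_kernel_def)
    have eq: "vertex_elem v h \<cdot> a \<cdot> pinv (vertex_elem v h) = vertex_elem v (h \<otimes>\<^bsub>vgroup Y v\<^esub> k \<otimes>\<^bsub>vgroup Y v\<^esub> inv\<^bsub>vgroup Y v\<^esub> h)"
      using v h k by (simp add: vertex_elem_mult vertex_elem_inv)
    have "\<rho> (vertex_elem v h \<cdot> a \<cdot> pinv (vertex_elem v h)) = \<one>\<^bsub>Q\<^esub>"
      using v h k by simp
    moreover have "h \<otimes>\<^bsub>vgroup Y v\<^esub> k \<otimes>\<^bsub>vgroup Y v\<^esub> inv\<^bsub>vgroup Y v\<^esub> h \<in> carrier (vgroup Y v)" using h k by simp
    ultimately show ?thesis unfolding vertex_kernel_def eq by blast
  qed
  have "pinv (vertex_elem v g) \<cdot> a \<cdot> vertex_elem v g \<in> vertex_kernel v" if "a \<in> vertex_kernel v" for a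
    using 1[of "inv\<^bsub>vgroup Y v\<^esub> g" a] that v g by (simp add: vertex_elem_inv)
  then show ?thesis using 1[OF g] v g unfolding conjugates_def by simp
qed

text \<open>The kernel assumptions enter here: an element of the kernel at one end comes from the
  edge group, so the arc relation moves it into the vertex group at the other end, where
  \<open>\<rho>\<close> still kills it.\<close>

lemma conjugates_arc:
  assumes e: "e \<in> E" shows "conjugates (arc_elem e) (src e) (tgt e)"
proof -
  have eq: "arc_elem e \<cdot> vertex_elem (tgt e) (head_emb Y e a) \<cdot> pinv (arc_elem e) = vertex_elem (src e) (tail_emb Y e a)"
    "pinv (arc_elem e) \<cdot> vertex_elem (src e) (tail_emb Y e a) \<cdot> arc_elem e = vertex_elem (tgt e) (head_emb Y e a)"
    if "a \<in> carrier (egroup Y e)" for a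
  proof -
    note r = arc_relation[OF e that]
    show "arc_elem e \<cdot> vertex_elem (tgt e) (head_emb Y e a) \<cdot> pinv (arc_elem e) = vertex_elem (src e) (tail_emb Y e a)"
      unfolding r using e that by (simp add: PG.m_assoc)
    have "pinv (arc_elem e) \<cdot> (vertex_elem (src e) (tail_emb Y e a) \<cdot> arc_elem e) = vertex_elem (tgt e) (head_emb Y e a)"
      unfolding r[symmetric] using e that by (simp add: PG.m_assoc[symmetric])
    then show "pinv (arc_elem e) \<cdot> vertex_elem (src e) (tail_emb Y e a) \<cdot> arc_elem e = vertex_elem (tgt e) (head_emb Y e a)"
      using e that by (simp add: PG.m_assoc)
  qed
  have "arc_elem e \<cdot> x \<cdot> pinv (arc_elem e) \<in> vertex_kernel (src e)" if x: "x \<in> vertex_kernel (tgt e)" for x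
  proof -
    obtain g where g: "x = vertex_elem (tgt e) g" "g \<in> carrier (vgroup Y (tgt e))" "\<rho> x = \<one>\<^bsub>Q\<^esub>"
      using x by (auto simp: vertex_kernel_def)
    then obtain a where a: "a \<in> carrier (egroup Y e)" "g = head_emb Y e a" using ker_head[OF e g(2)] by auto
    have "\<rho> (arc_elem e \<cdot> x \<cdot> pinv (arc_elem e)) = \<one>\<^bsub>Q\<^esub>" using g e by simp
    then show ?thesis unfolding g(1) a(2) eq(1)[OF a(1)] vertex_kernel_def using a(1) e by auto
  qed
  moreover have "pinv (arc_elem e) \<cdot> x \<cdot> arc_elem e \<in> vertex_kernel (tgt e)" if x: "x \<in> vertex_kernel (src e)" for x
  proof -
    obtain g where g: "x = vertex_elem (src e) g" "g \<in> carrier (vgroup Y (src e))" "\<rho> x = \<one>\<^bsub>Q\<^esub>"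
      using x by (auto simp: vertex_kernel_def)
    then obtain a where a: "a \<in> carrier (egroup Y e)" "g = tail_emb Y e a" using ker_tail[OF e g(2)] by auto
    have "\<rho> (pinv (arc_elem e) \<cdot> x \<cdot> arc_elem e) = \<one>\<^bsub>Q\<^esub>" using g e by simp
    then show ?thesis unfolding g(1) a(2) eq(2)[OF a(1)] vertex_kernel_def using a(1) e by auto
  qed
  ultimately show ?thesis unfolding conjugates_def using e by simp
qed

text \<open>For closed paths at \<open>v0\<close> this gives normality of \<open>A\<close>; for open
  paths it shows that a correction inside the kernel at the end point is invisible modulo
  \<open>A\<close>.\<close>

lemma conjugates_path:
  assumes "x \<in> paths u w" shows "conjugates x u w"
  using assms
proof (induction rule: paths_induct)
  case (base g)
  then show ?case by (rule conjugates_vertex)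
next
  case (forward x e g)
  have "u \<in> V" using forward.hyps(1) by (rule paths_closed)
  then show ?case using forward
    by (intro conjugates_mult[where v = "tgt e", OF conjugates_mult[where v = "src e"]])
      (auto intro: conjugates_arc conjugates_vertex)
next
  case (backward x e g)
  have "u \<in> V" using backward.hyps(1) by (rule paths_closed)
  then show ?case using backward
    by (intro conjugates_mult[where v = "src e", OF conjugates_mult[where v = "tgt e"]])
      (auto intro: conjugates_arc conjugates_inv conjugates_vertex)
qed

section \<open>The finite-index subgroup L and its normal subgroup A\<close>

definition L :: "('v \<times> 'g + 'e) word set set" where "L = {x \<in> paths v0 v0. \<rho> x = \<one>\<^bsub>Q\<^esub>}"
definition A :: "('v \<times> 'g + 'e) word set set" where "A = vertex_kernel v0"

lemma subgroup_L: "subgroup L PG"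
proof -
  have "L = paths v0 v0 \<inter> {x \<in> carrier PG. \<rho> x = \<one>\<^bsub>Q\<^esub>}" using paths_closed(1) by (auto simp: L_def)
  then show ?thesis using PG.subgroups_Inter_pair[OF subgroup_paths[OF v0] rho.subgroup_kernel] by (simp add: kernel_def)
qed

lemma finite_index_L: "finite_index_subgroup L (PG\<lparr>carrier := paths v0 v0\<rparr>)"
proof -
  interpret P0: group "PG\<lparr>carrier := paths v0 v0\<rparr>"
    by (rule subgroup.subgroup_is_group[OF subgroup_paths[OF v0] group_path_group])
  show ?thesis
  proof (rule P0.finite_index_subgroupI[where f = \<rho>])
    show "subgroup L (PG\<lparr>carrier := paths v0 v0\<rparr>)"
      by (rule PG.subgroup_incl[OF subgroup_L subgroup_paths[OF v0]]) (auto simp: L_def)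
    show "finite (\<rho> ` carrier (PG\<lparr>carrier := paths v0 v0\<rparr>))"
      by (rule finite_subset[OF _ finite_Q]) (use paths_closed(1) in auto)
    fix x y assume "x \<in> carrier (PG\<lparr>carrier := paths v0 v0\<rparr>)" "y \<in> carrier (PG\<lparr>carrier := paths v0 v0\<rparr>)" "\<rho> x = \<rho> y"
    moreover from this have "x \<cdot> pinv y \<in> paths v0 v0" by (auto intro: paths_mult paths_inv)
    ultimately show "x \<otimes>\<^bsub>PG\<lparr>carrier := paths v0 v0\<rparr>\<^esub> inv\<^bsub>PG\<lparr>carrier := paths v0 v0\<rparr>\<^esub> y \<in> L"
      using paths_closed(1) PG.m_inv_consistent[OF subgroup_paths[OF v0], of y] by (simp add: L_def)
  qed
qed

lemma subgroup_A: "subgroup A PG"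
proof -
  interpret G0: group "vgroup Y v0" by (rule group_vgroup[OF v0])
  interpret h: group_hom "vgroup Y v0" Q "\<rho> \<circ> vertex_elem v0"
    using hom_compose[OF vertex_elem_hom[OF v0] \<rho>_hom] by unfold_locales
  interpret k: group_hom "vgroup Y v0" PG "vertex_elem v0" using vertex_elem_hom[OF v0] by unfold_locales
  have "A = vertex_elem v0 ` kernel (vgroup Y v0) Q (\<rho> \<circ> vertex_elem v0)"
    by (auto simp: A_def vertex_kernel_def kernel_def)
  then show ?thesis using k.subgroup_img_is_subgroup[OF h.subgroup_kernel] by simp
qed

lemma A_subset_L: "A \<subseteq> L"
  using paths_base[OF v0] by (auto simp: A_def L_def vertex_kernel_def)

lemma normal_A: "A \<lhd> PG\<lparr>carrier := L\<rparr>"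
proof -
  interpret PL: group "PG\<lparr>carrier := L\<rparr>" by (rule subgroup.subgroup_is_group[OF subgroup_L group_path_group])
  show ?thesis
  proof (rule PL.normal_invI)
    show "subgroup A (PG\<lparr>carrier := L\<rparr>)" by (rule PG.subgroup_incl[OF subgroup_A subgroup_L A_subset_L])
    fix x h assume x: "x \<in> carrier (PG\<lparr>carrier := L\<rparr>)" "h \<in> A"
    then have "conjugates x v0 v0" by (intro conjugates_path) (simp add: L_def)
    then show "x \<otimes>\<^bsub>PG\<lparr>carrier := L\<rparr>\<^esub> h \<otimes>\<^bsub>PG\<lparr>carrier := L\<rparr>\<^esub> inv\<^bsub>PG\<lparr>carrier := L\<rparr>\<^esub> x \<in> A"
      using x PG.m_inv_consistent[OF subgroup_L, of x] by (simp add: conjugates_def A_def)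
  qed
qed

text \<open>Vertices and edges of the quotient of the Bass-Serre tree by \<open>L\<close>.\<close>

definition cover_vertex :: "'v \<Rightarrow> 'q \<Rightarrow> 'v \<times> 'q set" where
  "cover_vertex v q = (v, (\<lambda>g. q \<otimes>\<^bsub>Q\<^esub> \<rho> (vertex_elem v g)) ` carrier (vgroup Y v))"

definition cover_edge :: "'e \<Rightarrow> 'q \<Rightarrow> 'e \<times> 'q set" where
  "cover_edge e q = (e, (\<lambda>a. q \<otimes>\<^bsub>Q\<^esub> \<rho> (vertex_elem (src e) (tail_emb Y e a))) ` carrier (egroup Y e))"

lemma orbit_eq:
  assumes "group K" "h \<in> hom K Q" "k \<in> carrier K" "q \<in> carrier Q"
  shows "(\<lambda>g. q \<otimes>\<^bsub>Q\<^esub> h k \<otimes>\<^bsub>Q\<^esub> h g) ` carrier K = (\<lambda>g. q \<otimes>\<^bsub>Q\<^esub> h g) ` carrier K"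
proof -
  interpret K: group K by fact
  interpret h: group_hom K Q h using assms(2) by unfold_locales
  show ?thesis
  proof (intro Set.equalityI subsetI)
    fix z assume "z \<in> (\<lambda>g. q \<otimes>\<^bsub>Q\<^esub> h k \<otimes>\<^bsub>Q\<^esub> h g) ` carrier K"
    then obtain g where "g \<in> carrier K" "z = q \<otimes>\<^bsub>Q\<^esub> h (k \<otimes>\<^bsub>K\<^esub> g)" using assms by (auto simp: Q.m_assoc)
    then show "z \<in> (\<lambda>g. q \<otimes>\<^bsub>Q\<^esub> h g) ` carrier K" using assms(3) by blast
  next
    fix z assume "z \<in> (\<lambda>g. q \<otimes>\<^bsub>Q\<^esub> h g) ` carrier K"
    then obtain g where g: "g \<in> carrier K" "z = q \<otimes>\<^bsub>Q\<^esub> h g" by blast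
    have "h g = h k \<otimes>\<^bsub>Q\<^esub> h (inv\<^bsub>K\<^esub> k \<otimes>\<^bsub>K\<^esub> g)" using g(1) assms by (simp add: Q.m_assoc[symmetric])
    then have "z = q \<otimes>\<^bsub>Q\<^esub> h k \<otimes>\<^bsub>Q\<^esub> h (inv\<^bsub>K\<^esub> k \<otimes>\<^bsub>K\<^esub> g)"
      unfolding g(2) using g(1) assms by (simp add: Q.m_assoc del: h.hom_mult)
    moreover have "inv\<^bsub>K\<^esub> k \<otimes>\<^bsub>K\<^esub> g \<in> carrier K" using g(1) assms(3) by simp
    ultimately show "z \<in> (\<lambda>g. q \<otimes>\<^bsub>Q\<^esub> h k \<otimes>\<^bsub>Q\<^esub> h g) ` carrier K" by blast
  qed
qed

lemma self_in_orbit: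
  assumes "group K" "h \<in> hom K Q" "q \<in> carrier Q"
  shows "q \<in> (\<lambda>g. q \<otimes>\<^bsub>Q\<^esub> h g) ` carrier K"
  by (rule image_eqI[of _ _ "\<one>\<^bsub>K\<^esub>"])
    (use assms hom_one[OF assms(2,1) group_Q] group.is_monoid[OF assms(1)] in \<open>auto simp: monoid.one_closed\<close>)

lemma rho_vertex_hom: "v \<in> V \<Longrightarrow> (\<lambda>g. \<rho> (vertex_elem v g)) \<in> hom (vgroup Y v) Q"
  using hom_compose[OF vertex_elem_hom \<rho>_hom] by (simp add: comp_def)

lemma rho_edge_hom: "e \<in> E \<Longrightarrow> (\<lambda>a. \<rho> (vertex_elem (src e) (tail_emb Y e a))) \<in> hom (egroup Y e) Q"
  using hom_compose[OF emb_hom(1) rho_vertex_hom] by (simp add: comp_def)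

lemma cover_vertex_mult:
  "v \<in> V \<Longrightarrow> q \<in> carrier Q \<Longrightarrow> g \<in> carrier (vgroup Y v) \<Longrightarrow>
    cover_vertex v (q \<otimes>\<^bsub>Q\<^esub> \<rho> (vertex_elem v g)) = cover_vertex v q"
  unfolding cover_vertex_def using orbit_eq[OF group_vgroup rho_vertex_hom] by simp

lemma cover_edge_mult:
  "e \<in> E \<Longrightarrow> q \<in> carrier Q \<Longrightarrow> a \<in> carrier (egroup Y e) \<Longrightarrow>
    cover_edge e (q \<otimes>\<^bsub>Q\<^esub> \<rho> (vertex_elem (src e) (tail_emb Y e a))) = cover_edge e q"
  unfolding cover_edge_def using orbit_eq[OF group_egroup rho_edge_hom] by simp

text \<open>The vertex group element obtained here is what later corrects a tree path so that it has
  the same image under \<open>\<rho>\<close> as a given path to the same vertex of the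
  cover.\<close>

lemma cover_vertex_eqD:
  assumes "cover_vertex v q = cover_vertex v' q'" "v' \<in> V" "q' \<in> carrier Q"
  shows "v = v' \<and> (\<exists>g\<in>carrier (vgroup Y v). q' = q \<otimes>\<^bsub>Q\<^esub> \<rho> (vertex_elem v g))"
  using self_in_orbit[OF group_vgroup rho_vertex_hom, OF assms(2,2,3)] assms(1)
  unfolding cover_vertex_def by auto

lemma cover_edge_eqD:
  assumes "cover_edge e q = cover_edge e' q'" "e' \<in> E" "q' \<in> carrier Q"
  shows "e = e' \<and> (\<exists>a\<in>carrier (egroup Y e). q' = q \<otimes>\<^bsub>Q\<^esub> \<rho> (vertex_elem (src e) (tail_emb Y e a)))"
  using self_in_orbit[OF group_egroup rho_edge_hom, OF assms(2,2,3)] assms(1)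
  unfolding cover_edge_def by auto

section \<open>Cocycles counting edges of the cover\<close>

text \<open>A crossed homomorphism: \<open>c q x\<close> is the total weight of the walk that
  \<open>x\<close> describes in the cover from label \<open>q\<close>, which ends at label
  \<open>q\<close> times \<open>\<rho> x\<close>. Vertex letters cost nothing, and an arc
  contributes the weight of the cover edge that it crosses. On elements with trivial image under
  \<open>\<rho>\<close> it is multiplicative.\<close>

definition cocycle :: "('f, 'n) monoid_scheme \<Rightarrow> ('e \<times> 'q set \<Rightarrow> 'f) \<Rightarrow>
    ('q \<Rightarrow> ('v \<times> 'g + 'e) word set \<Rightarrow> 'f) \<Rightarrow> bool" where
  "cocycle F w c \<longleftrightarrow>
    (\<forall>q\<in>carrier Q. \<forall>x\<in>carrier PG. c q x \<in> carrier F) \<and>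
    (\<forall>q\<in>carrier Q. \<forall>x\<in>carrier PG. \<forall>y\<in>carrier PG. c q (x \<cdot> y) = c q x \<otimes>\<^bsub>F\<^esub> c (q \<otimes>\<^bsub>Q\<^esub> \<rho> x) y) \<and>
    (\<forall>q\<in>carrier Q. \<forall>v\<in>V. \<forall>g\<in>carrier (vgroup Y v). c q (vertex_elem v g) = \<one>\<^bsub>F\<^esub>) \<and>
    (\<forall>q\<in>carrier Q. \<forall>e\<in>E. c q (arc_elem e) = w (cover_edge e q))"

lemma cocycleD:
  assumes "cocycle F w c" "q \<in> carrier Q"
  shows "x \<in> carrier PG \<Longrightarrow> c q x \<in> carrier F"
    "x \<in> carrier PG \<Longrightarrow> y \<in> carrier PG \<Longrightarrow> c q (x \<cdot> y) = c q x \<otimes>\<^bsub>F\<^esub> c (q \<otimes>\<^bsub>Q\<^esub> \<rho> x) y"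
    "v \<in> V \<Longrightarrow> g \<in> carrier (vgroup Y v) \<Longrightarrow> c q (vertex_elem v g) = \<one>\<^bsub>F\<^esub>"
    "e \<in> E \<Longrightarrow> c q (arc_elem e) = w (cover_edge e q)"
  using assms unfolding cocycle_def by auto

text \<open>The action of the path group on \<open>F \<times> Q\<close>, which realizes a homomorphism to a wreath product.\<close>

lemma cocycle_exists:
  fixes F :: "('f, 'n) monoid_scheme"
  assumes "group F" and w: "\<And>z. w z \<in> carrier F"
  obtains c where "cocycle F w c"
proof -
  interpret F: group F by fact
  have we: "w (cover_edge e q) \<in> carrier F" for e q by (rule w)
  define X where "X = carrier F \<times> carrier Q"
  \<comment> \<open>The first coordinate accumulates weights and the second is the current label;
    vertex letters change only the label.\<close>
  define \<phi> where "\<phi> v g = (\<lambda>(f :: 'f, q). (f, q \<otimes>\<^bsub>Q\<^esub> \<rho> (vertex_elem v g)))" for v g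
  define b where "b e = (\<lambda>(f, q). (f \<otimes>\<^bsub>F\<^esub> w (cover_edge e q), q \<otimes>\<^bsub>Q\<^esub> \<rho> (arc_elem e)))" for e
  have "\<exists>\<alpha>. (\<forall>v g x. v \<in> V \<longrightarrow> g \<in> carrier (vgroup Y v) \<longrightarrow> x \<in> X \<longrightarrow> \<alpha> (vertex_elem v g) x = \<phi> v g x) \<and>
    (\<forall>e x. e \<in> E \<longrightarrow> x \<in> X \<longrightarrow> \<alpha> (arc_elem e) x = b e x) \<and>
    (\<forall>p x. p \<in> carrier PG \<longrightarrow> x \<in> X \<longrightarrow> \<alpha> p x \<in> X) \<and>
    (\<forall>p q x. p \<in> carrier PG \<longrightarrow> q \<in> carrier PG \<longrightarrow> x \<in> X \<longrightarrow> \<alpha> (p \<cdot> q) x = \<alpha> q (\<alpha> p x))"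
  proof (rule path_group_action[of X \<phi> b], goal_cases)
    case (1 v g x)
    then show ?case by (auto simp: X_def \<phi>_def)
  next
    case (2 v g h x)
    then show ?case by (auto simp: X_def \<phi>_def vertex_elem_mult Q.m_assoc)
  next
    case (3 v x)
    then show ?case by (auto simp: X_def \<phi>_def vertex_elem_one)
  next
    case (4 e)
    let ?r = "\<rho> (arc_elem e)"
    have r: "?r \<in> carrier Q" using 4 by simp
    show ?case
      by (rule bij_betwI[where g = "\<lambda>(f, q). (f \<otimes>\<^bsub>F\<^esub> inv\<^bsub>F\<^esub> w (cover_edge e (q \<otimes>\<^bsub>Q\<^esub> inv\<^bsub>Q\<^esub> ?r)), q \<otimes>\<^bsub>Q\<^esub> inv\<^bsub>Q\<^esub> ?r)"])
        (use r we in \<open>auto simp: b_def X_def Q.m_assoc F.m_assoc\<close>)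
  next
    \<comment> \<open>The arc relation survives because \<open>cover_edge\<close> identifies labels
      that differ by the tail image of the edge group, so \<open>w\<close> assigns them the same
      weight.\<close>
    case (5 e a x)
    have c: "vertex_elem (tgt e) (head_emb Y e a) \<in> carrier PG" "vertex_elem (src e) (tail_emb Y e a) \<in> carrier PG"
      "arc_elem e \<in> carrier PG" using 5 by auto
    have "\<rho> (arc_elem e) \<otimes>\<^bsub>Q\<^esub> \<rho> (vertex_elem (tgt e) (head_emb Y e a)) =
        \<rho> (vertex_elem (src e) (tail_emb Y e a)) \<otimes>\<^bsub>Q\<^esub> \<rho> (arc_elem e)"
      using arc_relation[OF 5(1,2)] c rho.hom_mult by metis
    then show ?case using 5 c by (auto simp: X_def \<phi>_def b_def cover_edge_mult Q.m_assoc)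
  next
    case (6 \<alpha>)
    then show ?case by (intro exI[of _ \<alpha>]) simp
  qed
  then obtain \<alpha> where \<alpha>: "\<And>v g x. v \<in> V \<Longrightarrow> g \<in> carrier (vgroup Y v) \<Longrightarrow> x \<in> X \<Longrightarrow> \<alpha> (vertex_elem v g) x = \<phi> v g x"
    "\<And>e x. e \<in> E \<Longrightarrow> x \<in> X \<Longrightarrow> \<alpha> (arc_elem e) x = b e x"
    "\<And>p x. p \<in> carrier PG \<Longrightarrow> x \<in> X \<Longrightarrow> \<alpha> p x \<in> X"
    "\<And>p q x. p \<in> carrier PG \<Longrightarrow> q \<in> carrier PG \<Longrightarrow> x \<in> X \<Longrightarrow> \<alpha> (p \<cdot> q) x = \<alpha> q (\<alpha> p x)" by blast
  \<comment> \<open>Every element multiplies the first coordinate on the right by a factor that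
    depends on the label only. This factor, evaluated from the identity of \<open>F\<close>, is the
    cocycle.\<close>
  define eqv where "eqv x \<longleftrightarrow> (\<exists>d. \<forall>q\<in>carrier Q. d q \<in> carrier F \<and>
    (\<forall>f\<in>carrier F. \<alpha> x (f, q) = (f \<otimes>\<^bsub>F\<^esub> d q, q \<otimes>\<^bsub>Q\<^esub> \<rho> x)))" for x
  have \<alpha>_one: "\<alpha> \<one>\<^bsub>PG\<^esub> x = x" if "x \<in> X" for x
    using \<alpha>(1)[OF v0 _ that, of "\<one>\<^bsub>vgroup Y v0\<^esub>"] that group.is_monoid[OF group_vgroup[OF v0]] v0
    by (auto simp: \<phi>_def vertex_elem_one monoid.one_closed X_def)
  have eqv: "eqv x" if "x \<in> carrier PG" for x
    using that
  proof (rule path_group_generated)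
    show "eqv \<one>\<^bsub>PG\<^esub>" unfolding eqv_def
      by (intro exI[of _ "\<lambda>_. \<one>\<^bsub>F\<^esub>"]) (use \<alpha>_one in \<open>auto simp: X_def\<close>)
  next
    fix x y assume xy: "x \<in> carrier PG" "y \<in> carrier PG" "eqv x" "eqv y"
    obtain d where d: "\<And>q. q \<in> carrier Q \<Longrightarrow> d q \<in> carrier F"
      "\<And>f q. q \<in> carrier Q \<Longrightarrow> f \<in> carrier F \<Longrightarrow> \<alpha> x (f, q) = (f \<otimes>\<^bsub>F\<^esub> d q, q \<otimes>\<^bsub>Q\<^esub> \<rho> x)"
      using xy(3) unfolding eqv_def by blast
    obtain d' where d': "\<And>q. q \<in> carrier Q \<Longrightarrow> d' q \<in> carrier F"
      "\<And>f q. q \<in> carrier Q \<Longrightarrow> f \<in> carrier F \<Longrightarrow> \<alpha> y (f, q) = (f \<otimes>\<^bsub>F\<^esub> d' q, q \<otimes>\<^bsub>Q\<^esub> \<rho> y)"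
      using xy(4) unfolding eqv_def by blast
    show "eqv (x \<cdot> y)" unfolding eqv_def
      by (intro exI[of _ "\<lambda>q. d q \<otimes>\<^bsub>F\<^esub> d' (q \<otimes>\<^bsub>Q\<^esub> \<rho> x)"])
        (use xy(1,2) d d' \<alpha>(4)[OF xy(1,2)] in \<open>auto simp: X_def F.m_assoc Q.m_assoc\<close>)
  next
    fix x assume x: "x \<in> carrier PG" "eqv x"
    obtain d where d: "\<And>q. q \<in> carrier Q \<Longrightarrow> d q \<in> carrier F"
      "\<And>f q. q \<in> carrier Q \<Longrightarrow> f \<in> carrier F \<Longrightarrow> \<alpha> x (f, q) = (f \<otimes>\<^bsub>F\<^esub> d q, q \<otimes>\<^bsub>Q\<^esub> \<rho> x)"
      using x(2) unfolding eqv_def by blast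
    have "\<alpha> (pinv x) (f, q) = (f \<otimes>\<^bsub>F\<^esub> inv\<^bsub>F\<^esub> d (q \<otimes>\<^bsub>Q\<^esub> inv\<^bsub>Q\<^esub> \<rho> x), q \<otimes>\<^bsub>Q\<^esub> \<rho> (pinv x))"
      if q: "q \<in> carrier Q" and f: "f \<in> carrier F" for q f
    proof -
      define p where "p = q \<otimes>\<^bsub>Q\<^esub> inv\<^bsub>Q\<^esub> \<rho> x"
      define g where "g = f \<otimes>\<^bsub>F\<^esub> inv\<^bsub>F\<^esub> d p"
      have p: "p \<in> carrier Q" "p \<otimes>\<^bsub>Q\<^esub> \<rho> x = q" unfolding p_def using q x(1) by (simp_all add: Q.m_assoc)
      have g: "g \<in> carrier F" "g \<otimes>\<^bsub>F\<^esub> d p = f" unfolding g_def using f d(1)[OF p(1)] by (simp_all add: F.m_assoc)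
      have gp: "(g, p) \<in> X" using g p by (simp add: X_def)
      have "\<alpha> (pinv x) (f, q) = \<alpha> (pinv x) (\<alpha> x (g, p))" using d(2)[OF p(1) g(1)] p g by simp
      also have "\<dots> = \<alpha> (x \<cdot> pinv x) (g, p)" using \<alpha>(4)[OF x(1) _ gp, of "pinv x"] x(1) by simp
      also have "\<dots> = (g, p)" using x(1) \<alpha>_one[OF gp] by simp
      finally show ?thesis using x(1) by (simp add: g_def p_def)
    qed
    then show "eqv (pinv x)" unfolding eqv_def
      by (intro exI[of _ "\<lambda>q. inv\<^bsub>F\<^esub> d (q \<otimes>\<^bsub>Q\<^esub> inv\<^bsub>Q\<^esub> \<rho> x)"]) (use d(1) x(1) in auto)
  next
    show "eqv (vertex_elem v g)" if "v \<in> V" "g \<in> carrier (vgroup Y v)" for v g unfolding eqv_def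
      by (intro exI[of _ "\<lambda>_. \<one>\<^bsub>F\<^esub>"]) (use \<alpha>(1)[OF that] in \<open>auto simp: X_def \<phi>_def\<close>)
    show "eqv (arc_elem e)" if "e \<in> E" for e unfolding eqv_def
      by (intro exI[of _ "\<lambda>q. w (cover_edge e q)"]) (use \<alpha>(2)[OF that] we in \<open>auto simp: X_def b_def\<close>)
  qed
  define c where "c q x = fst (\<alpha> x (\<one>\<^bsub>F\<^esub>, q))" for q x
  have \<alpha>_c: "\<alpha> x (f, q) = (f \<otimes>\<^bsub>F\<^esub> c q x, q \<otimes>\<^bsub>Q\<^esub> \<rho> x) \<and> c q x \<in> carrier F"
    if x: "x \<in> carrier PG" and f: "f \<in> carrier F" and q: "q \<in> carrier Q" for x f q
  proof -
    obtain d where d: "d q \<in> carrier F" "\<And>f. f \<in> carrier F \<Longrightarrow> \<alpha> x (f, q) = (f \<otimes>\<^bsub>F\<^esub> d q, q \<otimes>\<^bsub>Q\<^esub> \<rho> x)"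
      using eqv[OF x] q unfolding eqv_def by blast
    then have "c q x = d q" by (simp add: c_def)
    then show ?thesis using d f by simp
  qed
  have "cocycle F w c" unfolding cocycle_def
  proof (intro conjI ballI)
    fix q assume q: "q \<in> carrier Q"
    show "c q x \<in> carrier F" if "x \<in> carrier PG" for x using \<alpha>_c[OF that F.one_closed q] by simp
    show "c q (x \<cdot> y) = c q x \<otimes>\<^bsub>F\<^esub> c (q \<otimes>\<^bsub>Q\<^esub> \<rho> x) y" if x: "x \<in> carrier PG" and y: "y \<in> carrier PG" for x y
    proof -
      have q': "q \<otimes>\<^bsub>Q\<^esub> \<rho> x \<in> carrier Q" using q x by simp
      have "\<alpha> (x \<cdot> y) (\<one>\<^bsub>F\<^esub>, q) = \<alpha> y (\<alpha> x (\<one>\<^bsub>F\<^esub>, q))" using \<alpha>(4)[OF x y, of "(\<one>\<^bsub>F\<^esub>, q)"] q by (simp add: X_def)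
      also have "\<alpha> x (\<one>\<^bsub>F\<^esub>, q) = (c q x, q \<otimes>\<^bsub>Q\<^esub> \<rho> x)" using \<alpha>_c[OF x F.one_closed q] by simp
      also have "\<alpha> y (c q x, q \<otimes>\<^bsub>Q\<^esub> \<rho> x) = (c q x \<otimes>\<^bsub>F\<^esub> c (q \<otimes>\<^bsub>Q\<^esub> \<rho> x) y, q \<otimes>\<^bsub>Q\<^esub> \<rho> x \<otimes>\<^bsub>Q\<^esub> \<rho> y)"
        using \<alpha>_c[OF y _ q', of "c q x"] \<alpha>_c[OF x F.one_closed q] by simp
      finally show ?thesis by (simp add: c_def)
    qed
    show "c q (vertex_elem v g) = \<one>\<^bsub>F\<^esub>" if "v \<in> V" "g \<in> carrier (vgroup Y v)" for v g
      using \<alpha>(1)[OF that, of "(\<one>\<^bsub>F\<^esub>, q)"] q by (simp add: c_def \<phi>_def X_def)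
    show "c q (arc_elem e) = w (cover_edge e q)" if "e \<in> E" for e
      using \<alpha>(2)[OF that, of "(\<one>\<^bsub>F\<^esub>, q)"] q we by (simp add: c_def b_def X_def)
  qed
  then show ?thesis by (rule that)
qed

section \<open>A spanning tree of the cover\<close>

text \<open>Walks from the base point that cross only edges in \<open>Tr\<close>. A cover edge is
  labelled at its source, so a backward step is tested at the point where it arrives.\<close>

inductive_set tree_paths :: "('e \<times> 'q set) set \<Rightarrow> ('v \<times> 'g + 'e) word set set"
  for Tr :: "('e \<times> 'q set) set"
  where
    one: "\<one>\<^bsub>PG\<^esub> \<in> tree_paths Tr"
  | vertex: "x \<in> tree_paths Tr \<Longrightarrow> v \<in> V \<Longrightarrow> g \<in> carrier (vgroup Y v) \<Longrightarrow> x \<cdot> vertex_elem v g \<in> tree_paths Tr"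
  | arc: "x \<in> tree_paths Tr \<Longrightarrow> e \<in> E \<Longrightarrow> cover_edge e (\<rho> x) \<in> Tr \<Longrightarrow> x \<cdot> arc_elem e \<in> tree_paths Tr"
  | arc_inv: "x \<in> tree_paths Tr \<Longrightarrow> e \<in> E \<Longrightarrow> cover_edge e (\<rho> (x \<cdot> pinv (arc_elem e))) \<in> Tr \<Longrightarrow>
      x \<cdot> pinv (arc_elem e) \<in> tree_paths Tr"

lemma tree_paths_closed: "x \<in> tree_paths Tr \<Longrightarrow> x \<in> carrier PG"
  by (induction rule: tree_paths.induct) auto

lemma tree_paths_mono: "x \<in> tree_paths Tr \<Longrightarrow> Tr \<subseteq> Tr' \<Longrightarrow> x \<in> tree_paths Tr'"
  by (induction rule: tree_paths.induct) (auto intro: tree_paths.intros)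

lemma cocycle_one:
  assumes "group F" "cocycle F w c" "q \<in> carrier Q"
  shows "c q \<one>\<^bsub>PG\<^esub> = \<one>\<^bsub>F\<^esub>"
proof -
  interpret F: group F by fact
  have "c q \<one>\<^bsub>PG\<^esub> \<in> carrier F" "c q \<one>\<^bsub>PG\<^esub> = c q \<one>\<^bsub>PG\<^esub> \<otimes>\<^bsub>F\<^esub> c q \<one>\<^bsub>PG\<^esub>"
    using cocycleD(1)[OF assms(2,3), of "\<one>\<^bsub>PG\<^esub>"] cocycleD(2)[OF assms(2,3), of "\<one>\<^bsub>PG\<^esub>" "\<one>\<^bsub>PG\<^esub>"] assms(3)
    by simp_all
  then show ?thesis by (metis F.r_cancel_one')
qed

lemma cocycle_steps:
  assumes "group F" "cocycle F w c" and x: "x \<in> carrier PG"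
  shows "v \<in> V \<Longrightarrow> g \<in> carrier (vgroup Y v) \<Longrightarrow> c \<one>\<^bsub>Q\<^esub> (x \<cdot> vertex_elem v g) = c \<one>\<^bsub>Q\<^esub> x"
    "e \<in> E \<Longrightarrow> c \<one>\<^bsub>Q\<^esub> (x \<cdot> arc_elem e) = c \<one>\<^bsub>Q\<^esub> x \<otimes>\<^bsub>F\<^esub> w (cover_edge e (\<rho> x))"
    "e \<in> E \<Longrightarrow> c \<one>\<^bsub>Q\<^esub> x = c \<one>\<^bsub>Q\<^esub> (x \<cdot> pinv (arc_elem e)) \<otimes>\<^bsub>F\<^esub> w (cover_edge e (\<rho> (x \<cdot> pinv (arc_elem e))))"
proof -
  interpret F: group F by fact
  note cD = cocycleD[OF assms(2)]
  have q: "\<one>\<^bsub>Q\<^esub> \<in> carrier Q" by simp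
  have m: "c \<one>\<^bsub>Q\<^esub> (z \<cdot> y) = c \<one>\<^bsub>Q\<^esub> z \<otimes>\<^bsub>F\<^esub> c (\<rho> z) y" if "z \<in> carrier PG" "y \<in> carrier PG" for z y
    using cD(2)[OF q that] that by simp
  show "v \<in> V \<Longrightarrow> g \<in> carrier (vgroup Y v) \<Longrightarrow> c \<one>\<^bsub>Q\<^esub> (x \<cdot> vertex_elem v g) = c \<one>\<^bsub>Q\<^esub> x"
    using m[OF x] cD(3)[of "\<rho> x" v g] cD(1)[OF q x] x by simp
  have arc: "c \<one>\<^bsub>Q\<^esub> (z \<cdot> arc_elem e) = c \<one>\<^bsub>Q\<^esub> z \<otimes>\<^bsub>F\<^esub> w (cover_edge e (\<rho> z))" if "e \<in> E" "z \<in> carrier PG" for e z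
    using m[OF that(2)] cD(4)[of "\<rho> z" e] that by simp
  show "c \<one>\<^bsub>Q\<^esub> x = c \<one>\<^bsub>Q\<^esub> (x \<cdot> pinv (arc_elem e)) \<otimes>\<^bsub>F\<^esub> w (cover_edge e (\<rho> (x \<cdot> pinv (arc_elem e))))" if "e \<in> E"
  proof -
    have z: "x \<cdot> pinv (arc_elem e) \<in> carrier PG" using x that by simp
    have "x \<cdot> pinv (arc_elem e) \<cdot> arc_elem e = x" using x that by (simp add: PG.m_assoc)
    then show ?thesis using arc[OF that z] by simp
  qed
  show "e \<in> E \<Longrightarrow> c \<one>\<^bsub>Q\<^esub> (x \<cdot> arc_elem e) = c \<one>\<^bsub>Q\<^esub> x \<otimes>\<^bsub>F\<^esub> w (cover_edge e (\<rho> x))"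
    using arc x by blast
qed

lemma cocycle_tree_path:
  assumes F: "group F" and c: "cocycle F w c" and w: "\<And>\<epsilon>. \<epsilon> \<in> Tr \<Longrightarrow> w \<epsilon> = \<one>\<^bsub>F\<^esub>"
    and "x \<in> tree_paths Tr"
  shows "c \<one>\<^bsub>Q\<^esub> x = \<one>\<^bsub>F\<^esub>"
  using assms(4)
proof (induction rule: tree_paths.induct)
  interpret F: group F by fact
  {
    case one
    then show ?case using cocycle_one[OF F c] by simp
  next
    case (vertex x v g)
    then show ?case using cocycle_steps(1)[OF F c tree_paths_closed] by simp
  next
    case (arc x e)
    then show ?case using cocycle_steps(2)[OF F c tree_paths_closed] w by simp
  next
    case (arc_inv x e)
    have z: "x \<cdot> pinv (arc_elem e) \<in> carrier PG" using arc_inv tree_paths_closed by simp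
    have "c \<one>\<^bsub>Q\<^esub> x = c \<one>\<^bsub>Q\<^esub> (x \<cdot> pinv (arc_elem e)) \<otimes>\<^bsub>F\<^esub> \<one>\<^bsub>F\<^esub>"
      using cocycle_steps(3)[OF F c tree_paths_closed[OF arc_inv.hyps(1)] arc_inv.hyps(2)] w[OF arc_inv.hyps(3)] by simp
    then show ?case using arc_inv.IH cocycleD(1)[OF c _ z, of "\<one>\<^bsub>Q\<^esub>"] by simp
  }
qed

definition cover :: "('v \<times> 'q set) set" where
  "cover = {cover_vertex v (\<rho> x) | v x. x \<in> paths v0 v}"

text \<open>The edge connects two chosen paths exactly: crossing it from \<open>\<tau> y\<close>,
  after a vertex correction, gives \<open>\<tau> y'\<close> up to a vertex correction. The equation
  holds in the path group and not merely under \<open>\<rho>\<close>, which is what makes tree edges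
  trivial modulo \<open>A\<close>.\<close>

definition link :: "('v \<times> 'q set) set \<Rightarrow> ('v \<times> 'q set \<Rightarrow> ('v \<times> 'g + 'e) word set) \<Rightarrow> 'e \<times> 'q set \<Rightarrow> bool" where
  "link D \<tau> \<epsilon> \<longleftrightarrow> (\<exists>e g g' y y'. e \<in> E \<and> g \<in> carrier (vgroup Y (src e)) \<and> g' \<in> carrier (vgroup Y (tgt e)) \<and>
    y \<in> D \<and> y' \<in> D \<and> fst y = src e \<and> fst y' = tgt e \<and> \<epsilon> = cover_edge e (\<rho> (\<tau> y \<cdot> vertex_elem (src e) g)) \<and>
    \<tau> y \<cdot> vertex_elem (src e) g \<cdot> arc_elem e = \<tau> y' \<cdot> vertex_elem (tgt e) g')"

text \<open>A subtree with vertex set \<open>D\<close> and edge set \<open>Tr\<close>, recorded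
  through a lift: \<open>\<tau> y\<close> is a tree path from the base point to \<open>y\<close>.
  Acyclicity is not stated; the links take its place, since each edge of \<open>Tr\<close> is
  matched by the lift.\<close>

definition partial_tree where
  "partial_tree D \<tau> Tr \<longleftrightarrow> D \<subseteq> cover \<and> cover_vertex v0 \<one>\<^bsub>Q\<^esub> \<in> D \<and> \<tau> (cover_vertex v0 \<one>\<^bsub>Q\<^esub>) = \<one>\<^bsub>PG\<^esub> \<and>
    (\<forall>y\<in>D. \<tau> y \<in> paths v0 (fst y) \<and> cover_vertex (fst y) (\<rho> (\<tau> y)) = y \<and> \<tau> y \<in> tree_paths Tr) \<and>
    (\<forall>\<epsilon>\<in>Tr. link D \<tau> \<epsilon>)"

lemma link_mono:
  assumes "link D \<tau> \<epsilon>" "\<And>y. y \<in> D \<Longrightarrow> \<tau>' y = \<tau> y" "D \<subseteq> D'" shows "link D' \<tau>' \<epsilon>"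
proof -
  obtain e g g' y y' where *: "e \<in> E" "g \<in> carrier (vgroup Y (src e))" "g' \<in> carrier (vgroup Y (tgt e))"
    "y \<in> D" "y' \<in> D" "fst y = src e" "fst y' = tgt e" "\<epsilon> = cover_edge e (\<rho> (\<tau> y \<cdot> vertex_elem (src e) g))"
    "\<tau> y \<cdot> vertex_elem (src e) g \<cdot> arc_elem e = \<tau> y' \<cdot> vertex_elem (tgt e) g'"
    using assms(1) unfolding link_def by blast
  show ?thesis unfolding link_def
    by (rule exI[of _ e], rule exI[of _ g], rule exI[of _ g'], rule exI[of _ y], rule exI[of _ y'])
      (use * assms(2)[OF *(4)] assms(2)[OF *(5)] assms(3) in auto)
qed

lemma fst_cover_vertex [simp]: "fst (cover_vertex v q) = v"
  by (simp add: cover_vertex_def)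

lemma partial_tree_extend:
  assumes tree: "partial_tree D \<tau> Tr" and t: "t \<in> paths v0 u" and y: "y = cover_vertex u (\<rho> t)" "y \<notin> D"
    and tp: "t \<in> tree_paths (insert \<epsilon> Tr)" and l: "link (insert y D) (\<tau>(y := t)) \<epsilon>"
  shows "partial_tree (insert y D) (\<tau>(y := t)) (insert \<epsilon> Tr)"
proof -
  have "\<tau> z \<in> tree_paths (insert \<epsilon> Tr)" if "z \<in> D" for z
    using tree that tree_paths_mono[of "\<tau> z" Tr] by (auto simp: partial_tree_def)
  moreover have "y \<in> cover" using t y(1) by (auto simp: cover_def)
  moreover have "link (insert y D) (\<tau>(y := t)) \<epsilon>'" if "\<epsilon>' \<in> Tr" for \<epsilon>'
  proof (rule link_mono)
    show "link D \<tau> \<epsilon>'" using tree that by (auto simp: partial_tree_def)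
  qed (use y(2) in auto)
  ultimately show ?thesis using tree t y tp l unfolding partial_tree_def by (auto simp: fst_cover_vertex)
qed

lemma finite_cover: "finite cover"
proof -
  have "cover \<subseteq> V \<times> Pow (carrier Q)"
    unfolding cover_def cover_vertex_def using paths_closed by auto
  then show ?thesis using finite_graph finite_Q finite_subset by blast
qed

lemma vertex_one_closed [simp]: "v \<in> V \<Longrightarrow> \<one>\<^bsub>vgroup Y v\<^esub> \<in> carrier (vgroup Y v)"
  using group.is_monoid[OF group_vgroup] by (rule monoid.one_closed)

text \<open>A partial tree with the largest possible number of vertices exists because the cover is
  finite. Following an arbitrary path, the first step out of \<open>D\<close> would cross an edge by
  which the tree can be extended.\<close>

lemma spanning_tree_exists: "\<exists>\<tau> Tr. partial_tree cover \<tau> Tr"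
proof -
  define P where "P k \<longleftrightarrow> (\<exists>D \<tau> Tr. partial_tree D \<tau> Tr \<and> card D = k)" for k
  let ?y0 = "cover_vertex v0 \<one>\<^bsub>Q\<^esub>"
  have "?y0 \<in> cover" unfolding cover_def using paths_one[OF v0] rho.hom_one by (metis (mono_tags, lifting) mem_Collect_eq)
  then have "partial_tree {?y0} (\<lambda>_. \<one>\<^bsub>PG\<^esub>) {}"
    unfolding partial_tree_def using paths_one[OF v0] by (auto intro: tree_paths.one)
  then have "P (card {?y0})" unfolding P_def by blast
  moreover have bound: "k \<le> card cover" if "P k" for k
    using that card_mono[OF finite_cover] by (auto simp: P_def partial_tree_def)
  ultimately have "P (GREATEST k. P k)" by (rule GreatestI_nat)
  then obtain D \<tau> Tr where D: "partial_tree D \<tau> Tr" "card D = (GREATEST k. P k)" unfolding P_def by blast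
  have Dsub: "D \<subseteq> cover" using D(1) by (simp add: partial_tree_def)
  have finD: "finite D" using Dsub finite_cover by (rule finite_subset)
  have max: "y \<in> D" if "partial_tree (insert y D) \<tau>' Tr'" for y \<tau>' Tr'
  proof (rule ccontr)
    assume "y \<notin> D"
    then have "P (Suc (card D))" unfolding P_def using that finD by (metis card_insert_disjoint)
    then have "Suc (card D) \<le> (GREATEST k. P k)" using bound by (rule Greatest_le_nat)
    then show False using D(2) by simp
  qed
  have \<tau>: "\<tau> y \<in> paths v0 (fst y)" "cover_vertex (fst y) (\<rho> (\<tau> y)) = y" "\<tau> y \<in> tree_paths Tr" if "y \<in> D" for y
    using D(1) that by (auto simp: partial_tree_def)
  have "cover_vertex v (\<rho> x) \<in> D" if "x \<in> paths v0 v" for v x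
    using that
  proof (induction rule: paths_induct)
    case (base g)
    then have "cover_vertex v0 (\<rho> (vertex_elem v0 g)) = ?y0"
      using cover_vertex_mult[of v0 "\<one>\<^bsub>Q\<^esub>" g] by simp
    then show ?case using D(1) by (simp add: partial_tree_def)
  next
    case (forward x e g)
    let ?y = "cover_vertex (src e) (\<rho> x)"
    have e: "e \<in> E" "src e \<in> V" "tgt e \<in> V" using forward by auto
    have x: "x \<in> carrier PG" using forward paths_closed by blast
    have t0: "\<tau> ?y \<in> paths v0 (src e)" "cover_vertex (src e) (\<rho> (\<tau> ?y)) = ?y" "\<tau> ?y \<in> tree_paths Tr"
      using \<tau>[OF forward.IH] by simp_all
    have t0c: "\<tau> ?y \<in> carrier PG" using t0(1) by (rule paths_closed)
    \<comment> \<open>The chosen path to the current cover vertex is corrected by \<open>h\<close>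
      to have the same image as \<open>x\<close>, so that crossing \<open>e\<close> from it arrives
      at the same new cover vertex.\<close>
    obtain h where h: "h \<in> carrier (vgroup Y (src e))" "\<rho> x = \<rho> (\<tau> ?y) \<otimes>\<^bsub>Q\<^esub> \<rho> (vertex_elem (src e) h)"
      using cover_vertex_eqD[OF t0(2) e(2)] x by auto
    define t where "t = \<tau> ?y \<cdot> vertex_elem (src e) h \<cdot> arc_elem e"
    have t: "t \<in> paths v0 (tgt e)" unfolding t_def using paths_arc[OF paths_vertex[OF t0(1) h(1)] e(1)] .
    have tc: "t \<in> carrier PG" using t by (rule paths_closed)
    have "\<rho> t = \<rho> (x \<cdot> arc_elem e)" unfolding t_def using t0c h e x by simp
    then have y': "cover_vertex (tgt e) (\<rho> (x \<cdot> arc_elem e \<cdot> vertex_elem (tgt e) g)) = cover_vertex (tgt e) (\<rho> t)"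
      using cover_vertex_mult[of "tgt e" "\<rho> (x \<cdot> arc_elem e)" g] forward e x by simp
    define y where "y = cover_vertex (tgt e) (\<rho> t)"
    have "y \<in> D"
    proof (rule ccontr)
      assume y: "y \<notin> D"
      let ?\<epsilon> = "cover_edge e (\<rho> (\<tau> ?y \<cdot> vertex_elem (src e) h))"
      have tp: "t \<in> tree_paths (insert ?\<epsilon> Tr)" unfolding t_def
        using tree_paths_mono[OF t0(3), of "insert ?\<epsilon> Tr"] h(1) e by (auto intro!: tree_paths.intros)
      have ne: "?y \<noteq> y" using y forward.IH by blast
      have "link (insert y D) (\<tau>(y := t)) ?\<epsilon>" unfolding link_def
        by (rule exI[of _ e], rule exI[of _ h], rule exI[of _ "\<one>\<^bsub>vgroup Y (tgt e)\<^esub>"], rule exI[of _ ?y], rule exI[of _ y])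
          (use e h(1) forward.IH ne tc in \<open>auto simp: y_def t_def vertex_elem_one\<close>)
      from max[OF partial_tree_extend[OF D(1) t y_def y tp this]] y show False by blast
    qed
    then show ?case unfolding y' y_def .
  next
    case (backward x e g)
    let ?y = "cover_vertex (tgt e) (\<rho> x)"
    have e: "e \<in> E" "src e \<in> V" "tgt e \<in> V" using backward by auto
    have x: "x \<in> carrier PG" using backward paths_closed by blast
    have t0: "\<tau> ?y \<in> paths v0 (tgt e)" "cover_vertex (tgt e) (\<rho> (\<tau> ?y)) = ?y" "\<tau> ?y \<in> tree_paths Tr"
      using \<tau>[OF backward.IH] by simp_all
    have t0c: "\<tau> ?y \<in> carrier PG" using t0(1) by (rule paths_closed)
    obtain h where h: "h \<in> carrier (vgroup Y (tgt e))" "\<rho> x = \<rho> (\<tau> ?y) \<otimes>\<^bsub>Q\<^esub> \<rho> (vertex_elem (tgt e) h)"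
      using cover_vertex_eqD[OF t0(2) e(3)] x by auto
    define t where "t = \<tau> ?y \<cdot> vertex_elem (tgt e) h \<cdot> pinv (arc_elem e)"
    have t: "t \<in> paths v0 (src e)" unfolding t_def using paths_arc_inv[OF paths_vertex[OF t0(1) h(1)] e(1)] .
    have tc: "t \<in> carrier PG" using t by (rule paths_closed)
    have "\<rho> t = \<rho> (x \<cdot> pinv (arc_elem e))" unfolding t_def using t0c h e x by simp
    then have y': "cover_vertex (src e) (\<rho> (x \<cdot> pinv (arc_elem e) \<cdot> vertex_elem (src e) g)) = cover_vertex (src e) (\<rho> t)"
      using cover_vertex_mult[of "src e" "\<rho> (x \<cdot> pinv (arc_elem e))" g] backward e x by simp
    define y where "y = cover_vertex (src e) (\<rho> t)"
    have "y \<in> D"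
    proof (rule ccontr)
      assume y: "y \<notin> D"
      \<comment> \<open>Traversed backwards, the edge has the new vertex as its source, so its label
        is the image of \<open>t\<close>.\<close>
      let ?\<epsilon> = "cover_edge e (\<rho> t)"
      have tp: "t \<in> tree_paths (insert ?\<epsilon> Tr)" unfolding t_def
        by (rule tree_paths.arc_inv) (use tree_paths_mono[OF t0(3), of "insert ?\<epsilon> Tr"] h(1) e in \<open>auto intro!: tree_paths.vertex simp: t_def\<close>)
      have ne: "?y \<noteq> y" using y backward.IH by blast
      have tt: "t \<cdot> arc_elem e = \<tau> ?y \<cdot> vertex_elem (tgt e) h" unfolding t_def using t0c h(1) e by (simp add: PG.m_assoc)
      have "link (insert y D) (\<tau>(y := t)) ?\<epsilon>" unfolding link_def
        by (rule exI[of _ e], rule exI[of _ "\<one>\<^bsub>vgroup Y (src e)\<^esub>"], rule exI[of _ h], rule exI[of _ y], rule exI[of _ ?y])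
          (use tt e h(1) backward.IH ne tc in \<open>auto simp: y_def vertex_elem_one\<close>)
      from max[OF partial_tree_extend[OF D(1) t y_def y tp this]] y show False by blast
    qed
    then show ?case unfolding y' y_def .
  qed
  then have "D = cover" using Dsub by (auto simp: cover_def)
  then show ?thesis using D(1) by blast
qed

end

locale spanning_tree = finite_quotient Y v0 Q \<rho>
  for Y :: "('v, 'e, 'g, 'h) gog" and v0 :: 'v and Q :: "('q, 'm) monoid_scheme"
    and \<rho> :: "('v \<times> 'g + 'e) word set \<Rightarrow> 'q" +
  fixes \<tau> :: "'v \<times> 'q set \<Rightarrow> ('v \<times> 'g + 'e) word set" and Tr :: "('e \<times> 'q set) set"
  assumes tree: "partial_tree cover \<tau> Tr"
begin

abbreviation "PL \<equiv> PG\<lparr>carrier := L\<rparr>"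
abbreviation "M \<equiv> PL Mod A"

sublocale PL: group PL by (rule subgroup.subgroup_is_group[OF subgroup_L group_path_group])
sublocale A: normal A PL by (rule normal_A)
sublocale M: group M by (rule A.factorgroup_is_group)

definition cls :: "('v \<times> 'g + 'e) word set \<Rightarrow> ('v \<times> 'g + 'e) word set set" where "cls x = A #>\<^bsub>PL\<^esub> x"

sublocale cls: group_hom PL M cls
  unfolding cls_def using A.r_coset_hom_Mod by unfold_locales

lemma L_closed: "x \<in> L \<Longrightarrow> x \<in> carrier PG" "x \<in> L \<Longrightarrow> x \<in> paths v0 v0" "x \<in> L \<Longrightarrow> \<rho> x = \<one>\<^bsub>Q\<^esub>"
  using paths_closed(1) by (auto simp: L_def)

lemma cls_facts:
  assumes "x \<in> L" "y \<in> L"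
  shows "cls x \<in> carrier M" "cls (x \<cdot> y) = cls x \<otimes>\<^bsub>M\<^esub> cls y" "cls (pinv x) = inv\<^bsub>M\<^esub> cls x"
    "x \<cdot> pinv y \<in> A \<Longrightarrow> cls x = cls y" "cls x = \<one>\<^bsub>M\<^esub> \<longleftrightarrow> x \<in> A"
proof -
  show "cls x \<in> carrier M" "cls (x \<cdot> y) = cls x \<otimes>\<^bsub>M\<^esub> cls y" using cls.hom_closed[of x] cls.hom_mult[of x y] assms by simp_all
  show "cls (pinv x) = inv\<^bsub>M\<^esub> cls x" using cls.hom_inv[of x] assms PG.m_inv_consistent[OF subgroup_L, of x] by simp
  show "cls x = cls y" if "x \<cdot> pinv y \<in> A" unfolding cls_def
    by (rule PL.r_coset_eqI[OF A.subgroup_axioms]) (use assms that PG.m_inv_consistent[OF subgroup_L, of y] in auto)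
  show "cls x = \<one>\<^bsub>M\<^esub> \<longleftrightarrow> x \<in> A" unfolding cls_def one_FactGroup
    using PL.coset_join1[of A x] PL.coset_join2[of x A] A.subgroup_axioms assms by auto
qed

section \<open>Classes of paths relative to the spanning tree\<close>

definition base_path :: "'v \<Rightarrow> ('v \<times> 'g + 'e) word set \<Rightarrow> ('v \<times> 'g + 'e) word set" where
  "base_path v x = \<tau> (cover_vertex v (\<rho> x))"

lemma in_cover: "x \<in> paths v0 v \<Longrightarrow> cover_vertex v (\<rho> x) \<in> cover"
  by (auto simp: cover_def)

lemma base_path:
  assumes x: "x \<in> paths v0 v"
  shows "base_path v x \<in> paths v0 v" "base_path v x \<in> tree_paths Tr"
    "\<exists>g\<in>carrier (vgroup Y v). \<rho> x = \<rho> (base_path v x) \<otimes>\<^bsub>Q\<^esub> \<rho> (vertex_elem v g)"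
proof -
  have *: "\<tau> (cover_vertex v (\<rho> x)) \<in> paths v0 v" "cover_vertex v (\<rho> (\<tau> (cover_vertex v (\<rho> x)))) = cover_vertex v (\<rho> x)"
    "\<tau> (cover_vertex v (\<rho> x)) \<in> tree_paths Tr"
    using tree in_cover[OF x] by (auto simp: partial_tree_def)
  show "base_path v x \<in> paths v0 v" "base_path v x \<in> tree_paths Tr" using * by (simp_all add: base_path_def)
  show "\<exists>g\<in>carrier (vgroup Y v). \<rho> x = \<rho> (base_path v x) \<otimes>\<^bsub>Q\<^esub> \<rho> (vertex_elem v g)"
    using cover_vertex_eqD[OF *(2)] paths_closed[OF x] by (simp add: base_path_def)
qed

text \<open>The path \<open>x\<close> closed up by returning along the tree, after the correction
  \<open>g\<close> at its end point. It lies in \<open>L\<close> when the correction matches the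
  images under \<open>\<rho>\<close>.\<close>

definition remainder :: "'v \<Rightarrow> ('v \<times> 'g + 'e) word set \<Rightarrow> 'g \<Rightarrow> ('v \<times> 'g + 'e) word set" where
  "remainder v x g = x \<cdot> pinv (base_path v x \<cdot> vertex_elem v g)"

text \<open>The admissible corrections at the end of \<open>x\<close>: for a path from
  \<open>v0\<close> they form a coset of the kernel of \<open>\<rho>\<close> on the vertex
  group.\<close>

definition fibre :: "'v \<Rightarrow> ('v \<times> 'g + 'e) word set \<Rightarrow> 'g set" where
  "fibre v x = {g \<in> carrier (vgroup Y v). \<rho> x = \<rho> (base_path v x) \<otimes>\<^bsub>Q\<^esub> \<rho> (vertex_elem v g)}"

lemma remainder_L:
  assumes x: "x \<in> paths v0 v" and g: "g \<in> fibre v x"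
  shows "remainder v x g \<in> L"
proof -
  note b = base_path(1)[OF x]
  have g': "g \<in> carrier (vgroup Y v)" "\<rho> x = \<rho> (base_path v x) \<otimes>\<^bsub>Q\<^esub> \<rho> (vertex_elem v g)"
    using g by (auto simp: fibre_def)
  have "remainder v x g \<in> paths v0 v0" unfolding remainder_def
    by (rule paths_mult[OF paths_inv[OF paths_vertex[OF b g'(1)]] x])
  moreover have "\<rho> (remainder v x g) = \<one>\<^bsub>Q\<^esub>"
    unfolding remainder_def using paths_closed[OF x] paths_closed[OF b] g' by simp
  ultimately show ?thesis by (simp add: L_def)
qed

text \<open>The class of \<open>x\<close> modulo \<open>A\<close>, relative to the tree path with the same end point in the cover.\<close>

definition \<kappa> :: "'v \<Rightarrow> ('v \<times> 'g + 'e) word set \<Rightarrow> ('v \<times> 'g + 'e) word set set" where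
  "\<kappa> v x = cls (remainder v x (SOME g. g \<in> fibre v x))"

text \<open>Two corrections differ by an element of the kernel at \<open>v\<close>. Conjugation by
  \<open>x\<close> carries it into \<open>A\<close>, so the class of the remainder does not notice
  the choice.\<close>

lemma \<kappa>_eq:
  assumes x: "x \<in> paths v0 v" and g: "g \<in> fibre v x"
  shows "\<kappa> v x = cls (remainder v x g)"
proof -
  define h where "h = (SOME h. h \<in> fibre v x)"
  have h: "h \<in> fibre v x" unfolding h_def using g by (rule someI)
  note b = base_path(1)[OF x]
  have v: "v \<in> V" using x by (rule paths_closed)
  interpret Gv: group "vgroup Y v" by (rule group_vgroup[OF v])
  have c: "x \<in> carrier PG" "base_path v x \<in> carrier PG" "g \<in> carrier (vgroup Y v)" "h \<in> carrier (vgroup Y v)"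
    "vertex_elem v g \<in> carrier PG" "vertex_elem v h \<in> carrier PG"
    using paths_closed[OF x] paths_closed[OF b] g h v by (auto simp: fibre_def)
  have "\<rho> (base_path v x) \<otimes>\<^bsub>Q\<^esub> \<rho> (vertex_elem v h) = \<rho> (base_path v x) \<otimes>\<^bsub>Q\<^esub> \<rho> (vertex_elem v g)"
    using g h by (simp add: fibre_def)
  then have "\<rho> (vertex_elem v h) = \<rho> (vertex_elem v g)" using c by simp
  then have "\<rho> (vertex_elem v (inv\<^bsub>vgroup Y v\<^esub> h \<otimes>\<^bsub>vgroup Y v\<^esub> g)) = \<one>\<^bsub>Q\<^esub>"
    using c v by (simp add: vertex_elem_mult vertex_elem_inv)
  moreover have "inv\<^bsub>vgroup Y v\<^esub> h \<otimes>\<^bsub>vgroup Y v\<^esub> g \<in> carrier (vgroup Y v)" using c by simp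
  ultimately have "vertex_elem v (inv\<^bsub>vgroup Y v\<^esub> h \<otimes>\<^bsub>vgroup Y v\<^esub> g) \<in> vertex_kernel v"
    unfolding vertex_kernel_def by blast
  then have "x \<cdot> vertex_elem v (inv\<^bsub>vgroup Y v\<^esub> h \<otimes>\<^bsub>vgroup Y v\<^esub> g) \<cdot> pinv x \<in> A"
    using conjugates_path[OF x] by (simp add: conjugates_def A_def)
  moreover have "remainder v x h \<cdot> pinv (remainder v x g) = x \<cdot> vertex_elem v (inv\<^bsub>vgroup Y v\<^esub> h \<otimes>\<^bsub>vgroup Y v\<^esub> g) \<cdot> pinv x"
  proof -
    let ?b = "base_path v x"
    have "pinv ?b \<cdot> (?b \<cdot> (vertex_elem v g \<cdot> pinv x)) = vertex_elem v g \<cdot> pinv x"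
      using c by (simp add: PG.m_assoc[symmetric])
    then show ?thesis unfolding remainder_def
      using c v by (simp add: vertex_elem_mult vertex_elem_inv PG.inv_mult_group PG.m_assoc)
  qed
  ultimately show ?thesis unfolding \<kappa>_def h_def[symmetric]
    using cls_facts(4)[OF remainder_L[OF x h] remainder_L[OF x g]] by simp
qed

lemma fibre_nonempty: "x \<in> paths v0 v \<Longrightarrow> \<exists>g. g \<in> fibre v x"
  using base_path(3) by (auto simp: fibre_def)

lemma \<kappa>_closed: "x \<in> paths v0 v \<Longrightarrow> \<kappa> v x \<in> carrier M"
  using fibre_nonempty \<kappa>_eq remainder_L cls_facts(1) by metis

text \<open>The added vertex element goes into the correction and cancels in the remainder; the
  cover vertex stays the same.\<close>

lemma \<kappa>_vertex:
  assumes x: "x \<in> paths v0 v" and h: "h \<in> carrier (vgroup Y v)"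
  shows "\<kappa> v (x \<cdot> vertex_elem v h) = \<kappa> v x"
proof -
  have v: "v \<in> V" using x by (rule paths_closed)
  interpret Gv: group "vgroup Y v" by (rule group_vgroup[OF v])
  obtain g where g: "g \<in> fibre v x" using fibre_nonempty[OF x] by blast
  have g': "g \<in> carrier (vgroup Y v)" "\<rho> x = \<rho> (base_path v x) \<otimes>\<^bsub>Q\<^esub> \<rho> (vertex_elem v g)"
    using g by (auto simp: fibre_def)
  have c: "x \<in> carrier PG" "base_path v x \<in> carrier PG" using paths_closed[OF x] paths_closed[OF base_path(1)[OF x]] by auto
  have b: "base_path v (x \<cdot> vertex_elem v h) = base_path v x"
    unfolding base_path_def using cover_vertex_mult[OF v _ h, of "\<rho> x"] c v h by simp
  have "g \<otimes>\<^bsub>vgroup Y v\<^esub> h \<in> fibre v (x \<cdot> vertex_elem v h)"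
    unfolding fibre_def b using c v h g' by (simp add: vertex_elem_mult Q.m_assoc)
  then have "\<kappa> v (x \<cdot> vertex_elem v h) = cls (remainder v (x \<cdot> vertex_elem v h) (g \<otimes>\<^bsub>vgroup Y v\<^esub> h))"
    by (rule \<kappa>_eq[OF paths_vertex[OF x h]])
  also have "remainder v (x \<cdot> vertex_elem v h) (g \<otimes>\<^bsub>vgroup Y v\<^esub> h) = remainder v x g"
  proof -
    have "vertex_elem v h \<cdot> (pinv (vertex_elem v h) \<cdot> (pinv (vertex_elem v g) \<cdot> pinv (base_path v x))) = pinv (vertex_elem v g) \<cdot> pinv (base_path v x)"
      using c v h g' by (simp add: PG.m_assoc[symmetric])
    then show ?thesis unfolding remainder_def b using c v h g'
      by (simp add: vertex_elem_mult PG.inv_mult_group PG.m_assoc)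
  qed
  finally show ?thesis using \<kappa>_eq[OF x g] by simp
qed

text \<open>Elements of \<open>L\<close> have trivial image, so the tree path and the correction can
  be kept and \<open>l\<close> remains as a left factor.\<close>

lemma \<kappa>_L_mult:
  assumes l: "l \<in> L" and x: "x \<in> paths v0 v"
  shows "\<kappa> v (l \<cdot> x) = cls l \<otimes>\<^bsub>M\<^esub> \<kappa> v x"
proof -
  have v: "v \<in> V" using x by (rule paths_closed)
  obtain g where g: "g \<in> fibre v x" using fibre_nonempty[OF x] by blast
  have c: "x \<in> carrier PG" "base_path v x \<in> carrier PG" "vertex_elem v g \<in> carrier PG" "l \<in> carrier PG"
    using paths_closed[OF x] paths_closed[OF base_path(1)[OF x]] g v L_closed[OF l] by (auto simp: fibre_def)
  have \<rho>: "\<rho> (l \<cdot> x) = \<rho> x" using c L_closed(3)[OF l] by simp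
  have b: "base_path v (l \<cdot> x) = base_path v x" unfolding base_path_def \<rho> ..
  have "g \<in> fibre v (l \<cdot> x)" using g unfolding fibre_def b \<rho> .
  then have "\<kappa> v (l \<cdot> x) = cls (remainder v (l \<cdot> x) g)"
    by (rule \<kappa>_eq[OF paths_mult[OF x L_closed(2)[OF l]]])
  also have "remainder v (l \<cdot> x) g = l \<cdot> remainder v x g" unfolding remainder_def b using c by (simp add: PG.m_assoc)
  also have "cls \<dots> = cls l \<otimes>\<^bsub>M\<^esub> \<kappa> v x" unfolding \<kappa>_eq[OF x g] by (rule cls_facts(2)[OF l remainder_L[OF x g]])
  finally show ?thesis .
qed

lemma \<kappa>_tree:
  assumes y: "y \<in> cover" shows "\<kappa> (fst y) (\<tau> y) = \<one>\<^bsub>M\<^esub>"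
proof -
  have \<tau>: "\<tau> y \<in> paths v0 (fst y)" "cover_vertex (fst y) (\<rho> (\<tau> y)) = y"
    using tree y by (auto simp: partial_tree_def)
  have v: "fst y \<in> V" using \<tau>(1) by (rule paths_closed)
  have c: "\<tau> y \<in> carrier PG" using \<tau>(1) by (rule paths_closed)
  have b: "base_path (fst y) (\<tau> y) = \<tau> y" unfolding base_path_def \<tau>(2) ..
  have f: "\<one>\<^bsub>vgroup Y (fst y)\<^esub> \<in> fibre (fst y) (\<tau> y)" unfolding fibre_def b using v c by (simp add: vertex_elem_one)
  have "remainder (fst y) (\<tau> y) \<one>\<^bsub>vgroup Y (fst y)\<^esub> = \<one>\<^bsub>PG\<^esub>" unfolding remainder_def b using v c by (simp add: vertex_elem_one)
  then show ?thesis unfolding \<kappa>_eq[OF \<tau>(1) f] using cls.hom_one by simp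
qed

lemma \<kappa>_one: "\<kappa> v0 \<one>\<^bsub>PG\<^esub> = \<one>\<^bsub>M\<^esub>"
proof -
  have "cover_vertex v0 \<one>\<^bsub>Q\<^esub> \<in> cover" "\<tau> (cover_vertex v0 \<one>\<^bsub>Q\<^esub>) = \<one>\<^bsub>PG\<^esub>" using tree by (auto simp: partial_tree_def)
  then show ?thesis using \<kappa>_tree[of "cover_vertex v0 \<one>\<^bsub>Q\<^esub>"] by simp
qed

lemma \<kappa>_L:
  assumes l: "l \<in> L" shows "\<kappa> v0 l = cls l"
  using \<kappa>_L_mult[OF l paths_one[OF v0]]
  unfolding PG.r_one[OF L_closed(1)[OF l]] \<kappa>_one M.r_one[OF cls_facts(1)[OF l l]] .

section \<open>Elements of the quotient attached to edges\<close>

text \<open>The increment of \<open>\<kappa>\<close> across an arc. When \<open>x\<close> follows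
  the tree up to a vertex correction, it is the class of the loop that goes to the source along the
  tree, crosses the edge and returns along the tree.\<close>

definition edge_elem :: "'e \<Rightarrow> ('v \<times> 'g + 'e) word set \<Rightarrow> ('v \<times> 'g + 'e) word set set" where
  "edge_elem e x = inv\<^bsub>M\<^esub> \<kappa> (src e) x \<otimes>\<^bsub>M\<^esub> \<kappa> (tgt e) (x \<cdot> arc_elem e)"

text \<open>Two lifts of one cover edge differ by an edge group element on the right and an element
  \<open>l\<close> of \<open>L\<close> on the left. The first slides across the arc by the arc
  relation and is ignored by \<open>\<kappa>\<close>; the second contributes \<open>cls l\<close> to
  both ends and cancels.\<close>

lemma edge_elem_eq:
  assumes e: "e \<in> E" and x: "x \<in> paths v0 (src e)" and x': "x' \<in> paths v0 (src e)"
    and eq: "cover_edge e (\<rho> x) = cover_edge e (\<rho> x')"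
  shows "edge_elem e x = edge_elem e x'"
proof -
  have c: "x \<in> carrier PG" "x' \<in> carrier PG" using x x' paths_closed by auto
  obtain a where a: "a \<in> carrier (egroup Y e)" "\<rho> x' = \<rho> x \<otimes>\<^bsub>Q\<^esub> \<rho> (vertex_elem (src e) (tail_emb Y e a))"
    using cover_edge_eqD[OF eq e] c by auto
  define z where "z = x \<cdot> vertex_elem (src e) (tail_emb Y e a)"
  have z: "z \<in> paths v0 (src e)" unfolding z_def by (rule paths_vertex[OF x]) (use e a in auto)
  have zc: "z \<in> carrier PG" using z by (rule paths_closed)
  define l where "l = x' \<cdot> pinv z"
  have "\<rho> z = \<rho> x'" unfolding z_def a(2) using c e a(1) by simp
  moreover have "l \<in> paths v0 v0" unfolding l_def by (rule paths_mult[OF paths_inv[OF z] x'])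
  ultimately have l: "l \<in> L" unfolding L_def using c zc by (simp add: l_def)
  have lc: "l \<in> carrier PG" using l by (rule L_closed)
  have x'_eq: "x' = l \<cdot> z" unfolding l_def using c zc by (simp add: PG.m_assoc)
  have "z \<cdot> arc_elem e = x \<cdot> arc_elem e \<cdot> vertex_elem (tgt e) (head_emb Y e a)"
    unfolding z_def using c e a(1) arc_relation[OF e a(1)] by (simp add: PG.m_assoc)
  then have "\<kappa> (tgt e) (z \<cdot> arc_elem e) = \<kappa> (tgt e) (x \<cdot> arc_elem e)"
    using \<kappa>_vertex[OF paths_arc[OF x e], of "head_emb Y e a"] e a(1) by simp
  moreover have "\<kappa> (src e) z = \<kappa> (src e) x" unfolding z_def by (rule \<kappa>_vertex[OF x]) (use e a in auto)
  ultimately have ez: "edge_elem e z = edge_elem e x" by (simp add: edge_elem_def)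
  have k: "\<kappa> (src e) z \<in> carrier M" "\<kappa> (tgt e) (z \<cdot> arc_elem e) \<in> carrier M" "cls l \<in> carrier M"
    using \<kappa>_closed[OF z] \<kappa>_closed[OF paths_arc[OF z e]] cls_facts(1)[OF l l] by auto
  have "x' \<cdot> arc_elem e = l \<cdot> (z \<cdot> arc_elem e)" unfolding x'_eq using lc zc e by (simp add: PG.m_assoc)
  then have "\<kappa> (tgt e) (x' \<cdot> arc_elem e) = cls l \<otimes>\<^bsub>M\<^esub> \<kappa> (tgt e) (z \<cdot> arc_elem e)"
    using \<kappa>_L_mult[OF l paths_arc[OF z e]] by simp
  moreover have "\<kappa> (src e) x' = cls l \<otimes>\<^bsub>M\<^esub> \<kappa> (src e) z" unfolding x'_eq by (rule \<kappa>_L_mult[OF l z])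
  ultimately have "edge_elem e x' = inv\<^bsub>M\<^esub> (cls l \<otimes>\<^bsub>M\<^esub> \<kappa> (src e) z) \<otimes>\<^bsub>M\<^esub> (cls l \<otimes>\<^bsub>M\<^esub> \<kappa> (tgt e) (z \<cdot> arc_elem e))"
    by (simp add: edge_elem_def)
  also have "\<dots> = inv\<^bsub>M\<^esub> \<kappa> (src e) z \<otimes>\<^bsub>M\<^esub> (inv\<^bsub>M\<^esub> cls l \<otimes>\<^bsub>M\<^esub> (cls l \<otimes>\<^bsub>M\<^esub> \<kappa> (tgt e) (z \<cdot> arc_elem e)))"
    unfolding M.inv_mult_group[OF k(3,1)] by (rule M.m_assoc) (use k in \<open>simp_all only: M.inv_closed M.m_closed\<close>)
  also have "inv\<^bsub>M\<^esub> cls l \<otimes>\<^bsub>M\<^esub> (cls l \<otimes>\<^bsub>M\<^esub> \<kappa> (tgt e) (z \<cdot> arc_elem e)) = \<kappa> (tgt e) (z \<cdot> arc_elem e)"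
    unfolding M.m_assoc[OF M.inv_closed[OF k(3)] k(3,2), symmetric] M.l_inv[OF k(3)] by (rule M.l_one[OF k(2)])
  also have "inv\<^bsub>M\<^esub> \<kappa> (src e) z \<otimes>\<^bsub>M\<^esub> \<kappa> (tgt e) (z \<cdot> arc_elem e) = edge_elem e x" unfolding edge_elem_def[symmetric] by (rule ez)
  finally show ?thesis by (rule HOL.sym)
qed

text \<open>By the link condition there is a lift whose two ends are tree paths up to vertex
  elements, and \<open>\<kappa>\<close> is trivial at both.\<close>

lemma edge_elem_tree:
  assumes e: "e \<in> E" and x: "x \<in> paths v0 (src e)" and Tr: "cover_edge e (\<rho> x) \<in> Tr"
  shows "edge_elem e x = \<one>\<^bsub>M\<^esub>"
proof -
  have "link cover \<tau> (cover_edge e (\<rho> x))" using tree Tr by (simp add: partial_tree_def)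
  then obtain e' g g' y y' where *: "e' \<in> E" "g \<in> carrier (vgroup Y (src e'))" "g' \<in> carrier (vgroup Y (tgt e'))"
    "y \<in> cover" "y' \<in> cover" "fst y = src e'" "fst y' = tgt e'"
    "cover_edge e (\<rho> x) = cover_edge e' (\<rho> (\<tau> y \<cdot> vertex_elem (src e') g))"
    "\<tau> y \<cdot> vertex_elem (src e') g \<cdot> arc_elem e' = \<tau> y' \<cdot> vertex_elem (tgt e') g'"
    unfolding link_def by blast
  have [simp]: "e' = e" using *(8) by (simp add: cover_edge_def)
  have \<tau>: "\<tau> y \<in> paths v0 (src e)" "\<tau> y' \<in> paths v0 (tgt e)"
    using tree * by (auto simp: partial_tree_def)
  define z where "z = \<tau> y \<cdot> vertex_elem (src e) g"
  have z: "z \<in> paths v0 (src e)" unfolding z_def using paths_vertex[OF \<tau>(1)] * by simp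
  have "\<kappa> (src e) z = \<one>\<^bsub>M\<^esub>" unfolding z_def using \<kappa>_vertex[OF \<tau>(1)] \<kappa>_tree[OF *(4)] * by simp
  moreover have "\<kappa> (tgt e) (z \<cdot> arc_elem e) = \<one>\<^bsub>M\<^esub>"
    using *(9) \<kappa>_vertex[OF \<tau>(2)] \<kappa>_tree[OF *(5)] * by (simp add: z_def)
  ultimately have "edge_elem e z = \<one>\<^bsub>M\<^esub>" unfolding edge_elem_def by (simp only: M.inv_one M.l_one M.one_closed)
  moreover have "edge_elem e x = edge_elem e z" by (rule edge_elem_eq[OF e x z]) (use *(8) in \<open>simp add: z_def\<close>)
  ultimately show ?thesis by simp
qed

definition cover_edges :: "('e \<times> 'q set) set" where
  "cover_edges = {cover_edge e (\<rho> x) | e x. e \<in> E \<and> x \<in> paths v0 (src e)}"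

lemma finite_cover_edges: "finite cover_edges"
proof -
  have "cover_edge e q \<in> E \<times> Pow (carrier Q)" if "e \<in> E" "q \<in> carrier Q" for e q
    using that unfolding cover_edge_def by auto
  then have "cover_edges \<subseteq> E \<times> Pow (carrier Q)"
    unfolding cover_edges_def using paths_closed(1) rho.hom_closed by blast
  moreover have "finite (E \<times> Pow (carrier Q))" using finite_graph finite_Q by simp
  ultimately show ?thesis by (rule finite_subset)
qed

definition edge_class :: "'e \<times> 'q set \<Rightarrow> ('v \<times> 'g + 'e) word set set" where
  "edge_class \<epsilon> = (SOME m. \<exists>e x. e \<in> E \<and> x \<in> paths v0 (src e) \<and> \<epsilon> = cover_edge e (\<rho> x) \<and> m = edge_elem e x)"

lemma edge_class_eq:
  assumes "e \<in> E" "x \<in> paths v0 (src e)"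
  shows "edge_class (cover_edge e (\<rho> x)) = edge_elem e x"
  unfolding edge_class_def
proof (rule some_equality)
  show "\<exists>e' x'. e' \<in> E \<and> x' \<in> paths v0 (src e') \<and> cover_edge e (\<rho> x) = cover_edge e' (\<rho> x') \<and> edge_elem e x = edge_elem e' x'"
    using assms by blast
  fix m assume "\<exists>e' x'. e' \<in> E \<and> x' \<in> paths v0 (src e') \<and> cover_edge e (\<rho> x) = cover_edge e' (\<rho> x') \<and> m = edge_elem e' x'"
  then obtain e' x' where *: "e' \<in> E" "x' \<in> paths v0 (src e')" "cover_edge e (\<rho> x) = cover_edge e' (\<rho> x')" "m = edge_elem e' x'"
    by blast
  have "e' = e" using *(3) by (simp add: cover_edge_def)
  then show "m = edge_elem e x" using * edge_elem_eq[OF assms(1) assms(2), of x'] by simp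
qed

lemma edge_elem_closed:
  assumes "e \<in> E" "x \<in> paths v0 (src e)" shows "edge_elem e x \<in> carrier M"
  unfolding edge_elem_def
  by (intro M.m_closed M.inv_closed \<kappa>_closed paths_arc assms)

text \<open>\<open>\<theta>\<close> counts crossings of edges outside the tree, and \<open>h\<close>
  sends the basis element of such an edge to its edge element. Along every path \<open>h\<close> of
  the count equals \<open>\<kappa>\<close>, which is \<open>cls\<close> on \<open>L\<close>, so an
  element counted as trivial lies in \<open>A\<close>. Surjectivity comes from closing up each edge
  along the tree.\<close>

lemma free_quotient_of_tree:
  "\<exists>(S :: nat set) \<theta>. \<theta> \<in> hom PL (free_group S) \<and> \<theta> ` L = carrier (free_group S) \<and>
    (\<forall>x\<in>L. \<theta> x = \<one>\<^bsub>free_group S\<^esub> \<longleftrightarrow> x \<in> A)"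
proof -
  define S1 where "S1 = cover_edges - Tr"
  have finS1: "finite S1" using finite_cover_edges by (simp add: S1_def)
  \<comment> \<open>The finitely many edges outside the tree are numbered, which frees the type of
    the basis from the types of the graph.\<close>
  obtain enc :: "'e \<times> 'q set \<Rightarrow> nat" where enc: "inj_on enc S1"
    using finite_imp_inj_to_nat_seg[OF finS1] by (elim exE conjE) (rule that)
  let ?S = "enc ` S1"
  let ?F = "free_group ?S"
  interpret F: group ?F by (rule group_presented_group)
  \<comment> \<open>Edges outside the tree carry the basis elements and everything else weighs
    nothing, so tree paths are counted as trivial.\<close>
  define w where "w \<epsilon> = (if \<epsilon> \<in> S1 then word_class ?S {} [(enc \<epsilon>, True)] else \<one>\<^bsub>?F\<^esub>)" for \<epsilon>
  have w: "w \<epsilon> \<in> carrier ?F" for \<epsilon>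
  proof (cases "\<epsilon> \<in> S1")
    case True
    then have "[(enc \<epsilon>, True)] \<in> words ?S" by simp
    then show ?thesis unfolding w_def if_P[OF True] by (rule word_class_in_carrier)
  qed (simp add: w_def)
  obtain c where c: "cocycle ?F w c" using cocycle_exists[OF group_presented_group w] .
  have w_Tr: "w \<epsilon> = \<one>\<^bsub>?F\<^esub>" if "\<epsilon> \<in> Tr" for \<epsilon> using that by (simp add: w_def S1_def)
  note steps = cocycle_steps[OF group_presented_group c]
  have q1: "\<one>\<^bsub>Q\<^esub> \<in> carrier Q" by simp
  note c_closed = cocycleD(1)[OF c q1]
  have f_closed: "edge_class \<epsilon> \<in> carrier M" if \<epsilon>: "\<epsilon> \<in> S1" for \<epsilon>
  proof -
    obtain e x where e: "e \<in> E" "x \<in> paths v0 (src e)" "\<epsilon> = cover_edge e (\<rho> x)"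
      using \<epsilon> by (auto simp: S1_def cover_edges_def)
    show ?thesis unfolding e(3) edge_class_eq[OF e(1,2)] by (rule edge_elem_closed[OF e(1,2)])
  qed
  define f where "f s = edge_class (inv_into S1 enc s)" for s
  have f_enc: "f (enc \<epsilon>) = edge_class \<epsilon>" if "\<epsilon> \<in> S1" for \<epsilon> using inv_into_f_f[OF enc that] by (simp add: f_def)
  have "f \<in> ?S \<rightarrow> carrier M" using f_enc f_closed by auto
  then obtain h where h: "h \<in> hom ?F M" "\<And>w. w \<in> words ?S \<Longrightarrow> h (word_class ?S {} w) = eval_word M f w"
    "\<And>s. s \<in> ?S \<Longrightarrow> h (word_class ?S {} [(s, True)]) = f s"
    by (rule M.presented_group_hom) (erule emptyE, rule that)
  interpret h: group_hom ?F M h using h(1) by unfold_locales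
  have h_w: "h (w (cover_edge e (\<rho> x))) = edge_elem e x" if e: "e \<in> E" "x \<in> paths v0 (src e)" for e x
  proof (cases "cover_edge e (\<rho> x) \<in> Tr")
    case True
    show ?thesis unfolding w_Tr[OF True] h.hom_one edge_elem_tree[OF e True] by (rule HOL.refl)
  next
    case False
    then have S1: "cover_edge e (\<rho> x) \<in> S1" using e by (auto simp: S1_def cover_edges_def)
    have "h (w (cover_edge e (\<rho> x))) = f (enc (cover_edge e (\<rho> x)))"
      using h(3)[of "enc (cover_edge e (\<rho> x))"] S1 by (simp add: w_def)
    then show ?thesis unfolding f_enc[OF S1] edge_class_eq[OF e] .
  qed
  \<comment> \<open>Both sides start trivial, ignore vertex letters and change by the same edge
    element at each arc. A backward step uses the same increment, solved for the earlier
    value.\<close>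
  have h_c: "h (c \<one>\<^bsub>Q\<^esub> x) = \<kappa> v x" if "x \<in> paths v0 v" for v x
    using that
  proof (induction rule: paths_induct)
    case (base g)
    have "c \<one>\<^bsub>Q\<^esub> (vertex_elem v0 g) = \<one>\<^bsub>?F\<^esub>" using cocycleD(3)[OF c q1 base] .
    moreover have "\<kappa> v0 (vertex_elem v0 g) = \<one>\<^bsub>M\<^esub>"
      using \<kappa>_vertex[OF paths_one[OF v0] base(2)] base unfolding \<kappa>_one by simp
    ultimately show ?case by (simp only: h.hom_one)
  next
    case (forward x e g)
    have x: "x \<in> carrier PG" using forward.hyps(1) by (rule paths_closed)
    have xe: "x \<cdot> arc_elem e \<in> carrier PG" using x forward by simp
    have "c \<one>\<^bsub>Q\<^esub> (x \<cdot> arc_elem e \<cdot> vertex_elem (tgt e) g) = c \<one>\<^bsub>Q\<^esub> x \<otimes>\<^bsub>?F\<^esub> w (cover_edge e (\<rho> x))"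
      using steps(1)[OF xe _ forward.hyps(3)] steps(2)[OF x forward.hyps(2)] forward by simp
    also have "h \<dots> = \<kappa> (src e) x \<otimes>\<^bsub>M\<^esub> edge_elem e x"
      unfolding h.hom_mult[OF c_closed[OF x] w] forward.IH h_w[OF forward.hyps(2,1)] ..
    also have "\<dots> = \<kappa> (tgt e) (x \<cdot> arc_elem e)"
    proof -
      note k = \<kappa>_closed[OF forward.hyps(1)] \<kappa>_closed[OF paths_arc[OF forward.hyps(1,2)]]
      show ?thesis unfolding edge_elem_def M.m_assoc[OF k(1) M.inv_closed[OF k(1)] k(2), symmetric] M.r_inv[OF k(1)]
        by (rule M.l_one[OF k(2)])
    qed
    finally show ?case unfolding \<kappa>_vertex[OF paths_arc[OF forward.hyps(1,2)] forward.hyps(3)] .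
  next
    case (backward x e g)
    define z where "z = x \<cdot> pinv (arc_elem e)"
    have x: "x \<in> carrier PG" using backward.hyps(1) by (rule paths_closed)
    have z: "z \<in> paths v0 (src e)" unfolding z_def by (rule paths_arc_inv[OF backward.hyps(1,2)])
    have zc: "z \<in> carrier PG" using z by (rule paths_closed)
    have ze: "z \<cdot> arc_elem e = x" unfolding z_def using x backward.hyps(2) by (simp add: PG.m_assoc)
    note k = \<kappa>_closed[OF z] \<kappa>_closed[OF backward.hyps(1)]
    have hc: "h (c \<one>\<^bsub>Q\<^esub> z) \<in> carrier M" by (rule h.hom_closed[OF c_closed[OF zc]])
    have "\<kappa> (tgt e) x = h (c \<one>\<^bsub>Q\<^esub> z) \<otimes>\<^bsub>M\<^esub> edge_elem e z"
      unfolding backward.IH[symmetric] steps(3)[OF x backward.hyps(2), folded z_def]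
        h.hom_mult[OF c_closed[OF zc] w] h_w[OF backward.hyps(2) z] ..
    also have "\<dots> = h (c \<one>\<^bsub>Q\<^esub> z) \<otimes>\<^bsub>M\<^esub> inv\<^bsub>M\<^esub> \<kappa> (src e) z \<otimes>\<^bsub>M\<^esub> \<kappa> (tgt e) x"
      unfolding edge_elem_def ze by (rule M.m_assoc[OF hc M.inv_closed[OF k(1)] k(2), symmetric])
    finally have "\<one>\<^bsub>M\<^esub> \<otimes>\<^bsub>M\<^esub> \<kappa> (tgt e) x = h (c \<one>\<^bsub>Q\<^esub> z) \<otimes>\<^bsub>M\<^esub> inv\<^bsub>M\<^esub> \<kappa> (src e) z \<otimes>\<^bsub>M\<^esub> \<kappa> (tgt e) x"
      by (simp only: M.l_one[OF k(2)])
    then have "\<one>\<^bsub>M\<^esub> = h (c \<one>\<^bsub>Q\<^esub> z) \<otimes>\<^bsub>M\<^esub> inv\<^bsub>M\<^esub> \<kappa> (src e) z"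
      unfolding M.right_cancel[OF k(2) M.one_closed M.m_closed[OF hc M.inv_closed[OF k(1)]]] .
    then have "h (c \<one>\<^bsub>Q\<^esub> z) \<otimes>\<^bsub>M\<^esub> inv\<^bsub>M\<^esub> \<kappa> (src e) z = \<one>\<^bsub>M\<^esub>" by (rule HOL.sym)
    then have "h (c \<one>\<^bsub>Q\<^esub> z) = \<kappa> (src e) z" by (rule M.eq_if_mult_inv_eq_one[OF _ hc k(1)])
    moreover have "c \<one>\<^bsub>Q\<^esub> (z \<cdot> vertex_elem (src e) g) = c \<one>\<^bsub>Q\<^esub> z"
      by (rule steps(1)[OF zc _ backward.hyps(3)]) (use backward in auto)
    ultimately show ?case unfolding z_def[symmetric] \<kappa>_vertex[OF z backward.hyps(3)] by simp
  qed
  define \<theta> where "\<theta> = c \<one>\<^bsub>Q\<^esub>"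
  have \<theta>_mult: "c \<one>\<^bsub>Q\<^esub> (l \<cdot> y) = c \<one>\<^bsub>Q\<^esub> l \<otimes>\<^bsub>?F\<^esub> c \<one>\<^bsub>Q\<^esub> y" if "l \<in> L" "y \<in> carrier PG" for l y
    using cocycleD(2)[OF c q1 L_closed(1)[OF that(1)] that(2)] L_closed(3)[OF that(1)] by simp
  have \<theta>_hom: "\<theta> \<in> hom PL ?F"
    by (rule homI) (auto simp: \<theta>_def intro!: c_closed \<theta>_mult L_closed)
  have kernel: "\<theta> x = \<one>\<^bsub>?F\<^esub> \<longleftrightarrow> x \<in> A" if x: "x \<in> L" for x
  proof
    assume "\<theta> x = \<one>\<^bsub>?F\<^esub>"
    then have "cls x = \<one>\<^bsub>M\<^esub>"
      unfolding \<kappa>_L[OF x, symmetric] h_c[OF L_closed(2)[OF x], symmetric] \<theta>_def by (simp only: h.hom_one)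
    then show "x \<in> A" using cls_facts(5)[OF x x] by blast
  next
    assume "x \<in> A"
    then show "\<theta> x = \<one>\<^bsub>?F\<^esub>" using cocycleD(3)[OF c q1 v0] by (auto simp: A_def vertex_kernel_def \<theta>_def)
  qed
  interpret \<theta>: group_hom PL ?F \<theta> using \<theta>_hom by unfold_locales
  have img_sub: "subgroup (\<theta> ` L) ?F" using \<theta>.img_is_subgroup by simp
  \<comment> \<open>The loop \<open>l\<close> is a tree path to the source of the edge, the edge
    itself, and the return along the tree. Only the middle part has weight, so its count is exactly
    the wanted basis element.\<close>
  have gens: "word_class ?S {} [(s, True)] \<in> \<theta> ` L" if s: "s \<in> ?S" for s
  proof -
    obtain \<epsilon> where \<epsilon>: "\<epsilon> \<in> S1" "s = enc \<epsilon>" using s by blast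
    then obtain e x where e: "e \<in> E" "x \<in> paths v0 (src e)" "\<epsilon> = cover_edge e (\<rho> x)"
      by (auto simp: S1_def cover_edges_def)
    have xc: "x \<in> carrier PG" using e(2) by (rule paths_closed)
    note b = base_path[OF e(2)]
    obtain g where g: "g \<in> carrier (vgroup Y (src e))" "\<rho> x = \<rho> (base_path (src e) x) \<otimes>\<^bsub>Q\<^esub> \<rho> (vertex_elem (src e) g)"
      using b(3) by blast
    have bc: "base_path (src e) x \<in> carrier PG" using b(1) by (rule paths_closed)
    define z where "z = base_path (src e) x \<cdot> vertex_elem (src e) g"
    have z: "z \<in> paths v0 (src e)" unfolding z_def by (rule paths_vertex[OF b(1) g(1)])
    have zc: "z \<in> carrier PG" using z by (rule paths_closed)
    have \<rho>z: "\<rho> z = \<rho> x" unfolding z_def using bc e g by simp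
    have "c \<one>\<^bsub>Q\<^esub> z = \<one>\<^bsub>?F\<^esub>" unfolding z_def
      using steps(1)[OF bc _ g(1)] cocycle_tree_path[OF group_presented_group c w_Tr b(2)] e(1) by simp
    then have cze: "c \<one>\<^bsub>Q\<^esub> (z \<cdot> arc_elem e) = w \<epsilon>" using steps(2)[OF zc e(1)] w by (simp add: \<rho>z e(3))
    note ze = paths_arc[OF z e(1)]
    have zec: "z \<cdot> arc_elem e \<in> carrier PG" using ze by (rule paths_closed)
    note b' = base_path[OF ze]
    obtain g' where g': "g' \<in> fibre (tgt e) (z \<cdot> arc_elem e)" using fibre_nonempty[OF ze] by blast
    then have g'': "g' \<in> carrier (vgroup Y (tgt e))" by (simp add: fibre_def)
    let ?b = "base_path (tgt e) (z \<cdot> arc_elem e)"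
    have b'c: "?b \<in> carrier PG" using b'(1) by (rule paths_closed)
    define l where "l = remainder (tgt e) (z \<cdot> arc_elem e) g'"
    have l: "l \<in> L" unfolding l_def by (rule remainder_L[OF ze g'])
    have bg: "?b \<cdot> vertex_elem (tgt e) g' \<in> carrier PG" using b'c g'' e(1) by simp
    have "z \<cdot> arc_elem e = l \<cdot> (?b \<cdot> vertex_elem (tgt e) g')" unfolding l_def remainder_def
      using zec bg by (simp add: PG.m_assoc)
    then have "w \<epsilon> = c \<one>\<^bsub>Q\<^esub> l \<otimes>\<^bsub>?F\<^esub> c \<one>\<^bsub>Q\<^esub> (?b \<cdot> vertex_elem (tgt e) g')"
      using cze \<theta>_mult[OF l bg] by simp
    also have "c \<one>\<^bsub>Q\<^esub> (?b \<cdot> vertex_elem (tgt e) g') = \<one>\<^bsub>?F\<^esub>"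
      using steps(1)[OF b'c _ g''] cocycle_tree_path[OF group_presented_group c w_Tr b'(2)] e(1) by simp
    finally have "w \<epsilon> = \<theta> l" using c_closed[OF L_closed(1)[OF l]] by (simp add: \<theta>_def)
    then show ?thesis using \<epsilon> l by (simp add: w_def)
  qed
  have "p \<in> \<theta> ` L" if "p \<in> carrier ?F" for p
    using that
  proof (induction rule: presented_group_induct)
    case one
    then show ?case using subgroup.one_closed[OF img_sub] by (simp add: one_presented_group)
  next
    case (letter w s b)
    have s: "[(s, b)] \<in> words ?S" "[(s, True)] \<in> words ?S" using letter by auto
    have "word_class ?S {} [(s, b)] \<in> \<theta> ` L"
      using gens[OF letter(2)] subgroup.m_inv_closed[OF img_sub gens[OF letter(2)]] inv_word_class[OF s(2), of "{}"]
      by (cases b) (simp_all add: inverse_word_def)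
    from subgroup.m_closed[OF img_sub letter(3) this] show ?case
      unfolding presented_group_mult[OF letter(1) s(1)] .
  qed
  moreover have "\<theta> ` L \<subseteq> carrier ?F" using subgroup.subset[OF img_sub] .
  ultimately have "\<theta> ` L = carrier ?F" by blast
  then show ?thesis using \<theta>_hom kernel by blast
qed

end

context finite_quotient
begin

theorem free_quotient:
  "\<exists>(S :: nat set) \<theta>. \<theta> \<in> hom (PG\<lparr>carrier := L\<rparr>) (free_group S) \<and> \<theta> ` L = carrier (free_group S) \<and>
    (\<forall>x\<in>L. \<theta> x = \<one>\<^bsub>free_group S\<^esub> \<longleftrightarrow> x \<in> A)"
proof -
  obtain \<tau> Tr where "partial_tree cover \<tau> Tr" using spanning_tree_exists by blast
  then interpret spanning_tree Y v0 Q \<rho> \<tau> Tr by unfold_locales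
  show ?thesis by (rule free_quotient_of_tree)
qed

text \<open>\<open>A\<close> corresponds to the kernel of a homomorphism from the integer vectors to
  a finite group. The order of the image of a vector gives a multiple in the kernel, so the kernel
  is a full-rank sublattice and again free of rank \<open>n\<close>.\<close>

lemma A_iso_Zpow:
  assumes iso: "vgroup Y v0 \<cong> Zpow n" and inj: "inj_on (vertex_elem v0) (carrier (vgroup Y v0))"
  shows "PG\<lparr>carrier := A\<rparr> \<cong> Zpow n"
proof -
  interpret G0: group "vgroup Y v0" by (rule group_vgroup[OF v0])
  have "int_vec_group n \<cong> vgroup Y v0"
    using iso_trans[OF int_vec_group_iso_Zpow group.iso_sym[OF G0.is_group iso]] .
  then obtain \<alpha> where \<alpha>: "\<alpha> \<in> hom (int_vec_group n) (vgroup Y v0)" "bij_betw \<alpha> (int_vec n) (carrier (vgroup Y v0))"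
    by (auto simp: is_iso_def iso_def)
  define \<beta> where "\<beta> = vertex_elem v0 \<circ> \<alpha>"
  have \<beta>: "\<beta> \<in> hom (int_vec_group n) PG" unfolding \<beta>_def by (rule hom_compose[OF \<alpha>(1) vertex_elem_hom[OF v0]])
  have \<beta>_inj: "inj_on \<beta> (int_vec n)" unfolding \<beta>_def
    using comp_inj_on[of \<alpha> "int_vec n" "vertex_elem v0"] \<alpha>(2) inj by (simp add: bij_betw_def)
  have \<rho>\<beta>: "\<rho> \<circ> \<beta> \<in> hom (int_vec_group n) Q" by (rule hom_compose[OF \<beta> \<rho>_hom])
  interpret \<rho>\<beta>: group_hom "int_vec_group n" Q "\<rho> \<circ> \<beta>"
    using \<rho>\<beta> group_int_vec_group group_Q by (simp add: group_hom_def group_hom_axioms_def)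
  define C where "C = {z \<in> int_vec n. \<rho> (\<beta> z) = \<one>\<^bsub>Q\<^esub>}"
  have "subgroup C (int_vec_group n)" using \<rho>\<beta>.subgroup_kernel by (simp add: C_def kernel_def)
  then have C: "int_lattice C" "C \<subseteq> int_vec n" by (simp_all add: subgroup_int_vec_iff)
  have "\<exists>m>0. scale m z \<in> C" if z: "z \<in> int_vec n" for z
  proof -
    let ?k = "Q.ord ((\<rho> \<circ> \<beta>) z)"
    have q: "(\<rho> \<circ> \<beta>) z \<in> carrier Q" using \<rho>\<beta>.hom_closed z by simp
    have "(\<rho> \<circ> \<beta>) (scale (int ?k) z) = \<one>\<^bsub>Q\<^esub>"
      unfolding additive_scale_pow[OF group_Q \<rho>\<beta> z] by (rule Q.pow_ord_eq_1[OF q])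
    moreover have "scale (int ?k) z \<in> int_vec n" using z by (rule int_vec_closed)
    moreover have "?k > 0" using Q.ord_ge_1[OF finite_Q q] by simp
    ultimately show ?thesis by (intro exI[of _ "int ?k"]) (simp add: C_def)
  qed
  from int_lattice_basis[OF C this] obtain \<iota> where \<iota>: "bij_betw \<iota> (int_vec n) C"
    "\<And>x y. x \<in> int_vec n \<Longrightarrow> y \<in> int_vec n \<Longrightarrow> \<iota> (x + y) = \<iota> x + \<iota> y" by blast
  have img: "\<beta> ` C = A"
  proof -
    have "A = {vertex_elem v0 g | g. g \<in> \<alpha> ` int_vec n \<and> \<rho> (vertex_elem v0 g) = \<one>\<^bsub>Q\<^esub>}"
      using \<alpha>(2) by (simp add: A_def vertex_kernel_def bij_betw_def)
    then show ?thesis by (auto simp: C_def \<beta>_def)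
  qed
  have "\<beta> \<circ> \<iota> \<in> iso (int_vec_group n) (PG\<lparr>carrier := A\<rparr>)"
  proof (rule isoI)
    have \<iota>C: "\<iota> x \<in> C" "\<iota> x \<in> int_vec n" if "x \<in> int_vec n" for x
      using \<iota>(1) C(2) that by (auto simp: bij_betw_def)
    show "\<beta> \<circ> \<iota> \<in> hom (int_vec_group n) (PG\<lparr>carrier := A\<rparr>)"
    proof (rule homI)
      show "(\<beta> \<circ> \<iota>) x \<in> carrier (PG\<lparr>carrier := A\<rparr>)" if "x \<in> carrier (int_vec_group n)" for x
        using \<iota>C(1) that img by auto
      show "(\<beta> \<circ> \<iota>) (x \<otimes>\<^bsub>int_vec_group n\<^esub> y) = (\<beta> \<circ> \<iota>) x \<otimes>\<^bsub>PG\<lparr>carrier := A\<rparr>\<^esub> (\<beta> \<circ> \<iota>) y"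
        if "x \<in> carrier (int_vec_group n)" "y \<in> carrier (int_vec_group n)" for x y
        using that \<iota>(2)[of x y] \<iota>C(2)[of x] \<iota>C(2)[of y] hom_mult[OF \<beta>, of "\<iota> x" "\<iota> y"] by simp
    qed
    have "bij_betw \<beta> C A" using inj_on_subset[OF \<beta>_inj C(2)] img by (simp add: bij_betw_def)
    then show "bij_betw (\<beta> \<circ> \<iota>) (carrier (int_vec_group n)) (carrier (PG\<lparr>carrier := A\<rparr>))"
      using bij_betw_trans[OF \<iota>(1)] by simp
  qed
  then have "int_vec_group n \<cong> PG\<lparr>carrier := A\<rparr>" by (auto simp: is_iso_def)
  then show ?thesis using iso_trans[OF group.iso_sym[OF group_int_vec_group] int_vec_group_iso_Zpow] by blast
qed

end

section \<open>Subgroup separable GBS groups\<close>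

text \<open>In coordinates \<open>i\<close> becomes an injective additive endomorphism
  \<open>f\<close> of the integer vectors. Its cokernel is torsion, a uniform exponent exists, and
  so the image has finite index. The second claim transports the unit vectors.\<close>

lemma finite_index_injective_Zpow:
  assumes "group W" "group K" and W: "W \<cong> Zpow n" and K: "K \<cong> Zpow n"
    and i: "i \<in> hom K W" "inj_on i (carrier K)"
  shows "finite_index_subgroup (i ` carrier K) W"
    "\<exists>T. finite T \<and> T \<subseteq> carrier K \<and> generate K T = carrier K"
proof -
  interpret W: group W by fact
  interpret K: group K by fact
  interpret Z: group "int_vec_group n" by (rule group_int_vec_group)
  have "int_vec_group n \<cong> W" "int_vec_group n \<cong> K"
    using iso_trans[OF int_vec_group_iso_Zpow W.iso_sym[OF W]] iso_trans[OF int_vec_group_iso_Zpow K.iso_sym[OF K]] by auto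
  then obtain \<alpha> \<beta> where iso: "\<alpha> \<in> iso (int_vec_group n) W" "\<beta> \<in> iso (int_vec_group n) K"
    by (auto simp: is_iso_def)
  have \<alpha>: "\<alpha> \<in> hom (int_vec_group n) W" "bij_betw \<alpha> (int_vec n) (carrier W)"
    and \<beta>: "\<beta> \<in> hom (int_vec_group n) K" "bij_betw \<beta> (int_vec n) (carrier K)"
    using iso by (auto simp: iso_def)
  define \<gamma> where "\<gamma> = inv_into (int_vec n) \<alpha>"
  have \<gamma>: "\<gamma> \<in> hom W (int_vec_group n)"
    using Z.iso_set_sym[OF iso(1)] by (simp add: \<gamma>_def iso_def)
  have \<gamma>_bij: "bij_betw \<gamma> (carrier W) (int_vec n)" unfolding \<gamma>_def by (rule bij_betw_inv_into[OF \<alpha>(2)])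
  define f where "f = \<gamma> \<circ> (i \<circ> \<beta>)"
  have f: "f \<in> hom (int_vec_group n) (int_vec_group n)" unfolding f_def
    by (rule hom_compose[OF hom_compose[OF \<beta>(1) i(1)] \<gamma>])
  interpret f: group_hom "int_vec_group n" "int_vec_group n" f using f by unfold_locales
  have i_carrier: "i ` carrier K \<subseteq> carrier W" using i(1) by (auto simp: hom_def)
  have \<beta>_img: "\<beta> ` int_vec n = carrier K" using \<beta>(2) by (simp add: bij_betw_def)
  have f_inj: "inj_on f (int_vec n)"
  proof -
    have "inj_on \<gamma> (i ` \<beta> ` int_vec n)" unfolding \<beta>_img
      using \<gamma>_bij i_carrier by (meson bij_betw_def inj_on_subset)
    moreover have "inj_on i (\<beta> ` int_vec n)" unfolding \<beta>_img by (rule i(2))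
    moreover have "inj_on \<beta> (int_vec n)" using \<beta>(2) by (simp add: bij_betw_def)
    ultimately show ?thesis unfolding f_def by (intro comp_inj_on) (simp_all add: image_comp)
  qed
  define C where "C = f ` int_vec n"
  have C: "subgroup C (int_vec_group n)" unfolding C_def using f.img_is_subgroup by simp
  have f_fun: "f \<in> int_vec n \<rightarrow> int_vec n" using f.hom_closed by auto
  have f_add: "f (x + y) = f x + f y" if "x \<in> int_vec n" "y \<in> int_vec n" for x y
    using f.hom_mult[of x y] that by simp
  have "\<exists>m>0. scale m z \<in> C" if z: "z \<in> int_vec n" for z
    unfolding C_def using injective_additive_torsion[OF f_fun f_inj f_add z] .
  then obtain m where m: "m > 0" "\<And>z. z \<in> int_vec n \<Longrightarrow> scale m z \<in> C"
    using int_lattice_exponent[of C n] C by (auto simp: subgroup_int_vec_iff)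
  from W.finite_index_vimage[OF \<gamma> group_int_vec_group finite_index_int_lattice[OF C m]]
  have "finite_index_subgroup {x \<in> carrier W. \<gamma> x \<in> C} W" .
  moreover have "{x \<in> carrier W. \<gamma> x \<in> C} = i ` carrier K"
  proof -
    have "C = \<gamma> ` i ` carrier K" unfolding C_def f_def image_comp[symmetric] \<beta>_img ..
    then show ?thesis using \<gamma>_bij i_carrier unfolding bij_betw_def inj_on_def by blast
  qed
  ultimately show "finite_index_subgroup (i ` carrier K) W" by simp
  interpret \<beta>: group_hom "int_vec_group n" K \<beta> using \<beta>(1) by unfold_locales
  have "generate K (\<beta> ` unit_vec ` {..<n}) = carrier K"
    using \<beta>.generate_img[of "unit_vec ` {..<n}"] unfolding generate_unit_vecs \<beta>_img by auto
  moreover have "\<beta> ` unit_vec ` {..<n} \<subseteq> carrier K" using \<beta>.hom_closed by auto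
  ultimately show "\<exists>T. finite T \<and> T \<subseteq> carrier K \<and> generate K T = carrier K"
    by (intro exI[of _ "\<beta> ` unit_vec ` {..<n}"]) simp
qed

text \<open>The image of \<open>K\<close> is finitely generated, so its image in \<open>G\<close> is
  separable. As it has finite index in \<open>W\<close>, only finitely many of its cosets in
  \<open>W\<close> have to be kept out, one finite-index subgroup of \<open>G\<close> for
  each.\<close>

lemma (in group) finite_index_detects_subgroup:
  assumes LERF: "subgroup_separable G" and "group W" "group K" and W: "W \<cong> Zpow n" and K: "K \<cong> Zpow n"
    and i: "i \<in> hom K W" "inj_on i (carrier K)" and \<phi>: "\<phi> \<in> hom W G" "inj_on \<phi> (carrier W)"
  shows "\<exists>U. finite_index_subgroup U G \<and> (\<forall>g\<in>carrier W. \<phi> g \<in> U \<longrightarrow> g \<in> i ` carrier K)"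
proof -
  interpret W: group W by fact
  interpret K: group K by fact
  interpret i: group_hom K W i using i(1) by unfold_locales
  interpret \<phi>: group_hom W G \<phi> using \<phi>(1) by unfold_locales
  interpret \<phi>i: group_hom K G "\<phi> \<circ> i" using Group.hom_compose[OF i(1) \<phi>(1)] by unfold_locales
  define J where "J = i ` carrier K"
  have J: "finite_index_subgroup J W" unfolding J_def
    by (rule finite_index_injective_Zpow(1)[OF \<open>group W\<close> \<open>group K\<close> W K i])
  note J' = W.finite_index_subgroupD[OF J]
  have J_sub: "J \<subseteq> carrier W" using J'(1) by (rule subgroup.subset)
  obtain T where T: "finite T" "T \<subseteq> carrier K" "generate K T = carrier K"
    using finite_index_injective_Zpow(2)[OF \<open>group W\<close> \<open>group K\<close> W K i] by blast
  have "generate G ((\<phi> \<circ> i) ` T) = \<phi> ` J"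
    using \<phi>i.generate_img[OF T(2)] T(3) by (simp add: J_def image_comp)
  moreover have "finite ((\<phi> \<circ> i) ` T)" "(\<phi> \<circ> i) ` T \<subseteq> carrier G"
    using T(1) T(2) \<phi>i.hom_closed by blast+
  ultimately have sep: "separable_subgroup (\<phi> ` J) G"
    using LERF unfolding subgroup_separable_def by metis
  \<comment> \<open>Representatives of all cosets of \<open>J\<close> other than \<open>J\<close>
    itself. Excluding \<open>\<phi> r\<close> excludes the whole coset, because \<open>U r\<close>
    contains the image of \<open>J\<close>.\<close>
  obtain R where R: "R \<subseteq> carrier W - J" "finite R" "(\<lambda>x. J #>\<^bsub>W\<^esub> x) ` (carrier W - J) = (\<lambda>x. J #>\<^bsub>W\<^esub> x) ` R"
    using finite_subset_image[of "(\<lambda>x. J #>\<^bsub>W\<^esub> x) ` (carrier W - J)" "\<lambda>x. J #>\<^bsub>W\<^esub> x" "carrier W - J"]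
      finite_subset[OF image_mono[of "carrier W - J" "carrier W"] J'(2)] by blast
  have "\<exists>U. finite_index_subgroup U G \<and> \<phi> ` J \<subseteq> U \<and> \<phi> r \<notin> U" if r: "r \<in> R" for r
  proof -
    have r': "r \<in> carrier W" "r \<notin> J" using r R(1) by auto
    have "\<phi> r \<notin> \<phi> ` J" using \<phi>(2) r' J_sub by (auto simp: inj_on_def)
    then show ?thesis using sep \<phi>.hom_closed[OF r'(1)] unfolding separable_subgroup_iff by blast
  qed
  then obtain U where U: "\<And>r. r \<in> R \<Longrightarrow> finite_index_subgroup (U r) G" "\<And>r. r \<in> R \<Longrightarrow> \<phi> ` J \<subseteq> U r"
    "\<And>r. r \<in> R \<Longrightarrow> \<phi> r \<notin> U r" by metis
  define U0 where "U0 = carrier G \<inter> (\<Inter>r\<in>R. U r)"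
  have "finite_index_subgroup U0 G" unfolding U0_def by (rule finite_index_INT[OF R(2) U(1)])
  moreover have "g \<in> J" if g: "g \<in> carrier W" "\<phi> g \<in> U0" for g
  proof (rule ccontr)
    assume "g \<notin> J"
    then have "J #>\<^bsub>W\<^esub> g \<in> (\<lambda>x. J #>\<^bsub>W\<^esub> x) ` R" using g(1) R(3) by blast
    then obtain r where r: "r \<in> R" "J #>\<^bsub>W\<^esub> g = J #>\<^bsub>W\<^esub> r" by blast
    have rW: "r \<in> carrier W" using r(1) R(1) by blast
    have "g \<otimes>\<^bsub>W\<^esub> inv\<^bsub>W\<^esub> r \<in> J" by (rule W.r_coset_eqD[OF J'(1) g(1) rW r(2)])
    then have 1: "\<phi> (g \<otimes>\<^bsub>W\<^esub> inv\<^bsub>W\<^esub> r) \<in> U r" using U(2)[OF r(1)] by blast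
    interpret Ur: subgroup "U r" G by (rule finite_index_subgroupD(1)[OF U(1)[OF r(1)]])
    have 2: "\<phi> g \<in> U r" using g(2) r(1) by (auto simp: U0_def)
    have "inv (\<phi> (g \<otimes>\<^bsub>W\<^esub> inv\<^bsub>W\<^esub> r)) \<otimes> \<phi> g \<in> U r" by (rule Ur.m_closed[OF Ur.m_inv_closed[OF 1] 2])
    moreover have "inv (\<phi> (g \<otimes>\<^bsub>W\<^esub> inv\<^bsub>W\<^esub> r)) \<otimes> \<phi> g = \<phi> r"
      using g(1) rW \<phi>.hom_closed by (simp add: inv_mult_group m_assoc)
    ultimately show False using U(3)[OF r(1)] by simp
  qed
  ultimately show ?thesis unfolding J_def by blast
qed

lemma countable_Zpow:
  assumes "W \<cong> Zpow n" shows "countable (carrier W)"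
proof -
  obtain f where "bij_betw f (carrier W) (carrier (Zpow n))" using assms by (auto simp: is_iso_def iso_def)
  moreover have "inj_on (\<lambda>x. map x [0..<n]) (carrier (Zpow n))"
    by (rule inj_onI, rule PiE_ext[of _ "{..<n}" "\<lambda>_. UNIV"]) (auto simp: Zpow_def)
  then have "countable (carrier (Zpow n))"
    by (rule countable_image_inj_on[rotated]) (rule countableI_type)
  ultimately show ?thesis using bij_betw_def countable_image_inj_on by metis
qed

context graph_of_groups
begin

text \<open>Conjugating along chosen paths \<open>p v\<close> from \<open>v0\<close> to \<open>v\<close> gives a homomorphism from the path
  group to the fundamental group.\<close>

lemma retraction:
  assumes p: "\<And>v. v \<in> V \<Longrightarrow> p v \<in> paths v0 v" and v0: "v0 \<in> V"
  obtains r where "r \<in> hom PG (fundamental_group Y v0)"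
    "\<And>v g. v \<in> V \<Longrightarrow> g \<in> carrier (vgroup Y v) \<Longrightarrow>
      r (vertex_elem v g) = p v \<otimes>\<^bsub>PG\<^esub> vertex_elem v g \<otimes>\<^bsub>PG\<^esub> inv\<^bsub>PG\<^esub> p v"
proof -
  let ?G = "fundamental_group Y v0"
  have G: "group ?G" unfolding fundamental_group_eq
    by (rule subgroup.subgroup_is_group[OF subgroup_paths[OF v0] group_path_group])
  have pc: "p v \<in> carrier PG" if "v \<in> V" for v using p[OF that] by (rule paths_closed)
  let ?f = "\<lambda>v g. p v \<otimes>\<^bsub>PG\<^esub> vertex_elem v g \<otimes>\<^bsub>PG\<^esub> inv\<^bsub>PG\<^esub> p v"
  let ?t = "\<lambda>e. p (src e) \<otimes>\<^bsub>PG\<^esub> arc_elem e \<otimes>\<^bsub>PG\<^esub> inv\<^bsub>PG\<^esub> p (tgt e)"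
  have cancel: "inv\<^bsub>PG\<^esub> p v \<otimes>\<^bsub>PG\<^esub> (p v \<otimes>\<^bsub>PG\<^esub> z) = z" if "v \<in> V" "z \<in> carrier PG" for v z
    using pc[OF that(1)] that(2) by (simp add: PG.m_assoc[symmetric])
  have f: "?f v \<in> hom (vgroup Y v) ?G" if v: "v \<in> V" for v
  proof (rule homI)
    fix g assume g: "g \<in> carrier (vgroup Y v)"
    show "?f v g \<in> carrier ?G" unfolding fundamental_group_eq
      using paths_mult[OF paths_inv[OF p[OF v]] paths_vertex[OF p[OF v] g]] by simp
  next
    fix g h assume gh: "g \<in> carrier (vgroup Y v)" "h \<in> carrier (vgroup Y v)"
    then show "?f v (g \<otimes>\<^bsub>vgroup Y v\<^esub> h) = ?f v g \<otimes>\<^bsub>?G\<^esub> ?f v h"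
      using v pc[OF v] cancel[OF v] by (simp add: fundamental_group_eq vertex_elem_mult PG.m_assoc)
  qed
  have t: "?t e \<in> carrier ?G" if e: "e \<in> E" for e
    unfolding fundamental_group_eq
    using paths_mult[OF paths_inv[OF p[of "tgt e"]] paths_arc[OF p[of "src e"] e]] e by simp
  have rel: "?t e \<otimes>\<^bsub>?G\<^esub> ?f (tgt e) (head_emb Y e a) = ?f (src e) (tail_emb Y e a) \<otimes>\<^bsub>?G\<^esub> ?t e"
    if e: "e \<in> E" and a: "a \<in> carrier (egroup Y e)" for e a
  proof -
    have c: "vertex_elem (tgt e) (head_emb Y e a) \<in> carrier PG" "vertex_elem (src e) (tail_emb Y e a) \<in> carrier PG"
      "arc_elem e \<in> carrier PG" "p (src e) \<in> carrier PG" "p (tgt e) \<in> carrier PG" using e a pc by auto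
    have "?t e \<otimes>\<^bsub>PG\<^esub> ?f (tgt e) (head_emb Y e a) =
        p (src e) \<otimes>\<^bsub>PG\<^esub> (arc_elem e \<otimes>\<^bsub>PG\<^esub> vertex_elem (tgt e) (head_emb Y e a)) \<otimes>\<^bsub>PG\<^esub> inv\<^bsub>PG\<^esub> p (tgt e)"
      using c cancel[of "tgt e"] e by (simp add: PG.m_assoc)
    also have "\<dots> = ?f (src e) (tail_emb Y e a) \<otimes>\<^bsub>PG\<^esub> ?t e"
      unfolding arc_relation[OF e a] using c cancel[of "src e"] e by (simp add: PG.m_assoc)
    finally show ?thesis by (simp add: fundamental_group_eq)
  qed
  show ?thesis
  proof (rule path_group_hom[OF G, of ?f ?t])
    fix h assume "h \<in> hom PG ?G" "\<And>v g. v \<in> V \<Longrightarrow> g \<in> carrier (vgroup Y v) \<Longrightarrow> h (vertex_elem v g) = ?f v g"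
    then show thesis by (rule that)
  qed (use f t rel in auto)
qed

text \<open>Subgroups detecting both ends of every arc are intersected, which preserves finite index
  since the graph is finite, and replaced by a normal core \<open>N\<close>. Vertex groups are
  viewed in the fundamental group through conjugation along \<open>p v\<close>, which keeps their
  embeddings injective.\<close>

theorem Zpow_by_free_of_subgroup_separable:
  assumes fin: "finite V" "finite E" and conn: "Digraph_Component.connected (base_graph Y)"
    and vg: "\<And>v. v \<in> V \<Longrightarrow> vgroup Y v \<cong> Zpow n" and eg: "\<And>e. e \<in> E \<Longrightarrow> egroup Y e \<cong> Zpow n"
    and v0: "v0 \<in> V" and LERF: "subgroup_separable (fundamental_group Y v0)"
  shows "\<exists>L A (S :: nat set) \<theta>. finite_index_subgroup L (fundamental_group Y v0) \<and>
    \<theta> \<in> hom ((fundamental_group Y v0)\<lparr>carrier := L\<rparr>) (free_group S) \<and> \<theta> ` L = carrier (free_group S) \<and>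
    A = {x \<in> L. \<theta> x = \<one>\<^bsub>free_group S\<^esub>} \<and> (fundamental_group Y v0)\<lparr>carrier := A\<rparr> \<cong> Zpow n"
proof -
  let ?G = "fundamental_group Y v0"
  have "\<forall>v\<in>V. \<exists>x. x \<in> paths v0 v" using paths_connected[OF conn v0] by blast
  then obtain p where p: "\<And>v. v \<in> V \<Longrightarrow> p v \<in> paths v0 v" by metis
  have pc: "p v \<in> carrier PG" if "v \<in> V" for v using p[OF that] by (rule paths_closed)
  obtain r where r: "r \<in> hom PG ?G" "\<And>v g. v \<in> V \<Longrightarrow> g \<in> carrier (vgroup Y v) \<Longrightarrow>
      r (vertex_elem v g) = p v \<otimes>\<^bsub>PG\<^esub> vertex_elem v g \<otimes>\<^bsub>PG\<^esub> inv\<^bsub>PG\<^esub> p v"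
    by (rule retraction[of p v0]) (erule p, rule v0, rule that)
  interpret G: group ?G unfolding fundamental_group_eq
    by (rule subgroup.subgroup_is_group[OF subgroup_paths[OF v0] group_path_group])
  define \<phi> where "\<phi> v = r \<circ> vertex_elem v" for v
  have \<phi>: "\<phi> v \<in> hom (vgroup Y v) ?G" if "v \<in> V" for v
    unfolding \<phi>_def by (rule hom_compose[OF vertex_elem_hom[OF that] r(1)])
  have inj: "inj_on (vertex_elem v) (carrier (vgroup Y v))" if "v \<in> V" for v
    using vertex_elem_inj[OF countable_Zpow[OF vg] that] .
  have \<phi>_inj: "inj_on (\<phi> v) (carrier (vgroup Y v))" if v: "v \<in> V" for v
  proof (rule inj_onI)
    fix g h assume gh: "g \<in> carrier (vgroup Y v)" "h \<in> carrier (vgroup Y v)" "\<phi> v g = \<phi> v h"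
    then have "p v \<otimes>\<^bsub>PG\<^esub> vertex_elem v g \<otimes>\<^bsub>PG\<^esub> inv\<^bsub>PG\<^esub> p v = p v \<otimes>\<^bsub>PG\<^esub> vertex_elem v h \<otimes>\<^bsub>PG\<^esub> inv\<^bsub>PG\<^esub> p v"
      using r(2)[OF v] by (simp add: \<phi>_def)
    then have "vertex_elem v g = vertex_elem v h" using gh v pc[OF v] by simp
    then show "g = h" using inj[OF v] gh by (simp add: inj_on_def)
  qed
  have "\<exists>U. finite_index_subgroup U ?G \<and> (\<forall>g\<in>carrier (vgroup Y (src e)). \<phi> (src e) g \<in> U \<longrightarrow> g \<in> tail_emb Y e ` carrier (egroup Y e))"
    if e: "e \<in> E" for e
    using G.finite_index_detects_subgroup[OF LERF group_vgroup group_egroup[OF e] vg eg[OF e] emb_hom(1,3)[OF e] \<phi> \<phi>_inj] e by blast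
  then obtain Ut where Ut: "\<And>e. e \<in> E \<Longrightarrow> finite_index_subgroup (Ut e) ?G"
    "\<And>e g. e \<in> E \<Longrightarrow> g \<in> carrier (vgroup Y (src e)) \<Longrightarrow> \<phi> (src e) g \<in> Ut e \<Longrightarrow> g \<in> tail_emb Y e ` carrier (egroup Y e)"
    by metis
  have "\<exists>U. finite_index_subgroup U ?G \<and> (\<forall>g\<in>carrier (vgroup Y (tgt e)). \<phi> (tgt e) g \<in> U \<longrightarrow> g \<in> head_emb Y e ` carrier (egroup Y e))"
    if e: "e \<in> E" for e
    using G.finite_index_detects_subgroup[OF LERF group_vgroup group_egroup[OF e] vg eg[OF e] emb_hom(2,4)[OF e] \<phi> \<phi>_inj] e by blast
  then obtain Uh where Uh: "\<And>e. e \<in> E \<Longrightarrow> finite_index_subgroup (Uh e) ?G"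
    "\<And>e g. e \<in> E \<Longrightarrow> g \<in> carrier (vgroup Y (tgt e)) \<Longrightarrow> \<phi> (tgt e) g \<in> Uh e \<Longrightarrow> g \<in> head_emb Y e ` carrier (egroup Y e)"
    by metis
  have "finite_index_subgroup (carrier ?G \<inter> (\<Inter>e\<in>E. Ut e \<inter> Uh e)) ?G"
    by (rule G.finite_index_INT[OF fin(2)]) (rule G.finite_index_Int[OF Ut(1) Uh(1)])
  then obtain N where N: "N \<lhd> ?G" "finite_index_subgroup N ?G" "N \<subseteq> carrier ?G \<inter> (\<Inter>e\<in>E. Ut e \<inter> Uh e)"
    by (rule G.finite_index_core)
  interpret N: normal N ?G by (rule N(1))
  define Q where "Q = ?G Mod N"
  \<comment> \<open>The finite quotient is extended to the path group through the retraction: a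
    vertex group element is killed exactly when its conjugate along \<open>p v\<close> lies in
    \<open>N\<close>.\<close>
  define \<rho> where "\<rho> = (\<lambda>x. N #>\<^bsub>?G\<^esub> x) \<circ> r"
  have Q: "group Q" unfolding Q_def by (rule N.factorgroup_is_group)
  have finQ: "finite (carrier Q)" using N(2) by (simp add: Q_def finite_index_subgroup_def FactGroup_def)
  have \<rho>: "\<rho> \<in> hom PG Q" unfolding \<rho>_def Q_def by (rule hom_compose[OF r(1) N.r_coset_hom_Mod])
  have ker: "\<phi> v g \<in> N" if v: "v \<in> V" and g: "g \<in> carrier (vgroup Y v)" and "\<rho> (vertex_elem v g) = \<one>\<^bsub>Q\<^esub>" for v g
  proof -
    have "\<phi> v g \<in> carrier ?G" using \<phi>[OF v] g by (auto simp: hom_def)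
    moreover have "N #>\<^bsub>?G\<^esub> \<phi> v g = N" using that(3) by (simp add: \<rho>_def Q_def \<phi>_def)
    ultimately show ?thesis using G.coset_join1[OF _ _ N.subgroup_axioms] by blast
  qed
  interpret Q: group Q by (rule Q)
  interpret finite_quotient Y v0 Q \<rho>
  proof unfold_locales
    show "g \<in> tail_emb Y e ` carrier (egroup Y e)"
      if "e \<in> E" "g \<in> carrier (vgroup Y (src e))" "\<rho> (vertex_elem (src e) g) = \<one>\<^bsub>Q\<^esub>" for e g
      by (rule Ut(2)[OF that(1,2)]) (use ker[OF _ that(2,3)] N(3) that(1) in auto)
    show "g \<in> head_emb Y e ` carrier (egroup Y e)"
      if "e \<in> E" "g \<in> carrier (vgroup Y (tgt e))" "\<rho> (vertex_elem (tgt e) g) = \<one>\<^bsub>Q\<^esub>" for e g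
      by (rule Uh(2)[OF that(1,2)]) (use ker[OF _ that(2,3)] N(3) that(1) in auto)
  qed (use v0 fin finQ \<rho> in auto)
  obtain S :: "nat set" and \<theta> where \<theta>: "\<theta> \<in> hom (PG\<lparr>carrier := L\<rparr>) (free_group S)" "\<theta> ` L = carrier (free_group S)"
    "\<forall>x\<in>L. \<theta> x = \<one>\<^bsub>free_group S\<^esub> \<longleftrightarrow> x \<in> A" using free_quotient by (elim exE conjE) (rule that)
  have "A = {x \<in> L. \<theta> x = \<one>\<^bsub>free_group S\<^esub>}" using \<theta>(3) A_subset_L by auto
  moreover have "?G\<lparr>carrier := A\<rparr> \<cong> Zpow n"
    using A_iso_Zpow[OF vg[OF v0] inj[OF v0]] by (simp add: fundamental_group_eq)
  moreover have "finite_index_subgroup L ?G" using finite_index_L by (simp add: fundamental_group_eq)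
  moreover have "\<theta> \<in> hom (?G\<lparr>carrier := L\<rparr>) (free_group S)" using \<theta>(1) by (simp add: fundamental_group_eq)
  ultimately show ?thesis using \<theta>(2)
    by - (rule exI[of _ L], rule exI[of _ A], rule exI[of _ S], rule exI[of _ \<theta>], intro conjI)
qed

end

text \<open>Renaming of the basis, needed because \<open>is_free_group\<close> asks for a basis in
  the element type of the group, while the basis constructed above consists of natural
  numbers.\<close>

lemma free_group_image_iso:
  assumes j: "inj_on j S" shows "free_group S \<cong> free_group (j ` S)"
proof -
  let ?F = "free_group S" and ?F' = "free_group (j ` S)"
  interpret F: group ?F by (rule group_presented_group)
  interpret F': group ?F' by (rule group_presented_group)
  let ?g = "\<lambda>s. word_class S {} [(s, True)]" and ?g' = "\<lambda>s. word_class (j ` S) {} [(s, True)]"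
  have g: "?g s \<in> carrier ?F" if "s \<in> S" for s by (rule word_class_in_carrier) (use that in simp)
  have g': "?g' (j s) \<in> carrier ?F'" if "s \<in> S" for s by (rule word_class_in_carrier) (use that in simp)
  have "(\<lambda>s. ?g' (j s)) \<in> S \<rightarrow> carrier ?F'" using g' by (rule Pi_I)
  then obtain h where h: "h \<in> hom ?F ?F'" "\<And>w. w \<in> words S \<Longrightarrow> h (word_class S {} w) = eval_word ?F' (\<lambda>s. ?g' (j s)) w"
    "\<And>s. s \<in> S \<Longrightarrow> h (?g s) = ?g' (j s)"
    by (rule F'.presented_group_hom) (erule emptyE, rule that)
  let ?k = "\<lambda>t. ?g (inv_into S j t)"
  have "?k \<in> j ` S \<rightarrow> carrier ?F" by (rule Pi_I) (use g inv_into_into[of _ j S] in blast)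
  then obtain h' where h': "h' \<in> hom ?F' ?F" "\<And>w. w \<in> words (j ` S) \<Longrightarrow> h' (word_class (j ` S) {} w) = eval_word ?F ?k w"
    "\<And>t. t \<in> j ` S \<Longrightarrow> h' (?g' t) = ?k t"
    by (rule F.presented_group_hom) (erule emptyE, rule that)
  have h'_g: "h' (?g' (j s)) = ?g s" if "s \<in> S" for s
    using h'(3)[of "j s"] inv_into_f_f[OF j that] that by simp
  have id: "(\<lambda>x. x) \<in> hom K K" for K :: "('x, 'y) monoid_scheme" by (simp add: hom_def)
  have "(h' \<circ> h) x = x" if "x \<in> carrier ?F" for x
    by (rule F.presented_group_hom_eq[OF hom_compose[OF h(1) h'(1)] id _ that]) (simp add: h(3) h'_g)
  moreover have "(h \<circ> h') x = x" if "x \<in> carrier ?F'" for x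
  proof (rule F'.presented_group_hom_eq[OF hom_compose[OF h'(1) h(1)] id _ that])
    fix t assume "t \<in> j ` S"
    then obtain s where "s \<in> S" "t = j s" by blast
    then show "(h \<circ> h') (?g' t) = ?g' t" using h'_g h(3) by simp
  qed
  ultimately have "bij_betw h (carrier ?F) (carrier ?F')"
    using h(1) h'(1) by (intro bij_betwI[where g = h']) (auto simp: hom_def)
  then have "h \<in> iso ?F ?F'" using h(1) by (simp add: iso_def)
  then show ?thesis by (auto simp: is_iso_def)
qed

text \<open>Constant vectors already give infinitely many elements when there is a coordinate. This
  provides the room for renaming the basis.\<close>

lemma infinite_Zpow:
  assumes "n \<ge> 1" "W \<cong> Zpow n" shows "infinite (carrier W)"
proof -
  obtain f where "bij_betw f (carrier W) (carrier (Zpow n))" using assms(2) by (auto simp: is_iso_def iso_def)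
  moreover have "infinite (carrier (Zpow n))"
  proof -
    have "inj (\<lambda>k :: int. \<lambda>i\<in>{..<n}. k)"
    proof (rule injI)
      fix k l :: int assume "(\<lambda>i\<in>{..<n}. k) = (\<lambda>i\<in>{..<n}. l)"
      from fun_cong[OF this, of 0] show "k = l" using assms(1) by simp
    qed
    moreover have "range (\<lambda>k :: int. \<lambda>i\<in>{..<n}. k) \<subseteq> carrier (Zpow n)" by (auto simp: Zpow_def split: if_splits)
    ultimately show ?thesis using infinite_UNIV_int finite_imageD finite_subset by blast
  qed
  ultimately show ?thesis using bij_betw_finite by blast
qed

theorem virtually_Zpow_by_free_if_subgroup_separable:
  fixes G :: "'a monoid" and n :: nat
  assumes n: "n \<ge> 1" and GBS: "GBS_group n G" and sep: "subgroup_separable G"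
  shows "virtually_Zpow_by_free n G"
proof -
  have G: "group G" using GBS by (simp add: GBS_group_def)
  obtain Y :: "(nat, nat, nat \<Rightarrow> int, nat \<Rightarrow> int) gog" and v0 where
    Y: "graph_of_groups Y" "fin_digraph (base_graph Y)" "Digraph_Component.connected (base_graph Y)"
      "\<And>u. u \<in> verts (base_graph Y) \<Longrightarrow> vgroup Y u \<cong> Zpow n"
      "\<And>e. e \<in> arcs (base_graph Y) \<Longrightarrow> egroup Y e \<cong> Zpow n"
      "v0 \<in> verts (base_graph Y)" "G \<cong> fundamental_group Y v0"
    using GBS unfolding GBS_group_def by blast
  interpret G: group G by (rule G)
  interpret Y: graph_of_groups Y by (rule Y(1))
  let ?P = "fundamental_group Y v0"
  have P: "group ?P" unfolding Y.fundamental_group_eq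
    by (rule subgroup.subgroup_is_group[OF Y.subgroup_paths[OF Y(6)] Y.group_path_group])
  obtain \<phi> where iso: "\<phi> \<in> iso G ?P" using Y(7) by (auto simp: is_iso_def)
  have \<phi>: "\<phi> \<in> hom G ?P" "bij_betw \<phi> (carrier G) (carrier ?P)" using iso by (auto simp: iso_def)
  have sepP: "subgroup_separable ?P"
    by (rule subgroup_separable_iso[OF G P G.iso_set_sym[OF iso] sep])
  have finY: "finite (verts (base_graph Y))" "finite (arcs (base_graph Y))"
    using Y(2) by (auto simp: fin_digraph_def fin_digraph_axioms_def)
  have "\<exists>L A (S :: nat set) \<theta>. finite_index_subgroup L ?P \<and>
    \<theta> \<in> hom (?P\<lparr>carrier := L\<rparr>) (free_group S) \<and> \<theta> ` L = carrier (free_group S) \<and>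
    A = {x \<in> L. \<theta> x = \<one>\<^bsub>free_group S\<^esub>} \<and> ?P\<lparr>carrier := A\<rparr> \<cong> Zpow n"
    by (rule Y.Zpow_by_free_of_subgroup_separable[OF finY Y(3) _ _ Y(6) sepP]) (erule Y(4) Y(5))+
  then obtain L A and S :: "nat set" and \<theta> where L: "finite_index_subgroup L ?P"
    and \<theta>: "\<theta> \<in> hom (?P\<lparr>carrier := L\<rparr>) (free_group S)" "\<theta> ` L = carrier (free_group S)"
    and A: "A = {x \<in> L. \<theta> x = \<one>\<^bsub>free_group S\<^esub>}" "?P\<lparr>carrier := A\<rparr> \<cong> Zpow n"
    by (elim exE conjE) (rule that)
  have L_sub: "subgroup L ?P" using L by (simp add: finite_index_subgroup_def)
  define H where "H = {x \<in> carrier G. \<phi> x \<in> L}"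
  have H: "finite_index_subgroup H G" unfolding H_def by (rule G.finite_index_vimage[OF \<phi>(1) P L])
  let ?K = "G\<lparr>carrier := H\<rparr>"
  have K: "group ?K" using H by (simp add: finite_index_subgroup_def G.subgroup_imp_group)
  have \<phi>H: "\<phi> ` H = L"
  proof -
    have "L \<subseteq> \<phi> ` carrier G" using \<phi>(2) subgroup.subset[OF L_sub] by (simp add: bij_betw_def)
    then show ?thesis unfolding H_def by blast
  qed
  have \<phi>_hom: "\<phi> \<in> hom ?K (?P\<lparr>carrier := L\<rparr>)" using \<phi>(1) by (auto simp: hom_def H_def)
  define \<pi> where "\<pi> = \<theta> \<circ> \<phi>"
  have \<pi>: "\<pi> \<in> hom ?K (free_group S)" unfolding \<pi>_def by (rule hom_compose[OF \<phi>_hom \<theta>(1)])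
  have \<pi>_surj: "\<pi> ` carrier ?K = carrier (free_group S)" unfolding \<pi>_def image_comp[symmetric] by (simp add: \<phi>H \<theta>(2))
  interpret \<pi>: group_hom ?K "free_group S" \<pi> using \<pi> K group_presented_group by (simp add: group_hom_def group_hom_axioms_def)
  define B where "B = kernel ?K (free_group S) \<pi>"
  have B: "B \<lhd> ?K" unfolding B_def by (rule \<pi>.normal_kernel)
  have B_eq: "B = {x \<in> H. \<phi> x \<in> A}" unfolding B_def kernel_def A(1) \<pi>_def using \<phi>H by auto
  have "?K\<lparr>carrier := B\<rparr> \<cong> ?P\<lparr>carrier := A\<rparr>"
  proof -
    have "\<phi> ` B = A" unfolding B_eq using \<phi>H A(1) by auto
    moreover have "inj_on \<phi> B" using \<phi>(2) by (auto simp: B_eq H_def bij_betw_def inj_on_def)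
    moreover have "\<phi> \<in> hom (?K\<lparr>carrier := B\<rparr>) (?P\<lparr>carrier := A\<rparr>)"
      using \<phi>(1) by (auto simp: hom_def B_eq H_def)
    ultimately have "\<phi> \<in> iso (?K\<lparr>carrier := B\<rparr>) (?P\<lparr>carrier := A\<rparr>)" by (simp add: iso_def bij_betw_def)
    then show ?thesis by (auto simp: is_iso_def)
  qed
  then have B_Z: "?K\<lparr>carrier := B\<rparr> \<cong> Zpow n" using A(2) by (rule iso_trans)
  \<comment> \<open>Elements of the quotient have type \<open>'a set\<close>, and the numbered basis
    must be injected into this type. Since \<open>n \<ge> 1\<close>, the infinite subgroup
    \<open>B\<close> makes the type \<open>'a\<close> infinite.\<close>
  have "infinite (UNIV :: 'a set set)"
  proof -
    have "infinite (UNIV :: 'a set)"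
      using infinite_Zpow[OF n B_Z] finite_subset[OF subset_UNIV] by blast
    then show ?thesis by (simp add: Finite_Set.finite_set)
  qed
  then obtain j :: "nat \<Rightarrow> 'a set" where j: "inj j" using infinite_countable_subset by blast
  have "free_group S \<cong> free_group (j ` S)" by (rule free_group_image_iso[OF inj_on_subset[OF j subset_UNIV]])
  moreover have "?K Mod B \<cong> free_group S" unfolding B_def using \<pi>.FactGroup_iso_set[OF \<pi>_surj] by (auto simp: is_iso_def)
  ultimately have "?K Mod B \<cong> free_group (j ` S)" using iso_trans by blast
  then have "is_free_group (?K Mod B)"
    unfolding is_free_group_def using normal.factorgroup_is_group[OF B] by blast
  then show ?thesis unfolding virtually_Zpow_by_free_def Zpow_by_free_def using H B B_Z by blast
qed

theorem theorem4p2: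
  fixes G :: "'a monoid" and n :: nat
  assumes "n \<ge> 1" and "GBS_group n G"
  shows "subgroup_separable G \<longleftrightarrow> virtually_Zpow_by_free n G"
proof
  assume "subgroup_separable G"
  then show "virtually_Zpow_by_free n G"
    by (rule virtually_Zpow_by_free_if_subgroup_separable[OF assms])
next
  have "group G" using assms(2) by (simp add: GBS_group_def)
  then show "subgroup_separable G" if "virtually_Zpow_by_free n G"
    using that by (rule subgroup_separable_if_virtually_Zpow_by_free)
qed

end
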